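(* The theory of the variety $\mathcal V_3$ has a model completion, which is axiomatized (together with the axioms of $\mathcal V_3$) by the density axiom D3 and the splitting axiom S3.
   Context: A co-Heyting algebra is a bounded distributive lattice $(L,\mathbf{0},\mathbf{1},\vee,\wedge)$ with a binary operation $-$ such that $a-b$ is the least $c\in L$ with $a\le b\vee c$, viewed as a structure in the language $\{\mathbf 0,\mathbf 1,\vee,\wedge,-\}$. For $a,b\in L$ write $b\ll a$ iff $a-b=a$ and $b\le a$. $\mathcal V_3$ is the variety of co-Heyting algebras satisfying $\big(((\mathbf 1-x)\wedge x)-y\big)\wedge y=\mathbf 0$. Model completion is in the usual model-theoretic sense. Axiom D3: for every $a$ with $a=\mathbf 1-(\mathbf 1-a)\neq\mathbf 0$ there is $b\ne\mathbf 0$ with $b\ll a$. Axiom S3: for all $a,b_1,b_2$ with $b_1\vee b_2\ll a\ne\mathbf 0$ there are non-zero $a_1,a_2$ with $a-a_2=a_1\ge b_1$, $a-a_1=a_2\ge b_2$, and $a_1\wedge a_2=b_1\wedge b_2$. *)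

theory Defs
  imports Main
begin

section \<open>First-order logic over the language of co-Heyting algebras\<close>

datatype tm =
    Var nat
  | Zero ("\<^bold>0")
  | One ("\<^bold>1")
  | Join tm tm (infixl "\<^bold>\<squnion>" 65)
  | Meet tm tm (infixl "\<^bold>\<sqinter>" 70)
  | Diff tm tm (infixl "\<^bold>-" 75)

datatype fm =
    Eq tm tm (infix "\<^bold>=" 60)
  | Neg fm ("\<^bold>\<not> _" [58] 58)
  | Conj fm fm (infixr "\<^bold>\<and>" 55)
  | Ex nat fm

abbreviation Imp :: "fm \<Rightarrow> fm \<Rightarrow> fm" (infixr "\<^bold>\<longrightarrow>" 45)
  where "\<phi> \<^bold>\<longrightarrow> \<psi> \<equiv> \<^bold>\<not> (\<phi> \<^bold>\<and> \<^bold>\<not> \<psi>)"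

abbreviation All :: "nat \<Rightarrow> fm \<Rightarrow> fm"
  where "All n \<phi> \<equiv> \<^bold>\<not> (Ex n (\<^bold>\<not> \<phi>))"

fun vars_tm :: "tm \<Rightarrow> nat set" where
  "vars_tm (Var n) = {n}"
| "vars_tm \<^bold>0 = {}"
| "vars_tm \<^bold>1 = {}"
| "vars_tm (s \<^bold>\<squnion> t) = vars_tm s \<union> vars_tm t"
| "vars_tm (s \<^bold>\<sqinter> t) = vars_tm s \<union> vars_tm t"
| "vars_tm (s \<^bold>- t) = vars_tm s \<union> vars_tm t"

fun free_vars :: "fm \<Rightarrow> nat set" where
  "free_vars (s \<^bold>= t) = vars_tm s \<union> vars_tm t"
| "free_vars (\<^bold>\<not> \<phi>) = free_vars \<phi>"
| "free_vars (\<phi> \<^bold>\<and> \<psi>) = free_vars \<phi> \<union> free_vars \<psi>"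
| "free_vars (Ex n \<phi>) = free_vars \<phi> - {n}"

definition is_theory :: "fm set \<Rightarrow> bool" where
  "is_theory T \<longleftrightarrow> (\<forall>\<phi>\<in>T. free_vars \<phi> = {})"

record 'a coh_structure =
  carrier :: "'a set"
  zeroS :: 'a
  oneS :: 'a
  joinS :: "'a \<Rightarrow> 'a \<Rightarrow> 'a"
  meetS :: "'a \<Rightarrow> 'a \<Rightarrow> 'a"
  diffS :: "'a \<Rightarrow> 'a \<Rightarrow> 'a"

definition is_structure :: "'a coh_structure \<Rightarrow> bool" where
  "is_structure M \<longleftrightarrow>
     zeroS M \<in> carrier M \<and> oneS M \<in> carrier M \<and>
     (\<forall>x\<in>carrier M. \<forall>y\<in>carrier M.
        joinS M x y \<in> carrier M \<and> meetS M x y \<in> carrier M \<and> diffS M x y \<in> carrier M)"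

fun eval_tm :: "'a coh_structure \<Rightarrow> (nat \<Rightarrow> 'a) \<Rightarrow> tm \<Rightarrow> 'a" where
  "eval_tm M e (Var n) = e n"
| "eval_tm M e \<^bold>0 = zeroS M"
| "eval_tm M e \<^bold>1 = oneS M"
| "eval_tm M e (s \<^bold>\<squnion> t) = joinS M (eval_tm M e s) (eval_tm M e t)"
| "eval_tm M e (s \<^bold>\<sqinter> t) = meetS M (eval_tm M e s) (eval_tm M e t)"
| "eval_tm M e (s \<^bold>- t) = diffS M (eval_tm M e s) (eval_tm M e t)"

fun sat :: "'a coh_structure \<Rightarrow> (nat \<Rightarrow> 'a) \<Rightarrow> fm \<Rightarrow> bool" where
  "sat M e (s \<^bold>= t) \<longleftrightarrow> eval_tm M e s = eval_tm M e t"
| "sat M e (\<^bold>\<not> \<phi>) \<longleftrightarrow> \<not> sat M e \<phi>"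
| "sat M e (\<phi> \<^bold>\<and> \<psi>) \<longleftrightarrow> sat M e \<phi> \<and> sat M e \<psi>"
| "sat M e (Ex n \<phi>) \<longleftrightarrow> (\<exists>x\<in>carrier M. sat M (e(n := x)) \<phi>)"

definition is_model :: "'a coh_structure \<Rightarrow> fm set \<Rightarrow> bool" where
  "is_model M T \<longleftrightarrow>
     is_structure M \<and> (\<forall>\<phi>\<in>T. \<forall>e. range e \<subseteq> carrier M \<longrightarrow> sat M e \<phi>)"

definition is_embedding :: "('a \<Rightarrow> 'b) \<Rightarrow> 'a coh_structure \<Rightarrow> 'b coh_structure \<Rightarrow> bool" where
  "is_embedding f M N \<longleftrightarrow>
     f ` carrier M \<subseteq> carrier N \<and> inj_on f (carrier M) \<and>
     f (zeroS M) = zeroS N \<and> f (oneS M) = oneS N \<and>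
     (\<forall>x\<in>carrier M. \<forall>y\<in>carrier M.
        f (joinS M x y) = joinS N (f x) (f y) \<and>
        f (meetS M x y) = meetS N (f x) (f y) \<and>
        f (diffS M x y) = diffS N (f x) (f y))"


section \<open>Model completions\<close>

text \<open>
  \<open>T'\<close> is a model completion of \<open>T\<close> if \<open>T'\<close> entails \<open>T\<close>, every model of \<open>T\<close> embeds into a
  model of \<open>T'\<close>, and \<open>T'\<close> together with the diagram of \<open>M\<close> is complete for every model \<open>M\<close>
  of \<open>T\<close>. A model of that union is a model \<open>N\<close> of \<open>T'\<close> with an embedding \<open>f\<close> of \<open>M\<close>, and a
  sentence with parameters from \<open>M\<close> is a formula \<open>\<phi>\<close> with an assignment \<open>e\<close> into \<open>M\<close>.

  HOL cannot quantify over types, so all structures have their carrier inside one type \<open>'u\<close>.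
  The notion is meant for infinite \<open>'u\<close>: the language is countable, so by
  Loewenheim-Skolem no extension of a structure inside \<open>'u\<close> need be larger than \<open>'u\<close>, and
  holding for all infinite \<open>'u\<close> amounts to the usual notion.
\<close>

definition model_completion :: "'u itself \<Rightarrow> fm set \<Rightarrow> fm set \<Rightarrow> bool" where
  "model_completion _ T' T \<longleftrightarrow>
     is_theory T \<and> is_theory T' \<and>
     (\<forall>M :: 'u coh_structure. is_model M T' \<longrightarrow> is_model M T) \<and>
     (\<forall>M :: 'u coh_structure. is_model M T \<longrightarrow>
        (\<exists>(N :: 'u coh_structure) f. is_model N T' \<and> is_embedding f M N)) \<and>
     (\<forall>(M :: 'u coh_structure) (N1 :: 'u coh_structure) (N2 :: 'u coh_structure) f1 f2 \<phi> e.
        is_model M T \<and> is_model N1 T' \<and> is_model N2 T' \<and>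
        is_embedding f1 M N1 \<and> is_embedding f2 M N2 \<and> range e \<subseteq> carrier M \<longrightarrow>
        sat N1 (f1 \<circ> e) \<phi> = sat N2 (f2 \<circ> e) \<phi>)"


section \<open>The theory of the variety and the two axioms\<close>

abbreviation Le :: "tm \<Rightarrow> tm \<Rightarrow> fm" (infix "\<^bold>\<le>" 60)
  where "s \<^bold>\<le> t \<equiv> (s \<^bold>\<sqinter> t) \<^bold>= s"

abbreviation LL :: "tm \<Rightarrow> tm \<Rightarrow> fm" (infix "\<^bold>\<lless>" 60)
  where "t \<^bold>\<lless> s \<equiv> (s \<^bold>- t \<^bold>= s) \<^bold>\<and> (t \<^bold>\<le> s)"

definition coHeyting_theory :: "fm set" where
  "coHeyting_theory =
     (let x = Var 0; y = Var 1; z = Var 2; cl = (\<lambda>\<phi>. All 0 (All 1 (All 2 \<phi>))) in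
      {cl (x \<^bold>\<squnion> (y \<^bold>\<squnion> z) \<^bold>= (x \<^bold>\<squnion> y) \<^bold>\<squnion> z),
       cl (x \<^bold>\<squnion> y \<^bold>= y \<^bold>\<squnion> x),
       cl (x \<^bold>\<sqinter> (y \<^bold>\<sqinter> z) \<^bold>= (x \<^bold>\<sqinter> y) \<^bold>\<sqinter> z),
       cl (x \<^bold>\<sqinter> y \<^bold>= y \<^bold>\<sqinter> x),
       cl (x \<^bold>\<squnion> (x \<^bold>\<sqinter> y) \<^bold>= x),
       cl (x \<^bold>\<sqinter> (x \<^bold>\<squnion> y) \<^bold>= x),
       cl (x \<^bold>\<sqinter> (y \<^bold>\<squnion> z) \<^bold>= (x \<^bold>\<sqinter> y) \<^bold>\<squnion> (x \<^bold>\<sqinter> z)),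
       cl (\<^bold>0 \<^bold>\<le> x),
       cl (x \<^bold>\<le> \<^bold>1),
       cl (x \<^bold>\<le> y \<^bold>\<squnion> (x \<^bold>- y)),
       cl ((x \<^bold>\<le> y \<^bold>\<squnion> z) \<^bold>\<longrightarrow> (x \<^bold>- y \<^bold>\<le> z))})"

definition V3_theory :: "fm set" where
  "V3_theory = coHeyting_theory \<union>
     (let x = Var 0; y = Var 1 in
      {All 0 (All 1 (((((\<^bold>1 \<^bold>- x) \<^bold>\<sqinter> x) \<^bold>- y) \<^bold>\<sqinter> y) \<^bold>= \<^bold>0))})"

definition axiom_D3 :: fm where
  "axiom_D3 =
     (let a = Var 0; b = Var 1 in
      All 0 ((a \<^bold>= \<^bold>1 \<^bold>- (\<^bold>1 \<^bold>- a)) \<^bold>\<and> \<^bold>\<not> (a \<^bold>= \<^bold>0) \<^bold>\<longrightarrow>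
        Ex 1 (\<^bold>\<not> (b \<^bold>= \<^bold>0) \<^bold>\<and> (b \<^bold>\<lless> a))))"

definition axiom_S3 :: fm where
  "axiom_S3 =
     (let a = Var 0; b1 = Var 1; b2 = Var 2; a1 = Var 3; a2 = Var 4 in
      All 0 (All 1 (All 2 ((b1 \<^bold>\<squnion> b2 \<^bold>\<lless> a) \<^bold>\<and> \<^bold>\<not> (a \<^bold>= \<^bold>0) \<^bold>\<longrightarrow>
        Ex 3 (Ex 4 (\<^bold>\<not> (a1 \<^bold>= \<^bold>0) \<^bold>\<and> \<^bold>\<not> (a2 \<^bold>= \<^bold>0) \<^bold>\<and>
          (a \<^bold>- a2 \<^bold>= a1) \<^bold>\<and> (b1 \<^bold>\<le> a1) \<^bold>\<and>
          (a \<^bold>- a1 \<^bold>= a2) \<^bold>\<and> (b2 \<^bold>\<le> a2) \<^bold>\<and>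
          (a1 \<^bold>\<sqinter> a2 \<^bold>= b1 \<^bold>\<sqinter> b2)))))))"


section \<open>Semantic readings of the axioms\<close>

definition leS :: "'a coh_structure \<Rightarrow> 'a \<Rightarrow> 'a \<Rightarrow> bool" where
  "leS M x y \<longleftrightarrow> meetS M x y = x"

definition llS :: "'a coh_structure \<Rightarrow> 'a \<Rightarrow> 'a \<Rightarrow> bool" where
  "llS M b a \<longleftrightarrow> diffS M a b = a \<and> leS M b a"

lemma is_theory_axioms:
  "is_theory V3_theory" "is_theory (V3_theory \<union> {axiom_D3, axiom_S3})"
  by (auto simp: is_theory_def V3_theory_def coHeyting_theory_def axiom_D3_def axiom_S3_def Let_def)

lemma ex_assignment:
  assumes "is_structure M"
  shows "\<exists>e :: nat \<Rightarrow> 'a. range e \<subseteq> carrier (M :: 'a coh_structure)"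
  using assms by (intro exI[of _ "\<lambda>_. zeroS M"]) (auto simp: is_structure_def)

lemma is_model_coHeyting_iff:
  "is_model M coHeyting_theory \<longleftrightarrow> is_structure M \<and>
     (\<forall>x\<in>carrier M. \<forall>y\<in>carrier M. \<forall>z\<in>carrier M.
        joinS M x (joinS M y z) = joinS M (joinS M x y) z \<and>
        joinS M x y = joinS M y x \<and>
        meetS M x (meetS M y z) = meetS M (meetS M x y) z \<and>
        meetS M x y = meetS M y x \<and>
        joinS M x (meetS M x y) = x \<and>
        meetS M x (joinS M x y) = x \<and>
        meetS M x (joinS M y z) = joinS M (meetS M x y) (meetS M x z) \<and>
        leS M (zeroS M) x \<and> leS M x (oneS M) \<and>
        leS M x (joinS M y (diffS M x y)) \<and>
        (leS M x (joinS M y z) \<longrightarrow> leS M (diffS M x y) z))"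
proof (cases "is_structure M")
  case True
  then have ne: "\<exists>z. z \<in> carrier M" "carrier M \<noteq> {}" by (auto simp: is_structure_def)
  show ?thesis using True ne ex_assignment[OF True]
    unfolding is_model_def coHeyting_theory_def Let_def leS_def
    by (simp add: ball_conj_distrib)
qed (simp add: is_model_def)

lemma is_model_V3_iff:
  "is_model M V3_theory \<longleftrightarrow> is_model M coHeyting_theory \<and>
     (\<forall>x\<in>carrier M. \<forall>y\<in>carrier M.
        meetS M (diffS M (meetS M (diffS M (oneS M) x) x) y) y = zeroS M)"
proof (cases "is_structure M")
  case True
  then show ?thesis using ex_assignment[OF True]
    unfolding is_model_def V3_theory_def Let_def by auto
qed (simp add: is_model_def)

lemma sat_D3_iff:
  "sat M e axiom_D3 \<longleftrightarrow>
     (\<forall>a\<in>carrier M. a = diffS M (oneS M) (diffS M (oneS M) a) \<and> a \<noteq> zeroS M \<longrightarrow>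
        (\<exists>b\<in>carrier M. b \<noteq> zeroS M \<and> llS M b a))"
  by (auto simp: axiom_D3_def Let_def llS_def leS_def)

lemma sat_S3_iff:
  "sat M e axiom_S3 \<longleftrightarrow>
     (\<forall>a\<in>carrier M. \<forall>b1\<in>carrier M. \<forall>b2\<in>carrier M.
        llS M (joinS M b1 b2) a \<and> a \<noteq> zeroS M \<longrightarrow>
        (\<exists>a1\<in>carrier M. \<exists>a2\<in>carrier M. a1 \<noteq> zeroS M \<and> a2 \<noteq> zeroS M \<and>
           diffS M a a2 = a1 \<and> leS M b1 a1 \<and>
           diffS M a a1 = a2 \<and> leS M b2 a2 \<and>
           meetS M a1 a2 = meetS M b1 b2))"
  unfolding axiom_S3_def Let_def llS_def leS_def by simp blast

end

(*
  A co-Heyting algebra in V3 is an algebra of down-sets of a poset of depth two (its prime ideals,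
  ordered by inclusion), in which a - b is the down-closure of the set difference.

  Completeness over the diagram is a back-and-forth argument between finite subalgebras. Such a
  subalgebra is given by its join irreducible elements, i.e. by a finite poset of depth two (a
  pattern) realized in the algebra: regular elements that partition the maximal points, and disjoint
  elements without maximal points. Every element of a V3-algebra lies in the span of a refinement of
  a given realized pattern, and the refinement is a chain of three elementary steps: split a
  non-maximal piece, add a new non-maximal piece below one maximal piece, split a maximal piece with
  a prescribed distribution of the pieces below it. S3 and D3 say exactly that each of these steps can
  be copied in a model.

  For the existence of extensions, replace the poset by a space of infinite paths that extend its
  points, and take the down-sets that depend on finitely many letters only. One more letter offers
  all choices needed for an instance of D3 or S3. A downward Loewenheim-Skolem argument brings the
  resulting model back into the given type.
*)

theory Submission
  imports Defs
begin

text \<open>In the completeness part the points of two models are never related to each other. Only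
  named pieces are, and assignments are replaced by codes in a pattern, which have a meaning on both
  sides.

  The extension is shaped by the rigid conclusion that \<open>a1\<close> and \<open>a2\<close> meet
  exactly in the meet of \<open>b1\<close> and \<open>b2\<close>. A maximal point of
  \<open>a\<close> above one point in \<open>b1\<close> only and another in \<open>b2\<close> only
  could be in neither half. So S3 forbids a maximal point with two lower points that elements of the
  algebra tell apart, and the given poset, where such points may occur, must first be unravelled: up
  to equivalence a path has at most one lower point below it. Letters supply the choices. A
  component that the lower point remembers sends it, with all paths above it, to one half. A
  component that it forgets lets the paths above a point of both \<open>b1\<close> and
  \<open>b2\<close> go to different halves. The letter \<open>None\<close> frees a path from a lower
  point whose half is prescribed, which keeps the other half non-empty.\<close>

lemma eval_tm_cong:
  "(\<And>v. v \<in> vars_tm t \<Longrightarrow> e v = e' v) \<Longrightarrow> eval_tm M e t = eval_tm M e' t"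
  by (induction t) auto

lemma sat_cong:
  "(\<And>v. v \<in> free_vars \<phi> \<Longrightarrow> e v = e' v) \<Longrightarrow> sat M e \<phi> \<longleftrightarrow> sat M e' \<phi>"
proof (induction \<phi> arbitrary: e e')
  case (Eq s t)
  then show ?case using eval_tm_cong[of s e e'] eval_tm_cong[of t e e'] by auto
next
  case (Neg \<phi>)
  from Neg.IH[of e e'] Neg.prems show ?case by auto
next
  case (Conj \<phi> \<psi>)
  from Conj.IH[of e e'] Conj.prems show ?case by auto
next
  case (Ex n \<phi>)
  have "sat M (e(n := x)) \<phi> \<longleftrightarrow> sat M (e'(n := x)) \<phi>" for x
    using Ex.prems by (intro Ex.IH) auto
  then show ?case by simp
qed

lemma eval_tm_in_carrier:
  "is_structure M \<Longrightarrow> range e \<subseteq> carrier M \<Longrightarrow> eval_tm M e t \<in> carrier M"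
  by (induction t) (auto simp: is_structure_def)

lemma eval_tm_embedding:
  assumes "is_structure M" "is_embedding f M N" "range e \<subseteq> carrier M"
  shows "eval_tm N (f \<circ> e) t = f (eval_tm M e t)"
  using eval_tm_in_carrier[OF assms(1,3)] assms(2)
  by (induction t) (auto simp: is_embedding_def)

lemma is_embedding_comp:
  assumes "is_structure M" "is_embedding f M N" "is_embedding g N P"
  shows "is_embedding (g \<circ> f) M P"
  using assms unfolding is_embedding_def is_structure_def
  by (auto simp: image_subset_iff intro: comp_inj_on inj_on_subset)

lemma sat_iso:
  assumes "is_structure M" "is_embedding f M N" "f ` carrier M = carrier N"
  shows "range e \<subseteq> carrier M \<Longrightarrow> sat N (f \<circ> e) \<phi> \<longleftrightarrow> sat M e \<phi>"
proof (induction \<phi> arbitrary: e)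
  case (Eq s t)
  have "inj_on f (carrier M)" using assms(2) by (simp add: is_embedding_def)
  then show ?case
    using eval_tm_in_carrier[OF assms(1) Eq]
    unfolding sat.simps eval_tm_embedding[OF assms(1,2) Eq] by (simp add: inj_on_eq_iff)
next
  case (Ex n \<phi>)
  have "sat N ((f \<circ> e)(n := f x)) \<phi> \<longleftrightarrow> sat M (e(n := x)) \<phi>" if "x \<in> carrier M" for x
  proof -
    have "(f \<circ> e)(n := f x) = f \<circ> e(n := x)" by auto
    moreover have "range (e(n := x)) \<subseteq> carrier M" using Ex.prems that by auto
    ultimately show ?thesis using Ex.IH by metis
  qed
  then show ?case unfolding sat.simps assms(3)[symmetric] by simp
qed auto

lemma is_model_iso:
  assumes "is_model M T" "is_embedding f M N" "f ` carrier M = carrier N"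
  shows "is_model N T"
proof -
  have M: "is_structure M" using assms(1) by (simp add: is_model_def)
  have "is_structure N"
    using M assms(2) unfolding is_structure_def is_embedding_def assms(3)[symmetric]
    by (auto simp: image_iff) metis+
  moreover have "sat N e \<phi>" if "\<phi> \<in> T" "range e \<subseteq> carrier N" for \<phi> e
  proof -
    define e' where "e' = inv_into (carrier M) f \<circ> e"
    have r: "range e' \<subseteq> carrier M"
      using that(2) assms(3) by (auto simp: e'_def image_subset_iff intro!: inv_into_into)
    have "f \<circ> e' = e"
      using that(2) assms(3) by (auto simp: e'_def fun_eq_iff image_subset_iff intro!: f_inv_into_f)
    then show ?thesis
      using sat_iso[OF M assms(2,3) r, of \<phi>] assms(1) that(1) r by (simp add: is_model_def)
  qed
  ultimately show ?thesis by (simp add: is_model_def)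
qed

section \<open>Algebras of down-sets\<close>

definition set_str :: "'p set \<Rightarrow> ('p \<Rightarrow> 'p \<Rightarrow> bool) \<Rightarrow> 'p set set \<Rightarrow> 'p set coh_structure" where
  "set_str X le A = \<lparr>carrier = A, zeroS = {}, oneS = X, joinS = (\<union>), meetS = (\<inter>),
     diffS = (\<lambda>a b. {p \<in> X. \<exists>q\<in>a - b. le p q})\<rparr>"

lemma set_str_simps [simp]:
  "carrier (set_str X le A) = A" "zeroS (set_str X le A) = {}" "oneS (set_str X le A) = X"
  "joinS (set_str X le A) = (\<union>)" "meetS (set_str X le A) = (\<inter>)"
  "diffS (set_str X le A) a b = {p \<in> X. \<exists>q\<in>a - b. le p q}"
  by (simp_all add: set_str_def)

lemma leS_set_str [simp]: "leS (set_str X le A) a b \<longleftrightarrow> a \<subseteq> b"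
  by (auto simp: leS_def)

text \<open>Antisymmetry is left out because the path model has only a preorder. Depth two is
  phrased accordingly: of two consecutive steps one can be reversed.\<close>

locale down_algebra =
  fixes X :: "'p set" and le :: "'p \<Rightarrow> 'p \<Rightarrow> bool" and A :: "'p set set"
  assumes A_sub: "a \<in> A \<Longrightarrow> a \<subseteq> X"
    and A_down: "a \<in> A \<Longrightarrow> q \<in> a \<Longrightarrow> p \<in> X \<Longrightarrow> le p q \<Longrightarrow> p \<in> a"
    and le_refl: "p \<in> X \<Longrightarrow> le p p"
    and le_trans: "p \<in> X \<Longrightarrow> q \<in> X \<Longrightarrow> r \<in> X \<Longrightarrow> le p q \<Longrightarrow> le q r \<Longrightarrow> le p r"
    and depth: "p \<in> X \<Longrightarrow> q \<in> X \<Longrightarrow> r \<in> X \<Longrightarrow> le p q \<Longrightarrow> le q r \<Longrightarrow> le q p \<or> le r q"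
    and empty_A [simp]: "{} \<in> A" and top_A [simp]: "X \<in> A"
    and Un_A [simp]: "a \<in> A \<Longrightarrow> b \<in> A \<Longrightarrow> a \<union> b \<in> A"
    and Int_A [simp]: "a \<in> A \<Longrightarrow> b \<in> A \<Longrightarrow> a \<inter> b \<in> A"
    and diff_A: "a \<in> A \<Longrightarrow> b \<in> A \<Longrightarrow> {p \<in> X. \<exists>q\<in>a - b. le p q} \<in> A"
begin

text \<open>A counterexample to the identity of the variety would be a chain \<open>p\<close>,
  \<open>q\<close>, \<open>r\<close> with \<open>p\<close> in \<open>y\<close>, \<open>q\<close> in
  \<open>x - y\<close> and \<open>r\<close> outside \<open>x\<close>. As \<open>x\<close> and
  \<open>y\<close> are down-sets, neither step could be reversed, against
  \<open>depth\<close>.\<close>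

lemma model_V3: "is_model (set_str X le A) V3_theory"
proof -
  have "is_structure (set_str X le A)" by (simp add: is_structure_def diff_A)
  moreover have "a \<subseteq> b \<union> {p \<in> X. \<exists>q\<in>a - b. le p q}" if "a \<in> A" for a b
    using A_sub[OF that] le_refl by blast
  moreover have "{p \<in> X. \<exists>q\<in>a - b. le p q} \<subseteq> c" if "a \<subseteq> b \<union> c" "c \<in> A" for a b c
    using that A_down by blast
  moreover have "{p \<in> X. \<exists>q\<in>({p \<in> X. \<exists>q\<in>X - x. le p q} \<inter> x) - y. le p q} \<inter> y = {}"
    if "x \<in> A" "y \<in> A" for x y
  proof -
    have False if "p \<in> X" "q \<in> X" "r \<in> X - x" "le q r" "q \<in> x" "q \<notin> y" "le p q" "p \<in> y" for p q r
    proof -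
      have "le q p \<or> le r q" using depth that by blast
      then show False
        using that \<open>x \<in> A\<close> \<open>y \<in> A\<close> A_down by blast
    qed
    then show ?thesis by blast
  qed
  ultimately show ?thesis
    unfolding is_model_V3_iff is_model_coHeyting_iff
    by (auto simp: A_sub dest: A_sub)
qed

end

section \<open>Representation by prime ideals\<close>

locale coheyting =
  fixes M :: "'u coh_structure"
  assumes model: "is_model M V3_theory"
begin

abbreviation "L \<equiv> carrier M"
abbreviation jn (infixl "\<squnion>" 65) where "x \<squnion> y \<equiv> joinS M x y"
abbreviation mt (infixl "\<sqinter>" 70) where "x \<sqinter> y \<equiv> meetS M x y"
abbreviation df (infixl "\<ominus>" 65) where "x \<ominus> y \<equiv> diffS M x y"
abbreviation lq (infix "\<sqsubseteq>" 50) where "x \<sqsubseteq> y \<equiv> leS M x y"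

lemma struct: "is_structure M"
  using model by (simp add: is_model_def)

lemma closed [simp]:
  "zeroS M \<in> L" "oneS M \<in> L" "x \<in> L \<Longrightarrow> y \<in> L \<Longrightarrow> x \<squnion> y \<in> L"
  "x \<in> L \<Longrightarrow> y \<in> L \<Longrightarrow> x \<sqinter> y \<in> L" "x \<in> L \<Longrightarrow> y \<in> L \<Longrightarrow> x \<ominus> y \<in> L"
  using struct by (auto simp: is_structure_def)

lemma laws:
  assumes "x \<in> L" "y \<in> L" "z \<in> L"
  shows "x \<squnion> (y \<squnion> z) = x \<squnion> y \<squnion> z" "x \<squnion> y = y \<squnion> x"
    "x \<sqinter> (y \<sqinter> z) = x \<sqinter> y \<sqinter> z" "x \<sqinter> y = y \<sqinter> x" "x \<squnion> x \<sqinter> y = x" "x \<sqinter> (x \<squnion> y) = x"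
    "x \<sqinter> (y \<squnion> z) = x \<sqinter> y \<squnion> x \<sqinter> z" "zeroS M \<sqsubseteq> x" "x \<sqsubseteq> oneS M" "x \<sqsubseteq> y \<squnion> (x \<ominus> y)"
    "x \<sqsubseteq> y \<squnion> z \<Longrightarrow> x \<ominus> y \<sqsubseteq> z"
  using model assms unfolding is_model_V3_iff is_model_coHeyting_iff by blast+

lemma V3_law: "x \<in> L \<Longrightarrow> y \<in> L \<Longrightarrow> (((oneS M \<ominus> x) \<sqinter> x) \<ominus> y) \<sqinter> y = zeroS M"
  using model unfolding is_model_V3_iff by blast

lemma le_refl: "x \<in> L \<Longrightarrow> x \<sqsubseteq> x"
  unfolding leS_def using laws(5)[of x x x] laws(6)[of x "x \<sqinter> x" x] by simp

lemma le_antisym: "x \<in> L \<Longrightarrow> y \<in> L \<Longrightarrow> x \<sqsubseteq> y \<Longrightarrow> y \<sqsubseteq> x \<Longrightarrow> x = y"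
  unfolding leS_def using laws(4) by metis

lemma le_trans: "x \<in> L \<Longrightarrow> y \<in> L \<Longrightarrow> z \<in> L \<Longrightarrow> x \<sqsubseteq> y \<Longrightarrow> y \<sqsubseteq> z \<Longrightarrow> x \<sqsubseteq> z"
  unfolding leS_def using laws(3) by metis

lemma le_join: "x \<in> L \<Longrightarrow> y \<in> L \<Longrightarrow> x \<sqsubseteq> x \<squnion> y" "x \<in> L \<Longrightarrow> y \<in> L \<Longrightarrow> y \<sqsubseteq> x \<squnion> y"
  unfolding leS_def using laws(2,6) by metis+

lemma le_iff_join: "x \<in> L \<Longrightarrow> y \<in> L \<Longrightarrow> x \<sqsubseteq> y \<longleftrightarrow> x \<squnion> y = y"
  unfolding leS_def using laws(2,4,5,6) by metis

lemma join_least: "x \<in> L \<Longrightarrow> y \<in> L \<Longrightarrow> z \<in> L \<Longrightarrow> x \<sqsubseteq> z \<Longrightarrow> y \<sqsubseteq> z \<Longrightarrow> x \<squnion> y \<sqsubseteq> z"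
  using laws(1) by (metis closed(3) le_iff_join)

lemma meet_le: "x \<in> L \<Longrightarrow> y \<in> L \<Longrightarrow> x \<sqinter> y \<sqsubseteq> x" "x \<in> L \<Longrightarrow> y \<in> L \<Longrightarrow> x \<sqinter> y \<sqsubseteq> y"
  unfolding leS_def using laws(3,4) le_refl[unfolded leS_def] by (metis closed(4))+

lemma le_meet: "x \<in> L \<Longrightarrow> y \<in> L \<Longrightarrow> z \<in> L \<Longrightarrow> x \<sqsubseteq> y \<Longrightarrow> x \<sqsubseteq> z \<Longrightarrow> x \<sqsubseteq> y \<sqinter> z"
  unfolding leS_def using laws(3) by metis

lemma join_mono: "x \<in> L \<Longrightarrow> y \<in> L \<Longrightarrow> z \<in> L \<Longrightarrow> x \<sqsubseteq> y \<Longrightarrow> x \<squnion> z \<sqsubseteq> y \<squnion> z"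
  using le_trans[of x y "y \<squnion> z"] le_join[of y z] by (intro join_least) auto

definition ideal :: "'u set \<Rightarrow> bool" where
  "ideal I \<longleftrightarrow> I \<subseteq> L \<and> zeroS M \<in> I \<and> (\<forall>x\<in>I. \<forall>y\<in>I. x \<squnion> y \<in> I) \<and>
     (\<forall>y\<in>I. \<forall>x\<in>L. x \<sqsubseteq> y \<longrightarrow> x \<in> I)"

definition primes :: "'u set set" where
  "primes = {I. ideal I \<and> oneS M \<notin> I \<and> (\<forall>x\<in>L. \<forall>y\<in>L. x \<sqinter> y \<in> I \<longrightarrow> x \<in> I \<or> y \<in> I)}"

definition adjoin :: "'u set \<Rightarrow> 'u \<Rightarrow> 'u set" where
  "adjoin I b = {x \<in> L. \<exists>i\<in>I. x \<sqsubseteq> i \<squnion> b}"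

lemma ideal_adjoin:
  assumes I: "ideal I" and b: "b \<in> L"
  shows "ideal (adjoin I b)" "I \<subseteq> adjoin I b" "b \<in> adjoin I b"
proof -
  have IL: "I \<subseteq> L" and z: "zeroS M \<in> I" and
    j: "\<And>x y. x \<in> I \<Longrightarrow> y \<in> I \<Longrightarrow> x \<squnion> y \<in> I"
    using I by (auto simp: ideal_def)
  show sub: "I \<subseteq> adjoin I b"
    using IL b le_join(1) unfolding adjoin_def by blast
  show "b \<in> adjoin I b"
    using z b le_join closed(1) unfolding adjoin_def by blast
  have "x \<squnion> y \<in> adjoin I b" if "x \<in> adjoin I b" "y \<in> adjoin I b" for x y
  proof -
    from that obtain i k where ik: "i \<in> I" "k \<in> I" "x \<sqsubseteq> i \<squnion> b" "y \<sqsubseteq> k \<squnion> b" "x \<in> L" "y \<in> L"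
      by (auto simp: adjoin_def)
    then have L: "i \<in> L" "k \<in> L" using IL by auto
    have "i \<squnion> b \<sqsubseteq> (i \<squnion> k) \<squnion> b" "k \<squnion> b \<sqsubseteq> (i \<squnion> k) \<squnion> b"
      using le_join L b by (auto intro!: join_mono)
    then have "x \<squnion> y \<sqsubseteq> (i \<squnion> k) \<squnion> b"
      using L ik b le_trans[of x "i \<squnion> b"] le_trans[of y "k \<squnion> b"] by (intro join_least) auto
    then show ?thesis using ik j by (auto simp: adjoin_def)
  qed
  moreover have "x \<in> adjoin I b" if "y \<in> adjoin I b" "x \<in> L" "x \<sqsubseteq> y" for x y
  proof -
    from that(1) obtain i where i: "i \<in> I" "y \<sqsubseteq> i \<squnion> b" "y \<in> L" by (auto simp: adjoin_def)
    moreover have "i \<squnion> b \<in> L" using IL i b by auto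
    ultimately have "x \<sqsubseteq> i \<squnion> b" using le_trans[of x y "i \<squnion> b"] that by simp
    with i that show ?thesis by (auto simp: adjoin_def)
  qed
  ultimately show "ideal (adjoin I b)"
    using sub z unfolding ideal_def adjoin_def[of I b] by blast
qed

text \<open>Zorn gives an ideal \<open>P\<close> maximal among those that contain \<open>I\<close>
  and miss \<open>a\<close>. It is prime: if \<open>x\<close> and \<open>y\<close> are outside
  \<open>P\<close>, then \<open>a\<close> lies below the joins of both with a common
  \<open>m\<close> in \<open>P\<close>, hence by distributivity below the join of \<open>m\<close>
  with the meet of \<open>x\<close> and \<open>y\<close>. So this meet is not in
  \<open>P\<close>.\<close>

lemma prime_extension:
  assumes I: "ideal I" and a: "a \<in> L" "a \<notin> I"
  shows "\<exists>P\<in>primes. I \<subseteq> P \<and> a \<notin> P"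
proof -
  define F where "F = {J. ideal J \<and> I \<subseteq> J \<and> a \<notin> J}"
  have "\<exists>P\<in>F. \<forall>J\<in>F. P \<subseteq> J \<longrightarrow> J = P"
  proof (rule subset_Zorn_nonempty)
    show "F \<noteq> {}" using I a by (auto simp: F_def)
    fix \<C> assume C: "\<C> \<noteq> {}" "subset.chain F \<C>"
    have idJ: "ideal J" if "J \<in> \<C>" for J using C(2) that by (auto simp: subset_chain_def F_def)
    obtain J0 where "J0 \<in> \<C>" using C(1) by auto
    have "ideal (\<Union>\<C>)"
      unfolding ideal_def
    proof (intro conjI ballI impI)
      show "\<Union>\<C> \<subseteq> L" "zeroS M \<in> \<Union>\<C>"
        using idJ \<open>J0 \<in> \<C>\<close> unfolding ideal_def by blast+
      show "x \<in> \<Union>\<C>" if "y \<in> \<Union>\<C>" "x \<in> L" "x \<sqsubseteq> y" for x y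
        using idJ that unfolding ideal_def by blast
    next
      fix x y assume "x \<in> \<Union>\<C>" "y \<in> \<Union>\<C>"
      then obtain J1 J2 where J: "J1 \<in> \<C>" "J2 \<in> \<C>" "x \<in> J1" "y \<in> J2" by blast
      then have "J1 \<subseteq> J2 \<or> J2 \<subseteq> J1"
        using C(2) unfolding subset_chain_def by blast
      then obtain J where "J \<in> \<C>" "x \<in> J" "y \<in> J" using J by blast
      then show "x \<squnion> y \<in> \<Union>\<C>"
        using idJ by (auto simp: ideal_def)
    qed
    then show "\<Union>\<C> \<in> F"
      using C unfolding subset_chain_def F_def by auto
  qed
  then obtain P where P: "P \<in> F" and max: "\<And>J. J \<in> F \<Longrightarrow> P \<subseteq> J \<Longrightarrow> J = P" by blast
  have id: "ideal P" "I \<subseteq> P" "a \<notin> P" using P by (auto simp: F_def)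
  then have PL: "P \<subseteq> L" by (auto simp: ideal_def)
  have gen: "\<exists>i\<in>P. a \<sqsubseteq> i \<squnion> x" if "x \<in> L" "x \<notin> P" for x
  proof (rule ccontr)
    assume "\<not> ?thesis"
    then have "a \<notin> adjoin P x" by (auto simp: adjoin_def)
    then have "adjoin P x \<in> F"
      using ideal_adjoin[OF id(1) that(1)] id by (auto simp: F_def)
    then show False
      using max ideal_adjoin[OF id(1) that(1)] that(2) by blast
  qed
  have "x \<in> P \<or> y \<in> P" if xy: "x \<in> L" "y \<in> L" "x \<sqinter> y \<in> P" for x y
  proof (rule ccontr)
    assume "\<not> (x \<in> P \<or> y \<in> P)"
    then obtain i k where ik: "i \<in> P" "k \<in> P" "a \<sqsubseteq> i \<squnion> x" "a \<sqsubseteq> k \<squnion> y"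
      using gen xy by metis
    define m where "m = i \<squnion> k"
    have m: "m \<in> P" "i \<in> L" "k \<in> L" "m \<in> L"
      using ik id PL by (auto simp: m_def ideal_def)
    have "i \<squnion> x \<sqsubseteq> m \<squnion> x" "k \<squnion> y \<sqsubseteq> m \<squnion> y"
      using le_join m xy unfolding m_def by (auto intro!: join_mono)
    then have "a \<sqsubseteq> m \<squnion> x" "a \<sqsubseteq> m \<squnion> y"
      using le_trans[of a "i \<squnion> x"] le_trans[of a "k \<squnion> y"] ik a m xy by auto
    then have "a \<sqsubseteq> (m \<squnion> x) \<sqinter> (m \<squnion> y)"
      using le_meet a m xy closed(3) by simp
    moreover have "(m \<squnion> x) \<sqinter> (m \<squnion> y) \<sqsubseteq> m \<squnion> x \<sqinter> y"
    proof -
      have "(m \<squnion> x) \<sqinter> (m \<squnion> y) = (m \<squnion> x) \<sqinter> m \<squnion> (m \<squnion> x) \<sqinter> y"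
        using laws(7) m xy closed(3) by simp
      also have "(m \<squnion> x) \<sqinter> y = y \<sqinter> m \<squnion> y \<sqinter> x"
        using laws(4)[of "m \<squnion> x" y y] laws(7)[of y m x] m xy by simp
      finally have eq: "(m \<squnion> x) \<sqinter> (m \<squnion> y) = (m \<squnion> x) \<sqinter> m \<squnion> (y \<sqinter> m \<squnion> y \<sqinter> x)" .
      have 1: "(m \<squnion> x) \<sqinter> m \<sqsubseteq> m" "y \<sqinter> m \<sqsubseteq> m" "y \<sqinter> x = x \<sqinter> y"
        using meet_le laws(4) m xy by auto
      have 2: "m \<sqsubseteq> m \<squnion> x \<sqinter> y" "x \<sqinter> y \<sqsubseteq> m \<squnion> x \<sqinter> y"
        using le_join m xy by auto
      show ?thesis unfolding eq 1(3)
        using le_trans[OF _ _ _ 1(1) 2(1)] le_trans[OF _ _ _ 1(2) 2(1)] 2(2) m xy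
        by (intro join_least) auto
    qed
    ultimately have "a \<sqsubseteq> m \<squnion> x \<sqinter> y"
      using le_trans[of a "(m \<squnion> x) \<sqinter> (m \<squnion> y)" "m \<squnion> x \<sqinter> y"] a m xy by simp
    moreover have "m \<squnion> x \<sqinter> y \<in> P" using m xy id by (auto simp: ideal_def)
    ultimately show False using id a by (auto simp: ideal_def)
  qed
  moreover have "oneS M \<notin> P"
    using id a laws(9) by (auto simp: ideal_def)
  ultimately show ?thesis using id by (auto simp: primes_def)
qed

definition rep :: "'u \<Rightarrow> 'u set set" where
  "rep a = {P \<in> primes. a \<notin> P}"

lemma primesD:
  assumes "P \<in> primes"
  shows "ideal P" "P \<subseteq> L" "zeroS M \<in> P" "oneS M \<notin> P"
    "x \<in> P \<Longrightarrow> y \<in> P \<Longrightarrow> x \<squnion> y \<in> P" "y \<in> P \<Longrightarrow> x \<in> L \<Longrightarrow> x \<sqsubseteq> y \<Longrightarrow> x \<in> P"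
    "x \<in> L \<Longrightarrow> y \<in> L \<Longrightarrow> x \<sqinter> y \<in> P \<Longrightarrow> x \<in> P \<or> y \<in> P"
  using assms by (auto simp: primes_def ideal_def)

lemma rep_join: "x \<in> L \<Longrightarrow> y \<in> L \<Longrightarrow> rep (x \<squnion> y) = rep x \<union> rep y"
  unfolding rep_def using primesD(5,6) le_join closed(3) by blast

lemma rep_meet: "x \<in> L \<Longrightarrow> y \<in> L \<Longrightarrow> rep (x \<sqinter> y) = rep x \<inter> rep y"
  using primesD(6)[of _ x "x \<sqinter> y"] primesD(6)[of _ y "x \<sqinter> y"] primesD(7)[of _ x y] meet_le[of x y]
  by (auto simp: rep_def dest: primesD(6))

text \<open>If \<open>P\<close> misses the difference, then the ideal generated by \<open>P\<close>
  and \<open>y\<close> misses \<open>x\<close>, because \<open>x\<close> below the join of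
  \<open>i\<close> and \<open>y\<close> puts the difference below \<open>i\<close>. A prime
  extension of that ideal missing \<open>x\<close> is the required \<open>Q\<close>.\<close>

lemma rep_diff:
  assumes "x \<in> L" "y \<in> L"
  shows "rep (x \<ominus> y) = {P \<in> primes. \<exists>Q\<in>rep x - rep y. P \<subseteq> Q}"
proof (intro set_eqI iffI)
  fix P assume "P \<in> rep (x \<ominus> y)"
  then have P: "P \<in> primes" "x \<ominus> y \<notin> P" by (auto simp: rep_def)
  note PD = primesD[OF P(1)]
  have "x \<notin> adjoin P y"
  proof
    assume "x \<in> adjoin P y"
    then obtain i where i: "i \<in> P" "x \<sqsubseteq> i \<squnion> y" by (auto simp: adjoin_def)
    then have iL: "i \<in> L" using PD by auto
    then have "x \<ominus> y \<sqsubseteq> i"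
      using laws(2)[of i y y] laws(11)[of x y i] i assms by simp
    with i P assms PD(6) show False by simp
  qed
  then obtain Q where "Q \<in> primes" "adjoin P y \<subseteq> Q" "x \<notin> Q"
    using prime_extension ideal_adjoin(1)[OF PD(1)] assms by metis
  then show "P \<in> {P \<in> primes. \<exists>Q\<in>rep x - rep y. P \<subseteq> Q}"
    using P ideal_adjoin(2,3)[OF PD(1) assms(2)] by (auto simp: rep_def)
next
  fix P assume "P \<in> {P \<in> primes. \<exists>Q\<in>rep x - rep y. P \<subseteq> Q}"
  then obtain Q where Q: "P \<in> primes" "Q \<in> primes" "x \<notin> Q" "y \<in> Q" "P \<subseteq> Q"
    by (auto simp: rep_def)
  have "x \<ominus> y \<notin> Q"
    using primesD(5)[OF Q(2), of y "x \<ominus> y"] primesD(6)[OF Q(2), of "y \<squnion> (x \<ominus> y)" x]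
      Q laws(10)[of x y y] assms by auto
  with Q show "P \<in> rep (x \<ominus> y)" by (auto simp: rep_def)
qed

text \<open>If \<open>x\<close> is not below \<open>y\<close>, a prime extension of the principal
  ideal of \<open>y\<close> that misses \<open>x\<close> separates the two.\<close>

lemma rep_inj: "inj_on rep L"
proof (rule inj_onI)
  have *: "x \<sqsubseteq> y" if "x \<in> L" "y \<in> L" "rep x \<subseteq> rep y" for x y
  proof (rule ccontr)
    assume nle: "\<not> x \<sqsubseteq> y"
    have "ideal {z \<in> L. z \<sqsubseteq> y}"
      unfolding ideal_def
    proof (intro conjI ballI impI)
      show "u \<in> {z \<in> L. z \<sqsubseteq> y}" if "v \<in> {z \<in> L. z \<sqsubseteq> y}" "u \<in> L" "u \<sqsubseteq> v" for u v
        using le_trans[of u v y] that \<open>y \<in> L\<close> by simp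
    qed (use that laws(8)[of y y y] join_least[of _ _ y] in auto)
    then obtain P where "P \<in> primes" "{z \<in> L. z \<sqsubseteq> y} \<subseteq> P" "x \<notin> P"
      using prime_extension[of "{z \<in> L. z \<sqsubseteq> y}" x] nle \<open>x \<in> L\<close> by blast
    with that le_refl show False by (auto simp: rep_def)
  qed
  fix x y assume "x \<in> L" "y \<in> L" "rep x = rep y"
  then show "x = y" using * le_antisym by simp
qed

lemma rep_zero: "rep (zeroS M) = {}" and rep_one: "rep (oneS M) = primes"
  using primesD(3,4) by (auto simp: rep_def)

lemma rep_embedding: "is_embedding rep M (set_str primes (\<subseteq>) (rep ` L))"
  unfolding is_embedding_def set_str_simps
  by (intro conjI ballI rep_inj rep_zero rep_one rep_join rep_meet rep_diff subset_refl)

sublocale rep: down_algebra primes "(\<subseteq>)" "rep ` L"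
proof
  show "{} \<in> rep ` L" "primes \<in> rep ` L"
    using rep_zero rep_one by (metis closed(1,2) imageI)+
  show "a \<union> b \<in> rep ` L" "a \<inter> b \<in> rep ` L" "{p \<in> primes. \<exists>q\<in>a - b. p \<subseteq> q} \<in> rep ` L"
    if "a \<in> rep ` L" "b \<in> rep ` L" for a b
    using that rep_join[symmetric] rep_meet[symmetric] rep_diff[symmetric] by auto
  fix p q r assume pr: "p \<in> primes" "q \<in> primes" "r \<in> primes" "p \<subseteq> q" "q \<subseteq> r"
  show "q \<subseteq> p \<or> r \<subseteq> q"
  proof (rule ccontr)
    assume "\<not> (q \<subseteq> p \<or> r \<subseteq> q)"
    \<comment> \<open>A strict chain refutes the identity at any \<open>x\<close> in
      \<open>r - q\<close> and \<open>y\<close> in \<open>q - p\<close>: \<open>r\<close> puts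
      \<open>q\<close> into the inner difference, and \<open>q\<close>, which contains
      \<open>y\<close>, puts \<open>p\<close> into the outer one.\<close>
    then obtain x y where xy: "x \<in> r" "x \<notin> q" "y \<in> q" "y \<notin> p" by auto
    then have L: "x \<in> L" "y \<in> L" using pr primesD(2) by auto
    have "q \<in> rep ((oneS M \<ominus> x) \<sqinter> x) - rep y"
      using pr xy L rep_one by (auto simp: rep_meet rep_diff) (auto simp: rep_def)
    then have "p \<in> rep ((((oneS M \<ominus> x) \<sqinter> x) \<ominus> y) \<sqinter> y)"
      using pr xy L by (auto simp: rep_meet rep_diff) (auto simp: rep_def)
    then show False using V3_law[OF L] rep_zero by simp
  qed
qed (auto simp: rep_def)

end

section \<open>Finite patterns and their realizations\<close>

text \<open>These are the down-sets of the finite poset that the triple describes. They serve as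
  names for the elements of the finite subalgebra generated by the pieces.\<close>

definition codes :: "nat set \<times> nat set \<times> (nat \<times> nat) set \<Rightarrow> nat set set" where
  "codes = (\<lambda>(C, Y, R). {S. S \<subseteq> C \<union> Y \<and> (\<forall>(y, c)\<in>R. c \<in> S \<longrightarrow> y \<in> S)})"

definition pat_str :: "nat set \<times> nat set \<times> (nat \<times> nat) set \<Rightarrow> nat set coh_structure" where
  "pat_str K = (case K of (C, Y, R) \<Rightarrow> set_str (C \<union> Y) (\<lambda>i j. i = j \<or> (i, j) \<in> R) (codes K))"

definition val :: "(nat \<Rightarrow> 'p set) \<Rightarrow> nat set \<Rightarrow> 'p set" where
  "val \<rho> S = (\<Union>i\<in>S. \<rho> i)"

text \<open>Every refinement step keeps the index \<open>i\<close> for one part of a piece and gives the other part the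
  fresh index \<open>j\<close>; codes are translated accordingly.\<close>

definition lift :: "nat \<Rightarrow> nat \<Rightarrow> nat set \<Rightarrow> nat set" where
  "lift i j S = S \<union> (if i \<in> S then {j} else {})"

locale poset_algebra = down_algebra +
  assumes antisym: "p \<in> X \<Longrightarrow> q \<in> X \<Longrightarrow> le p q \<Longrightarrow> le q p \<Longrightarrow> p = q"
begin

definition mx :: "'a set" where "mx = {p \<in> X. \<forall>q\<in>X. le p q \<longrightarrow> q = p}"
definition lo :: "'a set" where "lo = X - mx"
definition dn :: "'a set \<Rightarrow> 'a set" where "dn W = {p \<in> X. \<exists>q\<in>W. le p q}"

abbreviation regular :: "'a set \<Rightarrow> bool" where "regular a \<equiv> dn (a \<inter> mx) = a"

lemma dn_A: "a \<in> A \<Longrightarrow> b \<in> A \<Longrightarrow> dn (a - b) \<in> A"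
  using diff_A by (simp add: dn_def)

lemma mx_sub: "mx \<subseteq> X" and lo_sub: "lo \<subseteq> X" and mx_lo: "mx \<inter> lo = {}"
  by (auto simp: mx_def lo_def)

lemma mxD: "p \<in> mx \<Longrightarrow> q \<in> X \<Longrightarrow> le p q \<Longrightarrow> q = p"
  by (auto simp: mx_def)

lemma above_lo: "p \<in> X \<Longrightarrow> q \<in> X \<Longrightarrow> le p q \<Longrightarrow> p \<noteq> q \<Longrightarrow> q \<in> mx"
  unfolding mx_def using depth[of p q] antisym[of p q] antisym[of q] by blast

lemma ex_mx: "p \<in> X \<Longrightarrow> \<exists>q\<in>mx. le p q"
  using above_lo[of p] le_refl[of p] mx_def by blast

lemma below_lo: "p \<in> X \<Longrightarrow> q \<in> lo \<Longrightarrow> le p q \<Longrightarrow> p = q"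
  using above_lo[of p q] by (auto simp: lo_def)

lemma dn_mono: "V \<subseteq> W \<Longrightarrow> dn V \<subseteq> dn W"
  by (auto simp: dn_def)

lemma dn_sub: "W \<subseteq> a \<Longrightarrow> a \<in> A \<Longrightarrow> dn W \<subseteq> a"
  using A_down by (auto simp: dn_def)

lemma sub_dn: "W \<subseteq> X \<Longrightarrow> W \<subseteq> dn W"
  using le_refl by (auto simp: dn_def)

lemma dn_mx: "W \<subseteq> X \<Longrightarrow> dn W \<inter> mx = W \<inter> mx"
  using mxD le_refl by (auto simp: dn_def mx_def)

lemma dn_lo: "W \<subseteq> lo \<Longrightarrow> dn W = W"
  unfolding dn_def using below_lo le_refl lo_sub by blast

lemma regular_dn_mx: "W \<subseteq> mx \<Longrightarrow> regular (dn W)"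
  using dn_mx[of W] mx_sub by (simp add: inf_absorb1)

text \<open>A maximal point of \<open>a\<close> above a point outside the down-set \<open>b\<close>
  is itself outside \<open>b\<close>, so restricting to maximal points loses nothing. This is why
  the halves produced by S3 from a regular element are regular.\<close>

lemma regular_diff:
  assumes "a \<in> A" "b \<in> A" "regular a"
  shows "dn (a - b) = dn ((a - b) \<inter> mx)" "regular (dn (a - b))"
proof -
  have "dn (a - b) \<subseteq> dn ((a - b) \<inter> mx)"
  proof
    fix p assume "p \<in> dn (a - b)"
    then obtain q where q: "p \<in> X" "q \<in> a" "q \<notin> b" "le p q" by (auto simp: dn_def)
    then obtain r where r: "r \<in> a" "r \<in> mx" "le q r" "q \<in> X"
      using assms(3) by (auto simp: dn_def)
    then have "r \<notin> b" "le p r" using A_down[OF assms(2), of r q] le_trans[of p q r] q mx_sub by blast+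
    then show "p \<in> dn ((a - b) \<inter> mx)" using q r by (auto simp: dn_def)
  qed
  then show eq: "dn (a - b) = dn ((a - b) \<inter> mx)" using dn_mono[of "(a - b) \<inter> mx" "a - b"] by blast
  show "regular (dn (a - b))" unfolding eq using regular_dn_mx by simp
qed

text \<open>The double complement has the same maximal points as \<open>a\<close> and is generated
  by them. Regularity thus becomes an equation of the language: D3 applies to it and embeddings
  preserve it.\<close>

lemma regular_iff: "a \<in> A \<Longrightarrow> regular a \<longleftrightarrow> dn (X - dn (X - a)) = a"
proof -
  assume a: "a \<in> A"
  have X: "regular X" using ex_mx mx_sub by (fastforce simp: dn_def)
  have "dn (X - a) \<in> A" using dn_A a by simp
  then have "dn (X - dn (X - a)) = dn ((X - dn (X - a)) \<inter> mx)"
    using regular_diff(1)[OF _ _ X] by simp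
  also have "(X - dn (X - a)) \<inter> mx = a \<inter> mx"
    using dn_mx[of "X - a"] mx_sub by blast
  finally show ?thesis by simp
qed

lemma regular_minus_lo:
  assumes "regular a" "b \<subseteq> lo" "a \<in> A"
  shows "dn (a - b) = a"
proof -
  have "a \<inter> mx \<subseteq> a - b" using assms(2) mx_lo by auto
  from dn_mono[OF this] show ?thesis using assms dn_sub[of "a - b" a] by auto
qed

text \<open>A pattern \<open>(C, Y, R)\<close> is a finite poset of depth two: \<open>C\<close> lists maximal and \<open>Y\<close> non-maximal
  elements, and \<open>(y, c) \<in> R\<close> says that \<open>y\<close> lies below \<open>c\<close>. It is realized by the join irreducible
  elements of a finite subalgebra.\<close>

definition realizes :: "nat set \<times> nat set \<times> (nat \<times> nat) set \<Rightarrow> (nat \<Rightarrow> 'a set) \<Rightarrow> bool" where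
  "realizes = (\<lambda>(C, Y, R) \<rho>. finite C \<and> finite Y \<and> C \<inter> Y = {} \<and> R \<subseteq> Y \<times> C \<and>
     (\<forall>c\<in>C. \<rho> c \<in> A \<and> \<rho> c \<noteq> {} \<and> regular (\<rho> c)) \<and>
     (\<forall>y\<in>Y. \<rho> y \<in> A \<and> \<rho> y \<noteq> {} \<and> \<rho> y \<subseteq> lo) \<and>
     val \<rho> C = X \<and>
     (\<forall>c\<in>C. \<forall>d\<in>C. c \<noteq> d \<longrightarrow> \<rho> c \<inter> \<rho> d \<subseteq> val \<rho> Y) \<and>
     (\<forall>y\<in>Y. \<forall>z\<in>Y. y \<noteq> z \<longrightarrow> \<rho> y \<inter> \<rho> z = {}) \<and>
     (\<forall>y\<in>Y. \<forall>c\<in>C. if (y, c) \<in> R then \<rho> y \<subseteq> \<rho> c else \<rho> y \<inter> \<rho> c = {}))"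

lemma realizesD:
  assumes "realizes (C, Y, R) \<rho>"
  shows "finite C" "finite Y" "C \<inter> Y = {}" "R \<subseteq> Y \<times> C"
    "c \<in> C \<Longrightarrow> \<rho> c \<in> A" "c \<in> C \<Longrightarrow> \<rho> c \<noteq> {}" "c \<in> C \<Longrightarrow> regular (\<rho> c)"
    "y \<in> Y \<Longrightarrow> \<rho> y \<in> A" "y \<in> Y \<Longrightarrow> \<rho> y \<noteq> {}" "y \<in> Y \<Longrightarrow> \<rho> y \<subseteq> lo"
    "val \<rho> C = X" "c \<in> C \<Longrightarrow> d \<in> C \<Longrightarrow> c \<noteq> d \<Longrightarrow> \<rho> c \<inter> \<rho> d \<subseteq> val \<rho> Y"
    "y \<in> Y \<Longrightarrow> z \<in> Y \<Longrightarrow> y \<noteq> z \<Longrightarrow> \<rho> y \<inter> \<rho> z = {}"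
    "(y, c) \<in> R \<Longrightarrow> \<rho> y \<subseteq> \<rho> c"
    "y \<in> Y \<Longrightarrow> c \<in> C \<Longrightarrow> (y, c) \<notin> R \<Longrightarrow> \<rho> y \<inter> \<rho> c = {}"
proof -
  note * = assms[unfolded realizes_def case_prod_conv]
  show "(y, c) \<in> R \<Longrightarrow> \<rho> y \<subseteq> \<rho> c"
    using * by (metis (no_types, lifting) SigmaD1 SigmaD2 subsetD)
  show "y \<in> Y \<Longrightarrow> c \<in> C \<Longrightarrow> (y, c) \<notin> R \<Longrightarrow> \<rho> y \<inter> \<rho> c = {}"
    using * by metis
  show "y \<in> Y \<Longrightarrow> z \<in> Y \<Longrightarrow> y \<noteq> z \<Longrightarrow> \<rho> y \<inter> \<rho> z = {}"
    using * by metis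
  show "c \<in> C \<Longrightarrow> d \<in> C \<Longrightarrow> c \<noteq> d \<Longrightarrow> \<rho> c \<inter> \<rho> d \<subseteq> val \<rho> Y"
    using * by metis
qed (use assms[unfolded realizes_def case_prod_conv] in \<open>elim conjE, simp; fail\<close>)+

lemma val_mx_lo:
  assumes "realizes (C, Y, R) \<rho>"
  shows "val \<rho> Y \<subseteq> lo" "c \<in> C \<Longrightarrow> \<rho> c \<inter> mx \<noteq> {}"
    "c \<in> C \<Longrightarrow> d \<in> C \<Longrightarrow> c \<noteq> d \<Longrightarrow> \<rho> c \<inter> \<rho> d \<inter> mx = {}"
proof -
  note D = realizesD[OF assms]
  show lo: "val \<rho> Y \<subseteq> lo" using D(10) by (auto simp: val_def)
  show "c \<in> C \<Longrightarrow> \<rho> c \<inter> mx \<noteq> {}" using D(6,7)[of c] by (auto simp: dn_def)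
  show "c \<in> C \<Longrightarrow> d \<in> C \<Longrightarrow> c \<noteq> d \<Longrightarrow> \<rho> c \<inter> \<rho> d \<inter> mx = {}"
    using D(12)[of c d] lo mx_lo by blast
qed

section \<open>A realization as an embedding of the pattern algebra\<close>

lemma val_A:
  assumes "realizes (C, Y, R) \<rho>" "S \<subseteq> C \<union> Y"
  shows "val \<rho> S \<in> A"
proof -
  note D = realizesD[OF assms(1)]
  have "finite S" using assms(2) D(1,2) by (meson finite_UnI finite_subset)
  then show ?thesis using assms(2)
  proof (induction S)
    case (insert i S)
    have "\<rho> i \<in> A" using insert.prems D(5,8)[of i] by auto
    moreover have "val \<rho> (insert i S) = \<rho> i \<union> val \<rho> S" by (simp add: val_def)
    ultimately show ?case using insert by simp
  qed (simp add: val_def)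
qed

text \<open>A point of a lower piece \<open>y\<close> lies only in \<open>y\<close> and in pieces
  above \<open>y\<close>, so every code of a set containing the point contains \<open>y\<close>. A
  point outside all lower pieces lies in only one maximal piece.\<close>

lemma val_Int:
  assumes r: "realizes (C, Y, R) \<rho>" and S: "S \<in> codes (C, Y, R)" "T \<in> codes (C, Y, R)"
  shows "val \<rho> (S \<inter> T) = val \<rho> S \<inter> val \<rho> T"
proof
  note D = realizesD[OF r]
  have SC: "S \<subseteq> C \<union> Y" "T \<subseteq> C \<union> Y" "\<And>y c. (y, c) \<in> R \<Longrightarrow> c \<in> S \<Longrightarrow> y \<in> S"
    "\<And>y c. (y, c) \<in> R \<Longrightarrow> c \<in> T \<Longrightarrow> y \<in> T"
    using S by (auto simp: codes_def)
  show "val \<rho> S \<inter> val \<rho> T \<subseteq> val \<rho> (S \<inter> T)"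
  proof
    fix p assume "p \<in> val \<rho> S \<inter> val \<rho> T"
    then obtain i j where ij: "i \<in> S" "j \<in> T" "p \<in> \<rho> i" "p \<in> \<rho> j" by (auto simp: val_def)
    have *: "y \<in> S \<inter> T" if "y \<in> Y" "p \<in> \<rho> y" for y
    proof -
      have "y \<in> S" using D(13)[of y i] D(15)[of y i] that ij SC by blast
      moreover have "y \<in> T" using D(13)[of y j] D(15)[of y j] that ij SC by blast
      ultimately show ?thesis by simp
    qed
    show "p \<in> val \<rho> (S \<inter> T)"
    proof (cases "\<exists>y\<in>Y. p \<in> \<rho> y")
      case True
      then show ?thesis using * by (auto simp: val_def)
    next
      case False
      then have "i \<in> C" "j \<in> C" using ij SC by auto
      with D(12)[of i j] False ij have "i = j" by (auto simp: val_def)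
      with ij show ?thesis by (auto simp: val_def)
    qed
  qed
qed (auto simp: val_def)

text \<open>A lower piece is disjoint from all pieces named in \<open>T\<close>. A maximal piece
  keeps all its maximal points and is regenerated by them. Both the formula for differences and the
  injectivity of \<open>val\<close> rest on this.\<close>

lemma dn_piece:
  assumes r: "realizes (C, Y, R) \<rho>" and T: "T \<in> codes (C, Y, R)" and j: "j \<in> C \<union> Y" "j \<notin> T"
  shows "\<rho> j \<subseteq> dn (\<rho> j - val \<rho> T)"
proof -
  note D = realizesD[OF r]
  have TC: "T \<subseteq> C \<union> Y" "\<And>y c. (y, c) \<in> R \<Longrightarrow> c \<in> T \<Longrightarrow> y \<in> T"
    using T by (auto simp: codes_def)
  show ?thesis
  proof (cases "j \<in> Y")
    case True
    have "\<rho> j \<inter> \<rho> i = {}" if "i \<in> T" for i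
      using D(13)[of j i] D(15)[of j i] that True TC j by blast
    then have "\<rho> j - val \<rho> T = \<rho> j" by (auto simp: val_def)
    then show ?thesis using sub_dn A_sub[OF D(8)[OF True]] by simp
  next
    case False
    then have jC: "j \<in> C" using j by simp
    have "\<rho> j \<inter> mx \<inter> \<rho> i = {}" if "i \<in> T" for i
      using val_mx_lo(3)[OF r jC, of i] D(10)[of i] that TC j mx_lo by blast
    then have "\<rho> j \<inter> mx \<subseteq> \<rho> j - val \<rho> T" by (auto simp: val_def)
    then show ?thesis using dn_mono D(7)[OF jC] by blast
  qed
qed

lemma val_diff:
  assumes r: "realizes (C, Y, R) \<rho>" and S: "S \<in> codes (C, Y, R)" "T \<in> codes (C, Y, R)"
  shows "val \<rho> {i \<in> C \<union> Y. \<exists>j\<in>S - T. i = j \<or> (i, j) \<in> R} = dn (val \<rho> S - val \<rho> T)"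
proof
  note D = realizesD[OF r]
  have SC: "S \<subseteq> C \<union> Y" using S by (auto simp: codes_def)
  have 1: "\<rho> j \<subseteq> dn (val \<rho> S - val \<rho> T)" if "j \<in> S - T" for j
  proof -
    have "\<rho> j - val \<rho> T \<subseteq> val \<rho> S - val \<rho> T" using that by (auto simp: val_def)
    then show ?thesis using dn_piece[OF r S(2), of j] dn_mono that SC by blast
  qed
  show "val \<rho> {i \<in> C \<union> Y. \<exists>j\<in>S - T. i = j \<or> (i, j) \<in> R} \<subseteq> dn (val \<rho> S - val \<rho> T)"
    using 1 D(14) by (fastforce simp: val_def)
  show "dn (val \<rho> S - val \<rho> T) \<subseteq> val \<rho> {i \<in> C \<union> Y. \<exists>j\<in>S - T. i = j \<or> (i, j) \<in> R}"
  proof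
    fix p assume "p \<in> dn (val \<rho> S - val \<rho> T)"
    then obtain q j where q: "p \<in> X" "le p q" "q \<in> \<rho> j" "j \<in> S" "q \<notin> val \<rho> T"
      by (auto simp: dn_def val_def)
    then have "j \<notin> T" "p \<in> \<rho> j" using A_down[of "\<rho> j"] D(5,8)[of j] SC by (auto simp: val_def)
    with q SC show "p \<in> val \<rho> {i \<in> C \<union> Y. \<exists>j\<in>S - T. i = j \<or> (i, j) \<in> R}"
      by (auto simp: val_def)
  qed
qed

lemma val_inj:
  assumes r: "realizes (C, Y, R) \<rho>"
  shows "inj_on (val \<rho>) (codes (C, Y, R))"
proof (rule inj_onI)
  have *: "S \<subseteq> T" if S: "S \<in> codes (C, Y, R)" "T \<in> codes (C, Y, R)" "val \<rho> S = val \<rho> T" for S T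
  proof
    fix j assume j: "j \<in> S"
    show "j \<in> T"
    proof (rule ccontr)
      assume "j \<notin> T"
      moreover have jC: "j \<in> C \<union> Y" using j S by (auto simp: codes_def)
      ultimately have "\<rho> j \<subseteq> dn (\<rho> j - val \<rho> T)" using dn_piece[OF r S(2)] by simp
      moreover have "\<rho> j - val \<rho> T = {}" using j S(3)[symmetric] by (auto simp: val_def)
      ultimately show False using realizesD(6,9)[OF r, of j] jC by (auto simp: dn_def)
    qed
  qed
  fix S T assume "S \<in> codes (C, Y, R)" "T \<in> codes (C, Y, R)" "val \<rho> S = val \<rho> T"
  with *[of S T] *[of T S] show "S = T" by auto
qed

lemma val_embedding:
  assumes "realizes K \<rho>"
  shows "is_embedding (val \<rho>) (pat_str K) (set_str X le A)"
proof -
  obtain C Y R where K: "K = (C, Y, R)" by (cases K)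
  note r = assms[unfolded K]
  have "val \<rho> (C \<union> Y) = X"
    using realizesD(11)[OF r] val_mx_lo(1)[OF r] lo_sub by (auto simp: val_def)
  moreover have "val \<rho> S \<in> A" if "S \<in> codes K" for S
    using val_A[OF r] that by (simp add: K codes_def)
  moreover note val_inj[OF r] val_Int[OF r] val_diff[OF r, unfolded dn_def]
  ultimately show ?thesis
    unfolding is_embedding_def pat_str_def K by (auto simp: val_def)
qed

lemma pat_structure:
  assumes "realizes K \<rho>"
  shows "is_structure (pat_str K)"
proof -
  obtain C Y R where K: "K = (C, Y, R)" by (cases K)
  show ?thesis
    using realizesD(3,4)[OF assms[unfolded K]]
    unfolding is_structure_def pat_str_def K by (auto simp: codes_def)
qed

section \<open>The three elementary steps on realizations\<close>

lemma realizes_add_lo: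
  assumes r: "realizes (C, Y, R) \<rho>" and c: "c \<in> C" and j: "j \<notin> C \<union> Y"
    and z: "z \<in> A" "z \<noteq> {}" "z \<subseteq> lo" "z \<subseteq> \<rho> c" "z \<inter> val \<rho> Y = {}"
  shows "realizes (C, insert j Y, insert (j, c) R) (\<rho>(j := z))"
proof -
  note D = realizesD[OF r]
  have eq: "(\<rho>(j := z)) i = \<rho> i" if "i \<in> C \<union> Y" for i using j that by auto
  have v: "val (\<rho>(j := z)) Y = val \<rho> Y" "val (\<rho>(j := z)) C = val \<rho> C"
    "val (\<rho>(j := z)) (insert j Y) = z \<union> val \<rho> Y"
    using j by (auto simp: val_def)
  have zy: "z \<inter> \<rho> y = {}" if "y \<in> Y" for y using z that by (auto simp: val_def)
  have zd: "z \<inter> \<rho> d = {}" if "d \<in> C" "d \<noteq> c" for d using D(12)[of c d] z that c by blast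
  have jR: "(j, d) \<notin> R" for d using D(4) j by blast
  show ?thesis
    unfolding realizes_def case_prod_conv v
  proof (intro conjI ballI impI)
    fix y d assume "y \<in> insert j Y" "d \<in> C"
    then show "if (y, d) \<in> insert (j, c) R then (\<rho>(j := z)) y \<subseteq> (\<rho>(j := z)) d
        else (\<rho>(j := z)) y \<inter> (\<rho>(j := z)) d = {}"
      using j jR zd z D(14,15) by (cases "y = j"; cases "d = c") auto
  next
    fix y w assume "y \<in> insert j Y" "w \<in> insert j Y" "y \<noteq> w"
    then show "(\<rho>(j := z)) y \<inter> (\<rho>(j := z)) w = {}"
      using zy D(13)[of y w] by auto
  next
    show "(\<rho>(j := z)) d \<inter> (\<rho>(j := z)) e \<subseteq> z \<union> val \<rho> Y" if "d \<in> C" "e \<in> C" "d \<noteq> e" for d e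
      using D(12)[OF that] eq that by auto
    show "(\<rho>(j := z)) d \<in> A" "(\<rho>(j := z)) d \<noteq> {}" "regular ((\<rho>(j := z)) d)" if "d \<in> C" for d
    proof -
      have "(\<rho>(j := z)) d = \<rho> d" using that eq by auto
      then show "(\<rho>(j := z)) d \<in> A" "(\<rho>(j := z)) d \<noteq> {}" "regular ((\<rho>(j := z)) d)"
        using D(5,6,7)[OF that] by simp_all
    qed
    show "(\<rho>(j := z)) y \<in> A" "(\<rho>(j := z)) y \<noteq> {}" "(\<rho>(j := z)) y \<subseteq> lo" if "y \<in> insert j Y" for y
      using D(8,9,10)[of y] z that by auto
  qed (use D(1-4,11) j c in auto)
qed

lemma realizes_split_lo:
  assumes r: "realizes (C, Y, R) \<rho>" and y: "y \<in> Y" and j: "j \<notin> C \<union> Y"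
    and z: "z \<in> A" "w \<in> A" "z \<noteq> {}" "w \<noteq> {}" "z \<union> w = \<rho> y" "z \<inter> w = {}"
  shows "realizes (C, insert j Y, R \<union> {j} \<times> {c. (y, c) \<in> R}) (\<rho>(y := z, j := w))"
    "val (\<rho>(y := z, j := w)) (insert j Y) = val \<rho> Y"
proof -
  note D = realizesD[OF r]
  let ?\<rho> = "\<rho>(y := z, j := w)"
  have yC: "y \<notin> C" "j \<noteq> y" "j \<notin> C" using y j D(3) by auto
  have v: "val ?\<rho> C = val \<rho> C"
    using yC by (auto simp: val_def)
  show v': "val ?\<rho> (insert j Y) = val \<rho> Y"
    using yC y j z(5) by (auto simp: val_def split: if_splits)
  have jR: "(j, d) \<notin> R" for d using D(4) j by blast
  have zw: "z \<subseteq> \<rho> y" "w \<subseteq> \<rho> y" using z(5) by auto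
  show "realizes (C, insert j Y, R \<union> {j} \<times> {c. (y, c) \<in> R}) ?\<rho>"
    unfolding realizes_def case_prod_conv v v'
  proof (intro conjI ballI impI)
    fix i d assume *: "i \<in> insert j Y" "d \<in> C"
    then have "?\<rho> d = \<rho> d" using yC by auto
    then show "if (i, d) \<in> R \<union> {j} \<times> {c. (y, c) \<in> R} then ?\<rho> i \<subseteq> ?\<rho> d else ?\<rho> i \<inter> ?\<rho> d = {}"
      using * jR zw yC D(14)[of y d] D(15)[of y d] D(14)[of i d] D(15)[of i d] y
      by (cases "i = j"; cases "i = y"; cases "(y, d) \<in> R"; simp; blast)
  next
    fix i k assume ik: "i \<in> insert j Y" "k \<in> insert j Y" "i \<noteq> k"
    have sub: "?\<rho> l \<subseteq> \<rho> (if l = j then y else l)" for l using zw by auto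
    show "?\<rho> i \<inter> ?\<rho> k = {}"
    proof (cases "{i, k} = {y, j}")
      case True
      then have "i = y \<and> k = j \<or> i = j \<and> k = y" by (auto simp: doubleton_eq_iff)
      then show ?thesis using z(6) yC(2) by auto
    next
      case False
      then have "\<rho> (if i = j then y else i) \<inter> \<rho> (if k = j then y else k) = {}"
        using ik y by (intro D(13)) auto
      then show ?thesis using sub[of i] sub[of k] by blast
    qed
  next
    show "R \<union> {j} \<times> {c. (y, c) \<in> R} \<subseteq> insert j Y \<times> C" using D(4) by auto
    show "?\<rho> i \<subseteq> lo" if "i \<in> insert j Y" for i
      using that D(10)[of i] D(10)[OF y] z(5) by auto
    show "?\<rho> c \<inter> ?\<rho> d \<subseteq> val \<rho> Y" if "c \<in> C" "d \<in> C" "c \<noteq> d" for c d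
      using that yC D(12)[of c d] by auto
    show "?\<rho> c \<in> A" "?\<rho> c \<noteq> {}" "regular (?\<rho> c)" if "c \<in> C" for c
    proof -
      have "?\<rho> c = \<rho> c" using that yC by auto
      then show "?\<rho> c \<in> A" "?\<rho> c \<noteq> {}" "regular (?\<rho> c)" using D(5,6,7)[OF that] by simp_all
    qed
  qed (use D z yC in auto)
qed

text \<open>The sets \<open>B1\<close> and \<open>B2\<close> may overlap: a lower piece in both lies
  below both halves. The halves may meet, but only inside lower pieces that are already
  named.\<close>

lemma realizes_split_mx:
  assumes r: "realizes (C, Y, R) \<rho>" and c: "c \<in> C" and j: "j \<notin> C \<union> Y"
    and z: "u \<in> A" "v \<in> A" "u \<noteq> {}" "v \<noteq> {}" "regular u" "regular v" "u \<union> v = \<rho> c"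
      "u \<inter> v \<subseteq> val \<rho> Y"
    and B: "\<forall>y. (y, c) \<in> R \<longrightarrow> (if y \<in> B1 then \<rho> y \<subseteq> u else \<rho> y \<inter> u = {})"
      "\<forall>y. (y, c) \<in> R \<longrightarrow> (if y \<in> B2 then \<rho> y \<subseteq> v else \<rho> y \<inter> v = {})"
      "B1 \<union> B2 = {y. (y, c) \<in> R}"
  shows "realizes (insert j C, Y, {(y, d) \<in> R. d \<noteq> c} \<union> B1 \<times> {c} \<union> B2 \<times> {j}) (\<rho>(c := u, j := v))"
proof -
  note D = realizesD[OF r]
  let ?\<rho> = "\<rho>(c := u, j := v)"
  have cY: "c \<notin> Y" "j \<noteq> c" "j \<notin> Y" using c j D(3) by auto
  have v: "val ?\<rho> Y = val \<rho> Y"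
    using cY by (auto simp: val_def)
  have v': "val ?\<rho> (insert j C) = val \<rho> C"
    using cY c j z(7) by (auto simp: val_def split: if_splits)
  have jR: "(y, j) \<notin> R" for y using D(4) j by blast
  have BY: "B1 \<subseteq> Y" "B2 \<subseteq> Y" using B(3) D(4) by auto
  show "realizes (insert j C, Y, {(y, d) \<in> R. d \<noteq> c} \<union> B1 \<times> {c} \<union> B2 \<times> {j}) ?\<rho>"
    unfolding realizes_def case_prod_conv v v'
  proof (intro conjI ballI impI)
    fix y d assume *: "y \<in> Y" "d \<in> insert j C"
    have y: "?\<rho> y = \<rho> y" using * cY by auto
    have "(y, c) \<notin> R \<Longrightarrow> \<rho> y \<inter> u = {} \<and> \<rho> y \<inter> v = {} \<and> y \<notin> B1 \<and> y \<notin> B2"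
      using D(15)[OF *(1) c] z(7) B(3) by blast
    then have **: "if y \<in> B1 then \<rho> y \<subseteq> u else \<rho> y \<inter> u = {}" "if y \<in> B2 then \<rho> y \<subseteq> v else \<rho> y \<inter> v = {}"
      using B(1,2)[rule_format, of y] by (cases "(y, c) \<in> R"; simp)+
    consider "d = c" | "d = j" | "d \<noteq> c" "d \<noteq> j" "d \<in> C" using * by auto
    then show "if (y, d) \<in> {(y, d) \<in> R. d \<noteq> c} \<union> B1 \<times> {c} \<union> B2 \<times> {j} then ?\<rho> y \<subseteq> ?\<rho> d else ?\<rho> y \<inter> ?\<rho> d = {}"
      unfolding y
      using ** jR cY D(14)[of y d] D(15)[of y d] *(1)
      by cases auto
  next
    fix i k assume ik: "i \<in> insert j C" "k \<in> insert j C" "i \<noteq> k"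
    have sub: "?\<rho> l \<subseteq> \<rho> (if l = j then c else l)" for l using z(7) by auto
    show "?\<rho> i \<inter> ?\<rho> k \<subseteq> val \<rho> Y"
    proof (cases "{i, k} = {c, j}")
      case True
      then have "i = c \<and> k = j \<or> i = j \<and> k = c" by (auto simp: doubleton_eq_iff)
      then show ?thesis using z(8) cY(2) by auto
    next
      case False
      then have "\<rho> (if i = j then c else i) \<inter> \<rho> (if k = j then c else k) \<subseteq> val \<rho> Y"
        using ik c by (intro D(12)) auto
      then show ?thesis using sub[of i] sub[of k] by blast
    qed
  next
    show "{(y, d) \<in> R. d \<noteq> c} \<union> B1 \<times> {c} \<union> B2 \<times> {j} \<subseteq> Y \<times> insert j C"
      using D(4) BY c by auto
    show "?\<rho> i \<in> A" "?\<rho> i \<noteq> {}" "regular (?\<rho> i)" if i: "i \<in> insert j C" for i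
    proof -
      consider "?\<rho> i = u" | "?\<rho> i = v" | "?\<rho> i = \<rho> i" "i \<in> C"
        using i by (cases "i = j"; cases "i = c") simp_all
      then show "?\<rho> i \<in> A" "?\<rho> i \<noteq> {}" "regular (?\<rho> i)"
        using z D(5,6,7)[of i] by (cases; metis)+
    qed
    show "?\<rho> i \<in> A" "?\<rho> i \<noteq> {}" "?\<rho> i \<subseteq> lo" if "i \<in> Y" for i
      using that cY D(8,9,10)[of i] by auto
    show "?\<rho> i \<inter> ?\<rho> k = {}" if "i \<in> Y" "k \<in> Y" "i \<noteq> k" for i k
      using that cY D(13)[of i k] by auto
  qed (use D cY in auto)
qed

end

lemma val_lift:
  assumes "S \<subseteq> I" "j \<notin> I" "i \<in> I" "\<And>k. k \<in> I \<Longrightarrow> k \<noteq> i \<Longrightarrow> \<rho>' k = \<rho> k" "\<rho>' i \<union> \<rho>' j = \<rho> i"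
  shows "val \<rho>' (lift i j S) = val \<rho> S"
proof (cases "i \<in> S")
  case True
  then have "lift i j S = insert i (insert j (S - {i}))" "S = insert i (S - {i})"
    by (auto simp: lift_def)
  moreover have "val \<rho>' (S - {i}) = val \<rho> (S - {i})"
    using assms unfolding val_def by (intro SUP_cong) auto
  ultimately show ?thesis using assms(5) unfolding val_def
    by (smt (verit) UN_insert sup_assoc)
next
  case False
  then show ?thesis using assms unfolding val_def lift_def by (auto intro!: SUP_cong)
qed

section \<open>Performing the elementary steps by means of S3 and D3\<close>

locale generic_algebra = poset_algebra +
  assumes D3: "a \<in> A \<Longrightarrow> a = dn (X - dn (X - a)) \<Longrightarrow> a \<noteq> {} \<Longrightarrow>
      \<exists>b\<in>A. b \<noteq> {} \<and> dn (a - b) = a \<and> b \<subseteq> a"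
    and S3: "a \<in> A \<Longrightarrow> b1 \<in> A \<Longrightarrow> b2 \<in> A \<Longrightarrow> dn (a - (b1 \<union> b2)) = a \<Longrightarrow> b1 \<union> b2 \<subseteq> a \<Longrightarrow>
      a \<noteq> {} \<Longrightarrow> \<exists>a1\<in>A. \<exists>a2\<in>A. a1 \<noteq> {} \<and> a2 \<noteq> {} \<and> dn (a - a2) = a1 \<and> b1 \<subseteq> a1 \<and>
        dn (a - a1) = a2 \<and> b2 \<subseteq> a2 \<and> a1 \<inter> a2 = b1 \<inter> b2"
begin

lemma splitting:
  assumes "a \<in> A" "b1 \<in> A" "b2 \<in> A" "dn (a - (b1 \<union> b2)) = a" "b1 \<union> b2 \<subseteq> a" "a \<noteq> {}"
  obtains a1 a2 where "a1 \<in> A" "a2 \<in> A" "a1 \<noteq> {}" "a2 \<noteq> {}" "a1 \<union> a2 = a" "b1 \<subseteq> a1" "b2 \<subseteq> a2"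
    "a1 \<inter> a2 = b1 \<inter> b2" "regular a \<Longrightarrow> regular a1" "regular a \<Longrightarrow> regular a2"
proof -
  from S3[OF assms] obtain a1 a2 where a: "a1 \<in> A" "a2 \<in> A" "a1 \<noteq> {}" "a2 \<noteq> {}" "dn (a - a2) = a1"
    "b1 \<subseteq> a1" "dn (a - a1) = a2" "b2 \<subseteq> a2" "a1 \<inter> a2 = b1 \<inter> b2" by blast
  have s1: "a - a2 \<subseteq> a1" using sub_dn[of "a - a2"] a(5) A_sub[OF assms(1)] by blast
  have s2: "a1 \<subseteq> a" "a2 \<subseteq> a" using dn_sub[of _ a] a(5,7) assms(1) by blast+
  have s3: "regular a \<Longrightarrow> regular a1" "regular a \<Longrightarrow> regular a2"
    using regular_diff(2)[OF assms(1) a(2)] regular_diff(2)[OF assms(1) a(1)] unfolding a(5,7)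
    by blast+
  show ?thesis
  proof (rule that[OF a(1-4) _ a(6,8,9)])
    show "a1 \<union> a2 = a" using s1 s2 by blast
  qed (erule s3)+
qed

text \<open>The down-closure of a set adds no maximal points, so the \<open>b\<close> given by D3
  cannot contain any: removing it would not be undone.\<close>

lemma density:
  assumes a: "a \<in> A" "regular a" "a \<noteq> {}"
  obtains z where "z \<in> A" "z \<noteq> {}" "z \<subseteq> a" "z \<subseteq> lo"
proof -
  have "a = dn (X - dn (X - a))" using regular_iff[OF a(1)] a(2) by simp
  from D3[OF a(1) this a(3)] obtain b where b: "b \<in> A" "b \<noteq> {}" "dn (a - b) = a" "b \<subseteq> a" by blast
  have "b \<inter> mx = {}"
    using dn_mx[of "a - b"] b A_sub[OF a(1)] by blast
  then have "b \<subseteq> lo" using A_sub[OF b(1)] by (auto simp: lo_def)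
  then show ?thesis using that b by blast
qed

text \<open>D3 alone might return a part of the existing lower pieces. So S3 is applied first, with
  \<open>b1\<close> the union of the lower pieces below \<open>c\<close> and \<open>b2\<close>
  empty. It cuts off a regular half \<open>a2\<close> disjoint from \<open>b1\<close>, and D3 is
  applied inside \<open>a2\<close>.\<close>

lemma ex_add_lo:
  assumes r: "realizes (C, Y, R) \<rho>" and c: "c \<in> C"
  obtains z where "z \<in> A" "z \<noteq> {}" "z \<subseteq> lo" "z \<subseteq> \<rho> c" "z \<inter> val \<rho> Y = {}"
proof -
  note D = realizesD[OF r]
  let ?b = "val \<rho> {y. (y, c) \<in> R}"
  have b: "?b \<in> A" "?b \<subseteq> lo" "?b \<subseteq> \<rho> c"
    using val_A[OF r, of "{y. (y, c) \<in> R}"] D(4,10) D(14)[of _ c] by (fastforce simp: val_def)+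
  have "dn (\<rho> c - (?b \<union> {})) = \<rho> c"
    using regular_minus_lo[OF D(7)[OF c] b(2) D(5)[OF c]] by simp
  from splitting[OF D(5)[OF c] b(1) empty_A this] b(3) D(6,7)[OF c]
  obtain a1 a2 where a: "a1 \<in> A" "a2 \<in> A" "a2 \<noteq> {}" "a1 \<union> a2 = \<rho> c" "?b \<subseteq> a1" "a1 \<inter> a2 = {}"
    "regular a2" by (metis inf_bot_right sup_bot_right)
  from density[OF a(2,7,3)] obtain z where z: "z \<in> A" "z \<noteq> {}" "z \<subseteq> a2" "z \<subseteq> lo" .
  have "z \<inter> \<rho> y = {}" if "y \<in> Y" for y
  proof (cases "(y, c) \<in> R")
    case True
    then have "\<rho> y \<subseteq> ?b" by (auto simp: val_def)
    then show ?thesis using a z by blast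
  qed (use D(15)[OF that c] a z in blast)
  then have "z \<inter> val \<rho> Y = {}" by (auto simp: val_def)
  then show ?thesis using that z a by blast
qed

text \<open>S3 with \<open>b1\<close> and \<open>b2\<close> both empty makes the halves disjoint. It
  applies to any non-zero element, not only to regular ones.\<close>

lemma ex_split_lo:
  assumes r: "realizes (C, Y, R) \<rho>" and y: "y \<in> Y"
  obtains z w where "z \<in> A" "w \<in> A" "z \<noteq> {}" "w \<noteq> {}" "z \<union> w = \<rho> y" "z \<inter> w = {}"
proof -
  note D = realizesD[OF r]
  have eq: "dn (\<rho> y - ({} \<union> {})) = \<rho> y" using dn_lo[OF D(10)[OF y]] by simp
  show ?thesis
    by (rule splitting[OF D(8)[OF y] empty_A empty_A eq _ D(9)[OF y]]) (auto intro: that)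
qed

text \<open>S3 is applied to the unions of the pieces in \<open>B1\<close> and in \<open>B2\<close>.
  A piece below \<open>c\<close> outside \<open>B1\<close> belongs to \<open>B2\<close>, hence lies
  in \<open>v\<close>. If it met \<open>u\<close>, it would meet the union over \<open>B1\<close>,
  because \<open>u\<close> and \<open>v\<close> meet only where the two unions do; but distinct
  lower pieces are disjoint.\<close>

lemma ex_split_mx:
  assumes r: "realizes (C, Y, R) \<rho>" and c: "c \<in> C" and B: "B1 \<union> B2 = {y. (y, c) \<in> R}"
  obtains u v where "u \<in> A" "v \<in> A" "u \<noteq> {}" "v \<noteq> {}" "regular u" "regular v" "u \<union> v = \<rho> c"
    "u \<inter> v \<subseteq> val \<rho> Y"
    "\<forall>y. (y, c) \<in> R \<longrightarrow> (if y \<in> B1 then \<rho> y \<subseteq> u else \<rho> y \<inter> u = {})"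
    "\<forall>y. (y, c) \<in> R \<longrightarrow> (if y \<in> B2 then \<rho> y \<subseteq> v else \<rho> y \<inter> v = {})"
proof -
  note D = realizesD[OF r]
  let ?b = "val \<rho> B1" and ?d = "val \<rho> B2"
  have BY: "B1 \<subseteq> Y" "B2 \<subseteq> Y" using B D(4) by auto
  then have b: "?b \<in> A" "?d \<in> A" using val_A[OF r, of B1] val_A[OF r, of B2] by auto
  have bl: "?b \<union> ?d \<subseteq> lo" using BY D(10) by (auto simp: val_def)
  have bc: "?b \<union> ?d \<subseteq> \<rho> c" using B D(14) by (fastforce simp: val_def)
  from splitting[OF D(5)[OF c] b regular_minus_lo[OF D(7)[OF c] bl D(5)[OF c]] bc D(6)[OF c]] D(7)[OF c]
  obtain u v where u: "u \<in> A" "v \<in> A" "u \<noteq> {}" "v \<noteq> {}" "u \<union> v = \<rho> c" "?b \<subseteq> u" "?d \<subseteq> v"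
    "u \<inter> v = ?b \<inter> ?d" "regular u" "regular v" by metis
  have bs: "\<rho> y \<subseteq> ?b" if "y \<in> B1" for y using that by (auto simp: val_def)
  have ds: "\<rho> y \<subseteq> ?d" if "y \<in> B2" for y using that by (auto simp: val_def)
  have dj: "\<rho> y \<inter> val \<rho> B = {}" if "y \<in> Y" "y \<notin> B" "B \<subseteq> Y" for y B
    using D(13)[of y] that by (fastforce simp: val_def)
  have 1: "if y \<in> B1 then \<rho> y \<subseteq> u else \<rho> y \<inter> u = {}" if "(y, c) \<in> R" for y
  proof (cases "y \<in> B1")
    case False
    then have "y \<in> B2" "y \<in> Y" using B that D(4) by auto
    then have "\<rho> y \<inter> u = {}" using u(7,8) dj[of y B1] ds[of y] BY False by blast
    then show ?thesis using False by simp
  qed (use bs u(6) in \<open>simp; blast\<close>)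
  have 2: "if y \<in> B2 then \<rho> y \<subseteq> v else \<rho> y \<inter> v = {}" if "(y, c) \<in> R" for y
  proof (cases "y \<in> B2")
    case False
    then have "y \<in> B1" "y \<in> Y" using B that D(4) by auto
    then have "\<rho> y \<inter> v = {}" using u(6,8) dj[of y B2] bs[of y] BY False by blast
    then show ?thesis using False by simp
  qed (use ds u(7) in \<open>simp; blast\<close>)
  have "u \<inter> v \<subseteq> val \<rho> Y" using u(8) BY by (auto simp: val_def)
  then show ?thesis using that[of u v] u 1 2 by blast
qed

end

text \<open>\<open>K'\<close> is obtained from \<open>K\<close> by steps that can be copied in every algebra that satisfies D3
  and S3. The type argument is needed because the points occur only under quantifiers.\<close>

definition mirrors :: "'p itself \<Rightarrow> nat set \<times> nat set \<times> (nat \<times> nat) set \<Rightarrow>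
    nat set \<times> nat set \<times> (nat \<times> nat) set \<Rightarrow> (nat set \<Rightarrow> nat set) \<Rightarrow> bool" where
  "mirrors _ K K' t \<longleftrightarrow> (\<forall>(X :: 'p set) le A \<rho>.
     generic_algebra X le A \<longrightarrow> poset_algebra.realizes X le A K \<rho> \<longrightarrow>
     (\<exists>\<rho>'. poset_algebra.realizes X le A K' \<rho>' \<and> (\<forall>S\<in>codes K. val \<rho>' (t S) = val \<rho> S)))"

lemma codes_sub: "S \<in> codes (C, Y, R) \<Longrightarrow> S \<subseteq> C \<union> Y"
  by (auto simp: codes_def)

lemma val_lift_code:
  assumes "S \<in> codes (C, Y, R)" "j \<notin> C \<union> Y" "i \<in> C \<union> Y"
  shows "u \<union> v = \<rho> i \<Longrightarrow> val (\<rho>(i := u, j := v)) (lift i j S) = val \<rho> S"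
    "u \<subseteq> \<rho> i \<Longrightarrow> val (\<rho>(j := u)) (lift i j S) = val \<rho> S"
proof -
  have "i \<noteq> j" using assms by auto
  then show "u \<union> v = \<rho> i \<Longrightarrow> val (\<rho>(i := u, j := v)) (lift i j S) = val \<rho> S"
    using assms by (intro val_lift[OF codes_sub[OF assms(1)]]) auto
  show "u \<subseteq> \<rho> i \<Longrightarrow> val (\<rho>(j := u)) (lift i j S) = val \<rho> S"
    using assms \<open>i \<noteq> j\<close> by (intro val_lift[OF codes_sub[OF assms(1)]]) auto
qed

context poset_algebra
begin

text \<open>One translation \<open>t\<close> has to serve both the realization at hand and every
  copy in a generic algebra. That keeps the codes of old elements synchronized on the two sides of
  the back-and-forth.\<close>

definition refines :: "nat set \<times> nat set \<times> (nat \<times> nat) set \<Rightarrow> (nat \<Rightarrow> 'a set) \<Rightarrow>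
    nat set \<times> nat set \<times> (nat \<times> nat) set \<Rightarrow> (nat \<Rightarrow> 'a set) \<Rightarrow> bool" where
  "refines K \<rho> K' \<rho>' \<longleftrightarrow> realizes K' \<rho>' \<and> (\<exists>t. mirrors TYPE('a) K K' t \<and>
     (\<forall>S\<in>codes K. t S \<in> codes K' \<and> val \<rho>' (t S) = val \<rho> S))"

definition span :: "nat set \<times> nat set \<times> (nat \<times> nat) set \<Rightarrow> (nat \<Rightarrow> 'a set) \<Rightarrow> 'a set set" where
  "span K \<rho> = val \<rho> ` codes K"

lemma refines_refl: "realizes K \<rho> \<Longrightarrow> refines K \<rho> K \<rho>"
  unfolding refines_def mirrors_def by (auto intro!: exI[of _ id])

lemma refines_trans:
  assumes "refines K \<rho> K' \<rho>'" "refines K' \<rho>' K'' \<rho>''"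
  shows "refines K \<rho> K'' \<rho>''"
proof -
  from assms(1) obtain t where t: "mirrors TYPE('a) K K' t"
    "\<And>S. S \<in> codes K \<Longrightarrow> t S \<in> codes K' \<and> val \<rho>' (t S) = val \<rho> S"
    by (auto simp: refines_def)
  from assms(2) obtain s where s: "mirrors TYPE('a) K' K'' s" "realizes K'' \<rho>''"
    "\<And>S. S \<in> codes K' \<Longrightarrow> s S \<in> codes K'' \<and> val \<rho>'' (s S) = val \<rho>' S"
    by (auto simp: refines_def)
  have "mirrors TYPE('a) K K'' (s \<circ> t)"
    unfolding mirrors_def
  proof (intro allI impI)
    fix Z :: "'a set" and lz B \<sigma>
    assume g: "generic_algebra Z lz B" "poset_algebra.realizes Z lz B K \<sigma>"
    with t(1) obtain \<sigma>' where s': "poset_algebra.realizes Z lz B K' \<sigma>'"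
      "\<forall>S\<in>codes K. val \<sigma>' (t S) = val \<sigma> S" unfolding mirrors_def by blast
    with s(1) g obtain \<sigma>'' where s'': "poset_algebra.realizes Z lz B K'' \<sigma>''"
      "\<forall>S\<in>codes K'. val \<sigma>'' (s S) = val \<sigma>' S" unfolding mirrors_def by blast
    then show "\<exists>\<sigma>''. poset_algebra.realizes Z lz B K'' \<sigma>'' \<and>
        (\<forall>S\<in>codes K. val \<sigma>'' ((s \<circ> t) S) = val \<sigma> S)"
      using s' t(2) by (intro exI[of _ \<sigma>'']) auto
  qed
  then show ?thesis using s t(2) unfolding refines_def
    by (intro conjI exI[of _ "s \<circ> t"]) auto
qed

lemma span_mono: "refines K \<rho> K' \<rho>' \<Longrightarrow> span K \<rho> \<subseteq> span K' \<rho>'"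
  unfolding refines_def span_def by force

lemma span_Un: "u \<in> span K \<rho> \<Longrightarrow> v \<in> span K \<rho> \<Longrightarrow> u \<union> v \<in> span K \<rho>"
proof -
  assume "u \<in> span K \<rho>" "v \<in> span K \<rho>"
  then obtain S T where ST: "S \<in> codes K" "T \<in> codes K" "u = val \<rho> S" "v = val \<rho> T"
    by (auto simp: span_def)
  moreover have "S \<union> T \<in> codes K" using ST by (cases K) (auto simp: codes_def)
  moreover have "val \<rho> (S \<union> T) = u \<union> v" using ST by (auto simp: val_def)
  ultimately show ?thesis unfolding span_def by (metis imageI)
qed

text \<open>The step here uses a given \<open>z\<close>. The copy in a generic algebra may use any
  \<open>w\<close> from \<open>ex_add_lo\<close>, since the new pattern and \<open>lift c j\<close>
  do not depend on this choice. The other two steps follow the same scheme.\<close>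

lemma refines_add_lo:
  assumes r: "realizes (C, Y, R) \<rho>" and c: "c \<in> C" and j: "j \<notin> C \<union> Y"
    and z: "z \<in> A" "z \<noteq> {}" "z \<subseteq> lo" "z \<subseteq> \<rho> c" "z \<inter> val \<rho> Y = {}"
  shows "refines (C, Y, R) \<rho> (C, insert j Y, insert (j, c) R) (\<rho>(j := z))"
proof -
  have "mirrors TYPE('a) (C, Y, R) (C, insert j Y, insert (j, c) R) (lift c j)"
    unfolding mirrors_def
  proof (intro allI impI)
    fix Z :: "'a set" and lz B \<sigma>
    assume g: "generic_algebra Z lz B" "poset_algebra.realizes Z lz B (C, Y, R) \<sigma>"
    interpret g: generic_algebra Z lz B by (fact g)
    from g.ex_add_lo[OF g(2) c] obtain w where w: "w \<in> B" "w \<noteq> {}" "w \<subseteq> g.lo" "w \<subseteq> \<sigma> c"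
      "w \<inter> val \<sigma> Y = {}" .
    show "\<exists>\<sigma>'. g.realizes (C, insert j Y, insert (j, c) R) \<sigma>' \<and>
        (\<forall>S\<in>codes (C, Y, R). val \<sigma>' (lift c j S) = val \<sigma> S)"
      using g.realizes_add_lo[OF g(2) c j w] val_lift_code(2)[OF _ j] c w by blast
  qed
  moreover have "lift c j S \<in> codes (C, insert j Y, insert (j, c) R)" if "S \<in> codes (C, Y, R)" for S
    using that c j realizesD(4)[OF r] by (auto simp: codes_def lift_def)
  moreover have "val (\<rho>(j := z)) (lift c j S) = val \<rho> S" if "S \<in> codes (C, Y, R)" for S
    using val_lift_code(2)[OF that j] c z by blast
  ultimately show ?thesis
    using realizes_add_lo[OF assms] unfolding refines_def by blast
qed

lemma refines_split_lo:
  assumes r: "realizes (C, Y, R) \<rho>" and y: "y \<in> Y" and j: "j \<notin> C \<union> Y"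
    and z: "z \<in> A" "w \<in> A" "z \<noteq> {}" "w \<noteq> {}" "z \<union> w = \<rho> y" "z \<inter> w = {}"
  shows "refines (C, Y, R) \<rho> (C, insert j Y, R \<union> {j} \<times> {c. (y, c) \<in> R}) (\<rho>(y := z, j := w))"
    (is "refines _ _ ?K _")
proof -
  have "mirrors TYPE('a) (C, Y, R) ?K (lift y j)"
    unfolding mirrors_def
  proof (intro allI impI)
    fix Z :: "'a set" and lz B \<sigma>
    assume g: "generic_algebra Z lz B" "poset_algebra.realizes Z lz B (C, Y, R) \<sigma>"
    interpret g: generic_algebra Z lz B by (fact g)
    from g.ex_split_lo[OF g(2) y] obtain u v where w: "u \<in> B" "v \<in> B" "u \<noteq> {}" "v \<noteq> {}"
      "u \<union> v = \<sigma> y" "u \<inter> v = {}" .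
    show "\<exists>\<sigma>'. g.realizes ?K \<sigma>' \<and> (\<forall>S\<in>codes (C, Y, R). val \<sigma>' (lift y j S) = val \<sigma> S)"
      using g.realizes_split_lo(1)[OF g(2) y j w] val_lift_code(1)[OF _ j] y w by blast
  qed
  moreover have "lift y j S \<in> codes ?K" if "S \<in> codes (C, Y, R)" for S
    using that y j realizesD(4)[OF r] by (auto simp: codes_def lift_def)
  moreover have "val (\<rho>(y := z, j := w)) (lift y j S) = val \<rho> S" if "S \<in> codes (C, Y, R)" for S
    using val_lift_code(1)[OF that j] y z by blast
  ultimately show ?thesis
    using realizes_split_lo(1)[OF assms] unfolding refines_def by blast
qed

lemma refines_split_mx:
  assumes r: "realizes (C, Y, R) \<rho>" and c: "c \<in> C" and j: "j \<notin> C \<union> Y"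
    and z: "u \<in> A" "v \<in> A" "u \<noteq> {}" "v \<noteq> {}" "regular u" "regular v" "u \<union> v = \<rho> c"
      "u \<inter> v \<subseteq> val \<rho> Y"
    and B: "\<forall>y. (y, c) \<in> R \<longrightarrow> (if y \<in> B1 then \<rho> y \<subseteq> u else \<rho> y \<inter> u = {})"
      "\<forall>y. (y, c) \<in> R \<longrightarrow> (if y \<in> B2 then \<rho> y \<subseteq> v else \<rho> y \<inter> v = {})"
      "B1 \<union> B2 = {y. (y, c) \<in> R}"
  shows "refines (C, Y, R) \<rho>
    (insert j C, Y, {(y, d) \<in> R. d \<noteq> c} \<union> B1 \<times> {c} \<union> B2 \<times> {j}) (\<rho>(c := u, j := v))"
    (is "refines _ _ ?K _")
proof -
  have "mirrors TYPE('a) (C, Y, R) ?K (lift c j)"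
    unfolding mirrors_def
  proof (intro allI impI)
    fix Z :: "'a set" and lz B \<sigma>
    assume g: "generic_algebra Z lz B" "poset_algebra.realizes Z lz B (C, Y, R) \<sigma>"
    interpret g: generic_algebra Z lz B by (fact g)
    obtain u v where w: "u \<in> B" "v \<in> B" "u \<noteq> {}" "v \<noteq> {}"
      "g.regular u" "g.regular v" "u \<union> v = \<sigma> c" "u \<inter> v \<subseteq> val \<sigma> Y"
      "\<forall>y. (y, c) \<in> R \<longrightarrow> (if y \<in> B1 then \<sigma> y \<subseteq> u else \<sigma> y \<inter> u = {})"
      "\<forall>y. (y, c) \<in> R \<longrightarrow> (if y \<in> B2 then \<sigma> y \<subseteq> v else \<sigma> y \<inter> v = {})"
      by (rule g.ex_split_mx[OF g(2) c B(3)])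
    show "\<exists>\<sigma>'. g.realizes ?K \<sigma>' \<and> (\<forall>S\<in>codes (C, Y, R). val \<sigma>' (lift c j S) = val \<sigma> S)"
      using g.realizes_split_mx[OF g(2) c j w B(3)] val_lift_code(1)[OF _ j] c w(7) by blast
  qed
  moreover have "lift c j S \<in> codes ?K" if "S \<in> codes (C, Y, R)" for S
    using that c j realizesD(3,4)[OF r] B(3) by (auto simp: codes_def lift_def)
  moreover have "val (\<rho>(c := u, j := v)) (lift c j S) = val \<rho> S" if "S \<in> codes (C, Y, R)" for S
    using val_lift_code(1)[OF that j] c z(7) by blast
  ultimately show ?thesis
    using realizes_split_mx[OF assms] unfolding refines_def by blast
qed

section \<open>Refining a pattern until its span contains a given element\<close>

lemma ex_fresh:
  assumes "realizes (C, Y, R) \<rho>"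
  obtains j where "j \<notin> C \<union> Y"
  using ex_new_if_finite[of "C \<union> Y"] realizesD(1,2)[OF assms] infinite_UNIV_nat by auto

text \<open>Induction on the number of lower pieces that \<open>z\<close> cuts properly. The part
  outside \<open>z\<close> belongs to the algebra because every subset of \<open>lo\<close> is
  already a down-set, so set difference and algebraic difference coincide there.\<close>

lemma refine_decide_lo:
  assumes "realizes (C, Y, R) \<rho>" "z \<in> A" "z \<subseteq> lo"
  shows "\<exists>Y' R' \<rho>'. refines (C, Y, R) \<rho> (C, Y', R') \<rho>' \<and> (\<forall>c\<in>C. \<rho>' c = \<rho> c) \<and>
    val \<rho>' Y' = val \<rho> Y \<and> (\<forall>y\<in>Y'. \<rho>' y \<inter> z = {} \<or> \<rho>' y \<subseteq> z)"
  using assms(1)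
proof (induction "card {y \<in> Y. \<not> (\<rho> y \<inter> z = {} \<or> \<rho> y \<subseteq> z)}" arbitrary: Y R \<rho> rule: less_induct)
  case less
  note D = realizesD[OF less.prems]
  show ?case
  proof (cases "\<exists>y\<in>Y. \<not> (\<rho> y \<inter> z = {} \<or> \<rho> y \<subseteq> z)")
    case False
    then show ?thesis using refines_refl[OF less.prems] by blast
  next
    case True
    then obtain y where y: "y \<in> Y" "\<rho> y \<inter> z \<noteq> {}" "\<not> \<rho> y \<subseteq> z" by blast
    obtain j where j: "j \<notin> C \<union> Y" using ex_fresh[OF less.prems] .
    let ?u = "\<rho> y \<inter> z" and ?v = "\<rho> y - z"
    have "dn ?v = ?v" using D(10)[OF y(1)] by (intro dn_lo) auto
    then have "?v \<in> A" using dn_A[OF D(8)[OF y(1)] assms(2)] by simp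
    then have p: "?u \<in> A" "?v \<in> A" "?u \<noteq> {}" "?v \<noteq> {}" "?u \<union> ?v = \<rho> y" "?u \<inter> ?v = {}"
      using D(8)[OF y(1)] assms(2) y by auto
    define R' \<rho>' where "R' = R \<union> {j} \<times> {c. (y, c) \<in> R}" and "\<rho>' = \<rho>(y := ?u, j := ?v)"
    have ref: "refines (C, Y, R) \<rho> (C, insert j Y, R') \<rho>'"
      unfolding R'_def \<rho>'_def by (rule refines_split_lo[OF less.prems y(1) j p])
    have v: "val \<rho>' (insert j Y) = val \<rho> Y"
      unfolding \<rho>'_def by (rule realizes_split_lo(2)[OF less.prems y(1) j p])
    have "{k \<in> insert j Y. \<not> (\<rho>' k \<inter> z = {} \<or> \<rho>' k \<subseteq> z)} \<subset> {k \<in> Y. \<not> (\<rho> k \<inter> z = {} \<or> \<rho> k \<subseteq> z)}"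
      using y j unfolding \<rho>'_def by (auto split: if_splits)
    then have "card {k \<in> insert j Y. \<not> (\<rho>' k \<inter> z = {} \<or> \<rho>' k \<subseteq> z)} < card {k \<in> Y. \<not> (\<rho> k \<inter> z = {} \<or> \<rho> k \<subseteq> z)}"
      using D(2) by (intro psubset_card_mono) auto
    moreover have "realizes (C, insert j Y, R') \<rho>'" using ref by (simp add: refines_def)
    ultimately obtain Y'' R'' \<rho>'' where *: "refines (C, insert j Y, R') \<rho>' (C, Y'', R'') \<rho>''"
      "\<forall>c\<in>C. \<rho>'' c = \<rho>' c" "val \<rho>'' Y'' = val \<rho>' (insert j Y)"
      "\<forall>y\<in>Y''. \<rho>'' y \<inter> z = {} \<or> \<rho>'' y \<subseteq> z"
      using less.hyps by blast
    moreover have "\<forall>c\<in>C. \<rho>' c = \<rho> c" using j y D(3) by (auto simp: \<rho>'_def)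
    ultimately show ?thesis using refines_trans[OF ref *(1)] v by metis
  qed
qed

text \<open>Each maximal piece receives at most one new lower piece, the uncovered part of
  \<open>z\<close> inside it. These parts do not interfere, because two maximal pieces meet only
  inside the lower pieces already present.\<close>

lemma refine_cover_lo:
  assumes "realizes (C, Y, R) \<rho>" "z \<in> A" "z \<subseteq> lo" "\<forall>y\<in>Y. \<rho> y \<inter> z = {} \<or> \<rho> y \<subseteq> z"
  shows "\<exists>Y' R' \<rho>'. refines (C, Y, R) \<rho> (C, Y', R') \<rho>' \<and> (\<forall>c\<in>C. \<rho>' c = \<rho> c) \<and>
    val \<rho>' Y' = val \<rho> Y \<union> z \<and> (\<forall>y\<in>Y'. \<rho>' y \<inter> z = {} \<or> \<rho>' y \<subseteq> z)"
  using assms(1,4)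
proof (induction "card {c \<in> C. \<not> \<rho> c \<inter> z \<subseteq> val \<rho> Y}" arbitrary: Y R \<rho> rule: less_induct)
  case less
  note D = realizesD[OF less.prems(1)]
  show ?case
  proof (cases "\<exists>c\<in>C. \<not> \<rho> c \<inter> z \<subseteq> val \<rho> Y")
    case False
    then have "z \<subseteq> val \<rho> Y" using D(11) A_sub[OF assms(2)] by (fastforce simp: val_def)
    then have "val \<rho> Y = val \<rho> Y \<union> z" by blast
    then show ?thesis using refines_refl[OF less.prems(1)] less.prems(2) by blast
  next
    case True
    then obtain c where c: "c \<in> C" "\<not> \<rho> c \<inter> z \<subseteq> val \<rho> Y" by blast
    obtain j where j: "j \<notin> C \<union> Y" using ex_fresh[OF less.prems(1)] .
    let ?w = "\<rho> c \<inter> z - val \<rho> Y"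
    have "dn ?w = ?w" using assms(3) by (intro dn_lo) auto
    moreover have "\<rho> c \<inter> z \<in> A" using D(5)[OF c(1)] assms(2) by simp
    ultimately have "?w \<in> A" using dn_A[of "\<rho> c \<inter> z" "val \<rho> Y"] val_A[OF less.prems(1), of Y] by auto
    then have p: "?w \<in> A" "?w \<noteq> {}" "?w \<subseteq> lo" "?w \<subseteq> \<rho> c" "?w \<inter> val \<rho> Y = {}"
      using assms(3) c by auto
    define R' \<rho>' where "R' = insert (j, c) R" and "\<rho>' = \<rho>(j := ?w)"
    have ref: "refines (C, Y, R) \<rho> (C, insert j Y, R') \<rho>'"
      unfolding R'_def \<rho>'_def by (rule refines_add_lo[OF less.prems(1) c(1) j p])
    have v: "val \<rho>' (insert j Y) = val \<rho> Y \<union> ?w"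
      using j by (auto simp: \<rho>'_def val_def)
    have eq: "\<rho>' i = \<rho> i" if "i \<in> C \<union> Y" for i using j that by (auto simp: \<rho>'_def)
    have "{d \<in> C. \<not> \<rho>' d \<inter> z \<subseteq> val \<rho>' (insert j Y)} \<subset> {d \<in> C. \<not> \<rho> d \<inter> z \<subseteq> val \<rho> Y}"
    proof
      show "{d \<in> C. \<not> \<rho>' d \<inter> z \<subseteq> val \<rho>' (insert j Y)} \<subseteq> {d \<in> C. \<not> \<rho> d \<inter> z \<subseteq> val \<rho> Y}"
        unfolding v using eq by auto
      have "\<rho>' c \<inter> z \<subseteq> val \<rho>' (insert j Y)" unfolding v using eq c by auto
      then show "{d \<in> C. \<not> \<rho>' d \<inter> z \<subseteq> val \<rho>' (insert j Y)} \<noteq> {d \<in> C. \<not> \<rho> d \<inter> z \<subseteq> val \<rho> Y}"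
        using c by blast
    qed
    then have "card {d \<in> C. \<not> \<rho>' d \<inter> z \<subseteq> val \<rho>' (insert j Y)} < card {d \<in> C. \<not> \<rho> d \<inter> z \<subseteq> val \<rho> Y}"
      using D(1) by (intro psubset_card_mono) auto
    moreover have "realizes (C, insert j Y, R') \<rho>'" using ref by (simp add: refines_def)
    moreover have "\<forall>y\<in>insert j Y. \<rho>' y \<inter> z = {} \<or> \<rho>' y \<subseteq> z"
      using less.prems(2) by (auto simp: \<rho>'_def)
    ultimately obtain Y'' R'' \<rho>'' where *: "refines (C, insert j Y, R') \<rho>' (C, Y'', R'') \<rho>''"
      "\<forall>c\<in>C. \<rho>'' c = \<rho>' c" "val \<rho>'' Y'' = val \<rho>' (insert j Y) \<union> z"
      "\<forall>y\<in>Y''. \<rho>'' y \<inter> z = {} \<or> \<rho>'' y \<subseteq> z"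
      using less.hyps by blast
    moreover have "val \<rho>' (insert j Y) \<union> z = val \<rho> Y \<union> z" unfolding v by auto
    ultimately show ?thesis using refines_trans[OF ref *(1)] eq by (metis UnI1)
  qed
qed

lemma refine_lo:
  assumes "realizes (C, Y, R) \<rho>" "z \<in> A" "z \<subseteq> lo"
  obtains Y' R' \<rho>' where "refines (C, Y, R) \<rho> (C, Y', R') \<rho>'" "\<And>c. c \<in> C \<Longrightarrow> \<rho>' c = \<rho> c"
    "val \<rho>' Y' = val \<rho> Y \<union> z" "z \<in> span (C, Y', R') \<rho>'"
proof -
  from refine_decide_lo[OF assms] obtain Y1 R1 \<rho>1 where 1: "refines (C, Y, R) \<rho> (C, Y1, R1) \<rho>1"
    "\<forall>c\<in>C. \<rho>1 c = \<rho> c" "val \<rho>1 Y1 = val \<rho> Y" "\<forall>y\<in>Y1. \<rho>1 y \<inter> z = {} \<or> \<rho>1 y \<subseteq> z" by blast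
  then have "realizes (C, Y1, R1) \<rho>1" by (simp add: refines_def)
  from refine_cover_lo[OF this assms(2,3) 1(4)] obtain Y2 R2 \<rho>2 where
    2: "refines (C, Y1, R1) \<rho>1 (C, Y2, R2) \<rho>2" "\<forall>c\<in>C. \<rho>2 c = \<rho>1 c" "val \<rho>2 Y2 = val \<rho>1 Y1 \<union> z"
      "\<forall>y\<in>Y2. \<rho>2 y \<inter> z = {} \<or> \<rho>2 y \<subseteq> z" by blast
  note r = 2(1)[unfolded refines_def, THEN conjunct1]
  have "{y \<in> Y2. \<rho>2 y \<subseteq> z} \<in> codes (C, Y2, R2)"
    using realizesD(3,4)[OF r] unfolding codes_def by blast
  moreover have "val \<rho>2 {y \<in> Y2. \<rho>2 y \<subseteq> z} = z"
    using 2(3,4) by (fastforce simp: val_def)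
  ultimately have "z \<in> span (C, Y2, R2) \<rho>2" by (force simp: span_def)
  then show ?thesis
    using that[of Y2 R2 \<rho>2] refines_trans[OF 1(1) 2(1)] 1 2 by metis
qed

end

context poset_algebra
begin

lemma span_decides:
  assumes r: "realizes (C, Y, R) \<rho>" and w: "w \<in> span (C, Y, R) \<rho>" and y: "y \<in> Y"
  shows "\<rho> y \<inter> w = {} \<or> \<rho> y \<subseteq> w"
proof -
  note D = realizesD[OF r]
  from w obtain S where S0: "S \<in> codes (C, Y, R)" and w_eq: "w = val \<rho> S"
    by (auto simp: span_def)
  have S: "S \<subseteq> C \<union> Y" "\<And>y c. (y, c) \<in> R \<Longrightarrow> c \<in> S \<Longrightarrow> y \<in> S" "w = val \<rho> S"
    using S0 w_eq by (auto simp: codes_def)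
  show ?thesis
  proof (cases "y \<in> S")
    case True
    then show ?thesis using S by (auto simp: val_def)
  next
    case False
    then have "\<rho> y \<inter> \<rho> i = {}" if "i \<in> S" for i
      using D(13)[OF y, of i] D(15)[OF y, of i] S that by blast
    then show ?thesis using S by (auto simp: val_def)
  qed
qed

lemma refine_split_by:
  assumes r: "realizes (C, Y, R) \<rho>" and x: "x \<in> A" and c: "c \<in> C"
    and und: "\<not> \<rho> c \<inter> mx \<subseteq> x" "\<rho> c \<inter> mx \<inter> x \<noteq> {}"
  obtains j Y' R' \<rho>' where "j \<notin> C" "refines (C, Y, R) \<rho> (insert j C, Y', R') \<rho>'"
    "\<rho>' c \<inter> mx \<inter> x = {}" "\<rho>' j \<inter> mx \<subseteq> x" "\<And>d. d \<in> C \<Longrightarrow> d \<noteq> c \<Longrightarrow> \<rho>' d = \<rho> d"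
proof -
  note D = realizesD[OF r]
  \<comment> \<open>The intersection of the piece with \<open>x\<close> need not be regular, so
    \<open>v\<close> is the down-closure of what \<open>u\<close> leaves over. Its maximal points
    are those of the piece that lie in \<open>x\<close>.\<close>
  define u v where "u = dn (\<rho> c - x)" and "v = dn (\<rho> c - u)"
  have uv: "u \<in> A" "v \<in> A" using dn_A D(5)[OF c] x by (auto simp: u_def v_def)
  have cX: "\<rho> c \<subseteq> X" using A_sub D(5)[OF c] by blast
  have umx: "u \<inter> mx = \<rho> c \<inter> mx - x" using dn_mx[of "\<rho> c - x"] cX by (auto simp: u_def)
  have vmx: "v \<inter> mx = \<rho> c \<inter> mx \<inter> x" using dn_mx[of "\<rho> c - u"] cX umx by (auto simp: v_def)
  have reg: "regular u" "regular v"
    using regular_diff(2)[OF D(5)[OF c] _ D(7)[OF c]] x uv(1) by (auto simp: u_def v_def)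
  have un: "u \<union> v = \<rho> c"
    using dn_sub[of "\<rho> c - x"] dn_sub[of "\<rho> c - u"] sub_dn[of "\<rho> c - u"] D(5)[OF c] cX
    unfolding u_def v_def by blast
  have ne: "u \<noteq> {}" "v \<noteq> {}" using umx vmx und by auto
  have w: "u \<inter> v \<in> A" "u \<inter> v \<subseteq> lo"
    using uv umx vmx A_sub[OF uv(1)] by (auto simp: lo_def)
  \<comment> \<open>A maximal piece may be split only if the overlap of the halves is covered by
    lower pieces, so the overlap is added first.\<close>
  from refine_lo[OF r w] obtain Y1 R1 \<rho>1 where 1: "refines (C, Y, R) \<rho> (C, Y1, R1) \<rho>1"
    "\<And>c. c \<in> C \<Longrightarrow> \<rho>1 c = \<rho> c" "val \<rho>1 Y1 = val \<rho> Y \<union> (u \<inter> v)" by metis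
  have r1: "realizes (C, Y1, R1) \<rho>1" using 1 by (simp add: refines_def)
  \<comment> \<open>Only subsets of \<open>lo\<close> can be passed to \<open>refine_lo\<close>.
    Therefore \<open>u\<close> and \<open>v\<close> are replaced by their traces on the union of the
    lower pieces. This union stays the same from here on, so deciding the traces decides
    \<open>u\<close> and \<open>v\<close> on every lower piece.\<close>
  let ?U = "val \<rho>1 Y1"
  have U: "?U \<in> A" "?U \<subseteq> lo" using val_A[OF r1, of Y1] val_mx_lo(1)[OF r1] by auto
  have "?U \<inter> u \<in> A" "?U \<inter> u \<subseteq> lo" using U uv by auto
  from refine_lo[OF r1 this] obtain Y2 R2 \<rho>2 where 2: "refines (C, Y1, R1) \<rho>1 (C, Y2, R2) \<rho>2"
    "\<And>c. c \<in> C \<Longrightarrow> \<rho>2 c = \<rho>1 c" "val \<rho>2 Y2 = ?U \<union> ?U \<inter> u" "?U \<inter> u \<in> span (C, Y2, R2) \<rho>2" by metis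
  have r2: "realizes (C, Y2, R2) \<rho>2" using 2 by (simp add: refines_def)
  have "?U \<inter> v \<in> A" "?U \<inter> v \<subseteq> lo" using U uv by auto
  from refine_lo[OF r2 this] obtain Y3 R3 \<rho>3 where 3: "refines (C, Y2, R2) \<rho>2 (C, Y3, R3) \<rho>3"
    "\<And>c. c \<in> C \<Longrightarrow> \<rho>3 c = \<rho>2 c" "val \<rho>3 Y3 = val \<rho>2 Y2 \<union> ?U \<inter> v" "?U \<inter> v \<in> span (C, Y3, R3) \<rho>3"
    by metis
  have r3: "realizes (C, Y3, R3) \<rho>3" using 3 by (simp add: refines_def)
  note D3 = realizesD[OF r3]
  have eq: "\<rho>3 d = \<rho> d" if "d \<in> C" for d using that 1(2) 2(2) 3(2) by simp
  have U3: "val \<rho>3 Y3 = ?U" using 2(3) 3(3) by auto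
  have s3: "?U \<inter> u \<in> span (C, Y3, R3) \<rho>3" using span_mono[OF 3(1)] 2(4) by blast
  have dec: "\<rho>3 y \<inter> u = {} \<or> \<rho>3 y \<subseteq> u" "\<rho>3 y \<inter> v = {} \<or> \<rho>3 y \<subseteq> v" if y: "y \<in> Y3" for y
  proof -
    have "\<rho>3 y \<subseteq> ?U" using y unfolding U3[symmetric] by (auto simp: val_def)
    then show "\<rho>3 y \<inter> u = {} \<or> \<rho>3 y \<subseteq> u" "\<rho>3 y \<inter> v = {} \<or> \<rho>3 y \<subseteq> v"
      using span_decides[OF r3 s3 y] span_decides[OF r3 3(4) y] by blast+
  qed
  define B1 B2 where "B1 = {y. (y, c) \<in> R3 \<and> \<rho>3 y \<subseteq> u}" and "B2 = {y. (y, c) \<in> R3 \<and> \<rho>3 y \<subseteq> v}"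
  have "\<rho>3 y \<subseteq> u \<or> \<rho>3 y \<subseteq> v" if "(y, c) \<in> R3" for y
  proof -
    have "y \<in> Y3" using that D3(4) by auto
    then show ?thesis using D3(9)[of y] D3(14)[OF that] dec[of y] un eq[OF c] by blast
  qed
  then have B: "B1 \<union> B2 = {y. (y, c) \<in> R3}" by (auto simp: B1_def B2_def)
  have B1: "\<forall>y. (y, c) \<in> R3 \<longrightarrow> (if y \<in> B1 then \<rho>3 y \<subseteq> u else \<rho>3 y \<inter> u = {})"
    and B2: "\<forall>y. (y, c) \<in> R3 \<longrightarrow> (if y \<in> B2 then \<rho>3 y \<subseteq> v else \<rho>3 y \<inter> v = {})"
    using dec D3(4) by (auto simp: B1_def B2_def)
  obtain j where j: "j \<notin> C \<union> Y3" using ex_fresh[OF r3] .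
  have "u \<inter> v \<subseteq> val \<rho>3 Y3" unfolding U3 1(3) by blast
  from refines_split_mx[OF r3 c j uv ne reg un[folded eq[OF c]] this B1 B2 B]
  have ref: "refines (C, Y3, R3) \<rho>3
    (insert j C, Y3, {(y, d) \<in> R3. d \<noteq> c} \<union> B1 \<times> {c} \<union> B2 \<times> {j}) (\<rho>3(c := u, j := v))" .
  show ?thesis
  proof (rule that)
    show "refines (C, Y, R) \<rho>
      (insert j C, Y3, {(y, d) \<in> R3. d \<noteq> c} \<union> B1 \<times> {c} \<union> B2 \<times> {j}) (\<rho>3(c := u, j := v))"
      by (rule refines_trans[OF 1(1) refines_trans[OF 2(1) refines_trans[OF 3(1) ref]]])
  qed (use j c umx vmx eq in auto)
qed

text \<open>Induction on the number of maximal pieces whose maximal points are neither all in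
  \<open>x\<close> nor all outside. When none is left, the pieces with all maximal points in
  \<open>x\<close> lie inside \<open>x\<close> by regularity. The rest of \<open>x\<close> has no
  maximal points and is handled by \<open>refine_lo\<close>.\<close>

lemma refine:
  assumes "realizes K \<rho>" "x \<in> A"
  shows "\<exists>K' \<rho>'. refines K \<rho> K' \<rho>' \<and> x \<in> span K' \<rho>'"
proof -
  have "\<exists>K' \<rho>'. refines (C, Y, R) \<rho> K' \<rho>' \<and> x \<in> span K' \<rho>'" if "realizes (C, Y, R) \<rho>" for C Y R \<rho>
    using that
  proof (induction "card {c \<in> C. \<not> (\<rho> c \<inter> mx \<subseteq> x \<or> \<rho> c \<inter> mx \<inter> x = {})}" arbitrary: C Y R \<rho>
      rule: less_induct)
    case less
    note r = less.prems
    note D = realizesD[OF r]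
    show ?case
    proof (cases "\<exists>c\<in>C. \<not> (\<rho> c \<inter> mx \<subseteq> x \<or> \<rho> c \<inter> mx \<inter> x = {})")
      case True
      then obtain c where c: "c \<in> C" "\<not> \<rho> c \<inter> mx \<subseteq> x" "\<rho> c \<inter> mx \<inter> x \<noteq> {}" by blast
      obtain j Y' R' \<rho>' where j: "j \<notin> C" "refines (C, Y, R) \<rho> (insert j C, Y', R') \<rho>'"
        "\<rho>' c \<inter> mx \<inter> x = {}" "\<rho>' j \<inter> mx \<subseteq> x" and eq: "\<And>d. d \<in> C \<Longrightarrow> d \<noteq> c \<Longrightarrow> \<rho>' d = \<rho> d"
        using refine_split_by[OF r assms(2) c] by metis
      let ?S = "\<lambda>C \<rho>. {c \<in> C. \<not> (\<rho> c \<inter> mx \<subseteq> x \<or> \<rho> c \<inter> mx \<inter> x = {})}"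
      have "?S (insert j C) \<rho>' \<subseteq> ?S C \<rho> - {c}"
      proof
        fix d assume "d \<in> ?S (insert j C) \<rho>'"
        moreover from this have "d \<noteq> j" "d \<noteq> c" using j by auto
        ultimately show "d \<in> ?S C \<rho> - {c}" using eq[of d] by auto
      qed
      then have "?S (insert j C) \<rho>' \<subset> ?S C \<rho>" using c by blast
      then have "card (?S (insert j C) \<rho>') < card (?S C \<rho>)"
        using D(1) by (intro psubset_card_mono) auto
      moreover have "realizes (insert j C, Y', R') \<rho>'" using j by (simp add: refines_def)
      ultimately show ?thesis using less.hyps refines_trans[OF j(2)] by blast
    next
      case False
      define T where "T = {c \<in> C. \<rho> c \<inter> mx \<subseteq> x}"
      define S where "S = T \<union> {y \<in> Y. \<exists>c\<in>T. (y, c) \<in> R}"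
      have S: "S \<in> codes (C, Y, R)"
        using D(3,4) by (auto simp: S_def T_def codes_def)
      have vS: "val \<rho> S = val \<rho> T"
        using D(14) by (fastforce simp: S_def val_def)
      let ?V = "val \<rho> S"
      have VA: "?V \<in> A" using val_A[OF r codes_sub[OF S]] .
      have Vx: "?V \<subseteq> x"
        unfolding vS unfolding val_def
      proof (rule UN_least)
        fix c assume "c \<in> T"
        then have "c \<in> C" "\<rho> c \<inter> mx \<subseteq> x" by (auto simp: T_def)
        then show "\<rho> c \<subseteq> x" using dn_sub[OF _ assms(2), of "\<rho> c \<inter> mx"] D(7)[of c] by simp
      qed
      have lo: "x - ?V \<subseteq> lo"
      proof
        fix p assume p: "p \<in> x - ?V"
        then have pX: "p \<in> X" using A_sub assms(2) by blast
        then obtain c where c: "c \<in> C" "p \<in> \<rho> c" using D(11) by (auto simp: val_def)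
        have "p \<notin> mx"
        proof
          assume "p \<in> mx"
          then have "c \<in> T" using False c p by (auto simp: T_def)
          then show False using c p unfolding vS by (auto simp: val_def)
        qed
        then show "p \<in> lo" using pX by (simp add: lo_def)
      qed
      then have "x - ?V \<in> A" using dn_A[OF assms(2) VA] dn_lo by simp
      from refine_lo[OF r this lo] obtain Y' R' \<rho>' where *: "refines (C, Y, R) \<rho> (C, Y', R') \<rho>'"
        "x - ?V \<in> span (C, Y', R') \<rho>'" by metis
      have "?V \<in> span (C, Y', R') \<rho>'"
        using span_mono[OF *(1)] S by (auto simp: span_def)
      from span_Un[OF this *(2)] have "?V \<union> (x - ?V) \<in> span (C, Y', R') \<rho>'" .
      moreover have "?V \<union> (x - ?V) = x" using Vx by blast
      ultimately show ?thesis using *(1) by auto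
    qed
  qed
  then show ?thesis using assms(1) by (cases K) blast
qed

section \<open>Existence of realizations, transfer along embeddings, back-and-forth\<close>

lemma ex_realizes: "\<exists>K \<rho>. realizes K \<rho>"
proof (cases "X = {}")
  case True
  \<comment> \<open>Pieces are non-empty, so the one-element algebra needs the empty
    pattern.\<close>
  have "realizes ({}, {}, {}) (\<lambda>_. {})"
    unfolding realizes_def using True by (simp add: val_def)
  then show ?thesis by blast
next
  case False
  have "regular X" using ex_mx mx_sub by (fastforce simp: dn_def)
  then have "realizes ({0}, {}, {}) (\<lambda>_. X)"
    using False by (simp add: realizes_def val_def)
  then show ?thesis by blast
qed

lemma ex_realizes_finite:
  assumes "finite F" "F \<subseteq> A"
  shows "\<exists>K \<rho>. realizes K \<rho> \<and> F \<subseteq> span K \<rho>"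
  using assms
proof (induction F)
  case empty
  then show ?case using ex_realizes by simp
next
  case (insert x F)
  then obtain K \<rho> where K: "realizes K \<rho>" "F \<subseteq> span K \<rho>" by auto
  with refine[OF K(1), of x] insert.prems obtain K' \<rho>' where
    "refines K \<rho> K' \<rho>'" "x \<in> span K' \<rho>'" by auto
  with K(2) show ?case using span_mono[of K \<rho> K' \<rho>'] unfolding refines_def by blast
qed

lemma lo_iff: "a \<in> A \<Longrightarrow> a \<subseteq> lo \<longleftrightarrow> dn (X - a) = X"
proof
  assume a: "a \<in> A" "a \<subseteq> lo"
  have "regular X" using ex_mx mx_sub by (fastforce simp: dn_def)
  then show "dn (X - a) = X" using regular_minus_lo[of X a] a by simp
next
  assume a: "a \<in> A" "dn (X - a) = X"
  then have "a \<inter> mx = {}" using dn_mx[OF Diff_subset, of a] mx_sub unfolding a(2) by blast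
  then show "a \<subseteq> lo" using A_sub[OF a(1)] by (auto simp: lo_def)
qed

end

text \<open>An embedding acts on elements, not on points. It still transfers realizations, because
  \<open>regular_iff\<close> and \<open>lo_iff\<close> express the two conditions about maximal
  points in the language.\<close>

lemma realizes_embedding:
  assumes "poset_algebra X le A" "poset_algebra Z lz B"
    and g: "is_embedding g (set_str X le A) (set_str Z lz B)"
    and r: "poset_algebra.realizes X le A K \<rho>"
  shows "poset_algebra.realizes Z lz B K (g \<circ> \<rho>)"
    "S \<in> codes K \<Longrightarrow> val (g \<circ> \<rho>) S = g (val \<rho> S)"
proof -
  interpret P: poset_algebra X le A by fact
  interpret Q: poset_algebra Z lz B by fact
  obtain C Y R where K: "K = (C, Y, R)" by (cases K)
  note r = r[unfolded K]
  note D = P.realizesD[OF r]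
  have gA: "a \<in> A \<Longrightarrow> g a \<in> B" and inj: "inj_on g A" and g0: "g {} = {}" and g1: "g X = Z"
    and gU: "a \<in> A \<Longrightarrow> b \<in> A \<Longrightarrow> g (a \<union> b) = g a \<union> g b"
    and gI: "a \<in> A \<Longrightarrow> b \<in> A \<Longrightarrow> g (a \<inter> b) = g a \<inter> g b"
    and gD: "a \<in> A \<Longrightarrow> b \<in> A \<Longrightarrow> g (P.dn (a - b)) = Q.dn (g a - g b)" for a b
    using g unfolding is_embedding_def set_str_simps P.dn_def Q.dn_def by blast+
  have sub: "g a \<subseteq> g b" if "a \<in> A" "b \<in> A" "a \<subseteq> b" for a b
    using gI[OF that(1,2)] that by (metis inf.absorb_iff1)
  have ne: "g a \<noteq> {}" if "a \<in> A" "a \<noteq> {}" for a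
    using inj_onD[OF inj, of a "{}"] that g0 by auto
  have val: "val (g \<circ> \<rho>) S = g (val \<rho> S)" if "S \<subseteq> C \<union> Y" for S
  proof -
    have "finite S" using that D(1,2) by (meson finite_UnI finite_subset)
    then show ?thesis using that
    proof (induction S)
      case (insert i S)
      have "\<rho> i \<in> A" using insert.prems D(5,8)[of i] by auto
      then have "g (\<rho> i) \<union> g (val \<rho> S) = g (\<rho> i \<union> val \<rho> S)"
        using gU P.val_A[OF r, of S] insert.prems by simp
      moreover have "val (g \<circ> \<rho>) S = g (val \<rho> S)" using insert by blast
      ultimately show ?case unfolding val_def by simp
    qed (simp add: val_def g0)
  qed
  show "S \<in> codes K \<Longrightarrow> val (g \<circ> \<rho>) S = g (val \<rho> S)"
    using val codes_sub[of S C Y R] by (simp add: K)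
  have reg: "Q.regular (g a)" if "a \<in> A" "P.regular a" for a
    using that P.regular_iff[OF that(1)] Q.regular_iff[OF gA[OF that(1)]]
      gD[of X "P.dn (X - a)"] gD[of X a] P.dn_A[of X a] g1 by simp
  have lo: "g a \<subseteq> Q.lo" if "a \<in> A" "a \<subseteq> P.lo" for a
    using that P.lo_iff[OF that(1)] Q.lo_iff[OF gA[OF that(1)]] gD[of X a] g1 by simp
  have dis: "g a \<inter> g b = {}" if "a \<in> A" "b \<in> A" "a \<inter> b = {}" for a b
    using gI[of a b] g0 that by simp
  have vY: "val \<rho> Y \<in> A" using P.val_A[OF r, of Y] by simp
  show "Q.realizes K (g \<circ> \<rho>)"
    unfolding K Q.realizes_def case_prod_conv
  proof (intro conjI ballI impI)
    show "(g \<circ> \<rho>) c \<in> B" "(g \<circ> \<rho>) c \<noteq> {}" "Q.regular ((g \<circ> \<rho>) c)" if "c \<in> C" for c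
      unfolding o_def using gA ne reg D(5,6,7)[OF that] by blast+
    show "(g \<circ> \<rho>) y \<in> B" "(g \<circ> \<rho>) y \<noteq> {}" "(g \<circ> \<rho>) y \<subseteq> Q.lo" if "y \<in> Y" for y
      unfolding o_def using gA ne lo D(8,9,10)[OF that] by blast+
    show "val (g \<circ> \<rho>) C = Z" using val[of C] D(11) g1 by simp
    show "(g \<circ> \<rho>) c \<inter> (g \<circ> \<rho>) d \<subseteq> val (g \<circ> \<rho>) Y" if "c \<in> C" "d \<in> C" "c \<noteq> d" for c d
      using sub[OF P.Int_A[OF D(5)[OF that(1)] D(5)[OF that(2)]] vY D(12)[OF that]]
        gI[OF D(5)[OF that(1)] D(5)[OF that(2)]] val[of Y] by simp
    show "(g \<circ> \<rho>) y \<inter> (g \<circ> \<rho>) z = {}" if "y \<in> Y" "z \<in> Y" "y \<noteq> z" for y z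
      unfolding o_def using dis D(8,13) that by blast
    show "if (y, c) \<in> R then (g \<circ> \<rho>) y \<subseteq> (g \<circ> \<rho>) c else (g \<circ> \<rho>) y \<inter> (g \<circ> \<rho>) c = {}"
      if "y \<in> Y" "c \<in> C" for y c
      using that sub[of "\<rho> y" "\<rho> c"] dis[of "\<rho> y" "\<rho> c"] D(5,8,14,15) by simp
  qed (use D(1-4) in auto)
qed

lemma forth:
  assumes "poset_algebra X le A" "generic_algebra (Z :: 'p set) lz B"
    and r: "poset_algebra.realizes (X :: 'p set) le A K \<rho>" "poset_algebra.realizes Z lz B K \<sigma>"
    and x: "x \<in> A"
  obtains K' \<rho>' \<sigma>' t T where "poset_algebra.realizes X le A K' \<rho>'" "poset_algebra.realizes Z lz B K' \<sigma>'"
    "\<forall>S\<in>codes K. t S \<in> codes K' \<and> val \<rho>' (t S) = val \<rho> S \<and> val \<sigma>' (t S) = val \<sigma> S"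
    "T \<in> codes K'" "val \<rho>' T = x"
proof -
  interpret P: poset_algebra X le A by fact
  from P.refine[OF r(1) x] obtain K' \<rho>' where K': "P.refines K \<rho> K' \<rho>'" "x \<in> P.span K' \<rho>'" by blast
  from K'(1) obtain t where t: "P.realizes K' \<rho>'" "mirrors TYPE('p) K K' t"
    "\<forall>S\<in>codes K. t S \<in> codes K' \<and> val \<rho>' (t S) = val \<rho> S"
    by (auto simp: P.refines_def)
  from t(2) assms(2) r(2) obtain \<sigma>' where "poset_algebra.realizes Z lz B K' \<sigma>'"
    "\<forall>S\<in>codes K. val \<sigma>' (t S) = val \<sigma> S"
    unfolding mirrors_def by blast
  moreover obtain T where "T \<in> codes K'" "val \<rho>' T = x" using K'(2) by (auto simp: P.span_def)
  ultimately show ?thesis using that t by blast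
qed

text \<open>The pattern varies in the induction, so that a quantifier can be answered by a
  refinement and its copy on the other side. Atomic formulas agree because \<open>val\<close> embeds
  the same finite algebra \<open>pat_str K\<close> into both algebras, and the equation is decided
  there.\<close>

lemma pattern_equiv:
  fixes X Z :: "'p set"
  assumes "generic_algebra X le A" "generic_algebra Z lz B"
  shows "poset_algebra.realizes X le A K \<rho> \<Longrightarrow> poset_algebra.realizes Z lz B K \<sigma> \<Longrightarrow>
    range s \<subseteq> codes K \<Longrightarrow>
    sat (set_str X le A) (val \<rho> \<circ> s) \<phi> \<longleftrightarrow> sat (set_str Z lz B) (val \<sigma> \<circ> s) \<phi>"
proof (induction \<phi> arbitrary: K \<rho> \<sigma> s)
  interpret P: generic_algebra X le A by fact
  interpret Q: generic_algebra Z lz B by fact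
  case (Eq u v)
  have c: "carrier (pat_str K) = codes K" by (cases K) (simp add: pat_str_def)
  note str = P.pat_structure[OF Eq(1)]
  have s: "range s \<subseteq> carrier (pat_str K)" using Eq(3) c by simp
  have "inj_on (val \<rho>) (codes K)" "inj_on (val \<sigma>) (codes K)"
    using P.val_embedding[OF Eq(1)] Q.val_embedding[OF Eq(2)] c by (simp_all add: is_embedding_def)
  then show ?case
    using eval_tm_in_carrier[OF str s] c
    unfolding sat.simps eval_tm_embedding[OF str P.val_embedding[OF Eq(1)] s]
      eval_tm_embedding[OF str Q.val_embedding[OF Eq(2)] s]
    by (simp add: inj_on_eq_iff)
next
  interpret P: generic_algebra X le A by fact
  interpret Q: generic_algebra Z lz B by fact
  have PQ: "poset_algebra X le A" "poset_algebra Z lz B" ..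
  case (Ex n \<phi>)
  have forward: "\<exists>y\<in>B. sat (set_str Z lz B) ((val \<sigma> \<circ> s)(n := y)) \<phi>"
    if x: "x \<in> A" "sat (set_str X le A) ((val \<rho> \<circ> s)(n := x)) \<phi>" for x
  proof -
    obtain K' \<rho>' \<sigma>' t T where *: "P.realizes K' \<rho>'" "Q.realizes K' \<sigma>'"
      "\<forall>S\<in>codes K. t S \<in> codes K' \<and> val \<rho>' (t S) = val \<rho> S \<and> val \<sigma>' (t S) = val \<sigma> S"
      "T \<in> codes K'" "val \<rho>' T = x"
      using forth[OF PQ(1) assms(2) Ex.prems(1,2) x(1)] by metis
    have s: "s v \<in> codes K" for v using Ex.prems(3) by auto
    let ?s = "(t \<circ> s)(n := T)"
    have "val \<rho>' \<circ> ?s = (val \<rho> \<circ> s)(n := x)" "val \<sigma>' \<circ> ?s = (val \<sigma> \<circ> s)(n := val \<sigma>' T)"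
      using * s by (auto simp: fun_eq_iff)
    moreover have "range ?s \<subseteq> codes K'" using * s by auto
    moreover have "val \<sigma>' T \<in> B"
      using Q.val_embedding[OF *(2)] *(4) by (cases K') (auto simp: is_embedding_def pat_str_def)
    ultimately show ?thesis using Ex.IH[OF *(1,2)] x(2) by metis
  qed
  have backward: "\<exists>x\<in>A. sat (set_str X le A) ((val \<rho> \<circ> s)(n := x)) \<phi>"
    if y: "y \<in> B" "sat (set_str Z lz B) ((val \<sigma> \<circ> s)(n := y)) \<phi>" for y
  proof -
    obtain K' \<rho>' \<sigma>' t T where *: "P.realizes K' \<rho>'" "Q.realizes K' \<sigma>'"
      "\<forall>S\<in>codes K. t S \<in> codes K' \<and> val \<sigma>' (t S) = val \<sigma> S \<and> val \<rho>' (t S) = val \<rho> S"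
      "T \<in> codes K'" "val \<sigma>' T = y"
      using forth[OF PQ(2) assms(1) Ex.prems(2,1) y(1)] by metis
    have s: "s v \<in> codes K" for v using Ex.prems(3) by auto
    let ?s = "(t \<circ> s)(n := T)"
    have "val \<sigma>' \<circ> ?s = (val \<sigma> \<circ> s)(n := y)" "val \<rho>' \<circ> ?s = (val \<rho> \<circ> s)(n := val \<rho>' T)"
      using * s by (auto simp: fun_eq_iff)
    moreover have "range ?s \<subseteq> codes K'" using * s by auto
    moreover have "val \<rho>' T \<in> A"
      using P.val_embedding[OF *(1)] *(4) by (cases K') (auto simp: is_embedding_def pat_str_def)
    ultimately show ?thesis using Ex.IH[OF *(1,2)] y(2) by metis
  qed
  show ?case unfolding sat.simps set_str_simps using forward backward by blast
qed auto

section \<open>Completeness over the diagram\<close>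

abbreviation (input) "T3 \<equiv> V3_theory \<union> {axiom_D3, axiom_S3}"

lemma is_model_T3_iff:
  "is_model M T3 \<longleftrightarrow> is_model M V3_theory \<and>
     (\<forall>a\<in>carrier M. a = diffS M (oneS M) (diffS M (oneS M) a) \<and> a \<noteq> zeroS M \<longrightarrow>
        (\<exists>b\<in>carrier M. b \<noteq> zeroS M \<and> llS M b a)) \<and>
     (\<forall>a\<in>carrier M. \<forall>b1\<in>carrier M. \<forall>b2\<in>carrier M.
        llS M (joinS M b1 b2) a \<and> a \<noteq> zeroS M \<longrightarrow>
        (\<exists>a1\<in>carrier M. \<exists>a2\<in>carrier M. a1 \<noteq> zeroS M \<and> a2 \<noteq> zeroS M \<and>
           diffS M a a2 = a1 \<and> leS M b1 a1 \<and>
           diffS M a a1 = a2 \<and> leS M b2 a2 \<and>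
           meetS M a1 a2 = meetS M b1 b2))" (is "?l \<longleftrightarrow> _ \<and> ?D \<and> ?S")
proof (cases "is_structure M")
  case True
  then obtain e :: "nat \<Rightarrow> 'a" where e: "range e \<subseteq> carrier M" using ex_assignment by blast
  have "(\<forall>e. range e \<subseteq> carrier M \<longrightarrow> sat M e axiom_D3) \<longleftrightarrow> ?D"
    "(\<forall>e. range e \<subseteq> carrier M \<longrightarrow> sat M e axiom_S3) \<longleftrightarrow> ?S"
    unfolding sat_D3_iff sat_S3_iff using e by blast+
  moreover have "?l \<longleftrightarrow> is_model M V3_theory \<and> (\<forall>e. range e \<subseteq> carrier M \<longrightarrow> sat M e axiom_D3) \<and>
      (\<forall>e. range e \<subseteq> carrier M \<longrightarrow> sat M e axiom_S3)"
    unfolding is_model_def by blast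
  ultimately show ?thesis by simp
qed (simp add: is_model_def)

lemma is_embedding_inv:
  assumes M: "is_structure M" and f: "is_embedding f M N" and surj: "f ` carrier M = carrier N"
  shows "is_embedding (inv_into (carrier M) f) N M"
proof -
  let ?g = "inv_into (carrier M) f"
  have inj: "inj_on f (carrier M)" using f by (simp add: is_embedding_def)
  have gf: "?g (f x) = x" if "x \<in> carrier M" for x using inv_into_f_f[OF inj that] .
  have c: "zeroS M \<in> carrier M" "oneS M \<in> carrier M" and cl: "\<And>x y. x \<in> carrier M \<Longrightarrow> y \<in> carrier M \<Longrightarrow>
      joinS M x y \<in> carrier M \<and> meetS M x y \<in> carrier M \<and> diffS M x y \<in> carrier M"
    using M by (auto simp: is_structure_def)
  have fz: "f (zeroS M) = zeroS N" "f (oneS M) = oneS N" and fh: "\<And>x y. x \<in> carrier M \<Longrightarrow> y \<in> carrier M \<Longrightarrow>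
      joinS N (f x) (f y) = f (joinS M x y) \<and> meetS N (f x) (f y) = f (meetS M x y) \<and>
      diffS N (f x) (f y) = f (diffS M x y)"
    using f by (auto simp: is_embedding_def)
  show ?thesis
    unfolding is_embedding_def surj[symmetric] fz[symmetric]
    using c cl fh by (auto simp: gf intro!: inj_onI)
qed

lemma finite_free_vars: "finite (free_vars \<phi>)"
proof -
  have "finite (vars_tm t)" for t by (induction t) auto
  then show ?thesis by (induction \<phi>) auto
qed

lemma (in coheyting) rep_poset_algebra: "poset_algebra primes (\<subseteq>) (rep ` L)"
  by unfold_locales auto

lemma (in coheyting) rep_generic:
  assumes "is_model M T3"
  shows "generic_algebra primes (\<subseteq>) (rep ` L)"
proof -
  interpret P: poset_algebra primes "(\<subseteq>)" "rep ` L" by (rule rep_poset_algebra)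
  let ?N = "set_str primes (\<subseteq>) (rep ` L)"
  have N: "is_model ?N T3"
    by (rule is_model_iso[OF assms rep_embedding]) simp
  have d: "diffS ?N a b = P.dn (a - b)" for a b by (simp add: P.dn_def)
  show ?thesis
  proof
    show "\<exists>b\<in>rep ` L. b \<noteq> {} \<and> P.dn (a - b) = a \<and> b \<subseteq> a"
      if "a \<in> rep ` L" "a = P.dn (primes - P.dn (primes - a))" "a \<noteq> {}" for a
    proof -
      have "diffS ?N (oneS ?N) (diffS ?N (oneS ?N) a) = P.dn (primes - P.dn (primes - a))"
        by (simp add: P.dn_def)
      then have eq: "a = diffS ?N (oneS ?N) (diffS ?N (oneS ?N) a)" by (rule trans[OF that(2) sym])
      have a: "a \<in> carrier ?N" "a \<noteq> zeroS ?N" using that(1,3) by simp_all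
      from N[unfolded is_model_T3_iff, THEN conjunct2, THEN conjunct1, rule_format, OF a(1) conjI[OF eq a(2)]]
      obtain b where "b \<in> carrier ?N" "b \<noteq> zeroS ?N" "llS ?N b a" by blast
      then show ?thesis unfolding llS_def d by (auto simp: leS_def)
    qed
    show "\<exists>a1\<in>rep ` L. \<exists>a2\<in>rep ` L. a1 \<noteq> {} \<and> a2 \<noteq> {} \<and> P.dn (a - a2) = a1 \<and> b1 \<subseteq> a1 \<and>
        P.dn (a - a1) = a2 \<and> b2 \<subseteq> a2 \<and> a1 \<inter> a2 = b1 \<inter> b2"
      if "a \<in> rep ` L" "b1 \<in> rep ` L" "b2 \<in> rep ` L" "P.dn (a - (b1 \<union> b2)) = a" "b1 \<union> b2 \<subseteq> a" "a \<noteq> {}"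
      for a b1 b2
    proof -
      have ll: "llS ?N (joinS ?N b1 b2) a"
        unfolding llS_def d unfolding set_str_simps leS_set_str using that by simp
      have mem: "a \<in> carrier ?N" "b1 \<in> carrier ?N" "b2 \<in> carrier ?N" "a \<noteq> zeroS ?N"
        using that(1-3,6) by simp_all
      have "\<exists>a1\<in>carrier ?N. \<exists>a2\<in>carrier ?N. a1 \<noteq> zeroS ?N \<and> a2 \<noteq> zeroS ?N \<and>
           diffS ?N a a2 = a1 \<and> leS ?N b1 a1 \<and> diffS ?N a a1 = a2 \<and> leS ?N b2 a2 \<and>
           meetS ?N a1 a2 = meetS ?N b1 b2"
        by (rule N[unfolded is_model_T3_iff, THEN conjunct2, THEN conjunct2, rule_format,
              OF mem(1-3) conjI[OF ll mem(4)]])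
      then show ?thesis unfolding d unfolding leS_set_str set_str_simps .
    qed
  qed
qed

text \<open>The finitely many parameters of \<open>\<phi>\<close> are put into the span of a pattern
  realized in \<open>M\<close>. Both embeddings carry it to realizations of the same pattern, and
  \<open>pattern_equiv\<close> compares these. The prime ideals of \<open>N1\<close> and
  \<open>N2\<close> have the same type, as \<open>mirrors\<close> requires.\<close>

lemma diagram_complete:
  fixes M N1 N2 :: "'u coh_structure"
  assumes M: "is_model M V3_theory" and N1: "is_model N1 T3" and N2: "is_model N2 T3"
    and f1: "is_embedding f1 M N1" and f2: "is_embedding f2 M N2" and e: "range e \<subseteq> carrier M"
  shows "sat N1 (f1 \<circ> e) \<phi> \<longleftrightarrow> sat N2 (f2 \<circ> e) \<phi>"
proof -
  interpret M: coheyting M by standard (fact M)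
  interpret PM: poset_algebra M.primes "(\<subseteq>)" "M.rep ` M.L" by (rule M.rep_poset_algebra)
  let ?F = "(M.rep \<circ> e) ` free_vars \<phi>"
  have "finite ?F" "?F \<subseteq> M.rep ` M.L" using finite_free_vars e by (auto simp: image_subset_iff)
  from PM.ex_realizes_finite[OF this] obtain K \<rho> where K: "PM.realizes K \<rho>" "?F \<subseteq> PM.span K \<rho>"
    by blast
  have "\<forall>v. \<exists>S\<in>codes K. v \<in> free_vars \<phi> \<longrightarrow> val \<rho> S = M.rep (e v)"
  proof
    fix v
    have "{} \<in> codes K" by (cases K) (auto simp: codes_def)
    moreover have "v \<in> free_vars \<phi> \<Longrightarrow> M.rep (e v) \<in> PM.span K \<rho>" using K(2) by auto
    ultimately show "\<exists>S\<in>codes K. v \<in> free_vars \<phi> \<longrightarrow> val \<rho> S = M.rep (e v)"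
      unfolding PM.span_def by (cases "v \<in> free_vars \<phi>") (auto simp: image_iff)
  qed
  then obtain s where s: "\<And>v. s v \<in> codes K" "\<And>v. v \<in> free_vars \<phi> \<Longrightarrow> val \<rho> (s v) = M.rep (e v)"
    by metis
  let ?g = "inv_into M.L M.rep"
  have g: "is_embedding ?g (set_str M.primes (\<subseteq>) (M.rep ` M.L)) M"
    by (rule is_embedding_inv[OF M.struct M.rep_embedding]) simp
  have sM: "is_structure (set_str M.primes (\<subseteq>) (M.rep ` M.L))"
    using M.rep.model_V3 by (simp add: is_model_def)
  have side: "\<exists>\<sigma>. poset_algebra.realizes (coheyting.primes N) (\<subseteq>) (coheyting.rep N ` carrier N) K \<sigma> \<and>
      (sat N (f \<circ> e) \<phi> \<longleftrightarrow> sat (set_str (coheyting.primes N) (\<subseteq>) (coheyting.rep N ` carrier N)) (val \<sigma> \<circ> s) \<phi>)"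
    if N: "is_model N V3_theory" and f: "is_embedding f M N" for N :: "'u coh_structure" and f
  proof -
    interpret N: coheyting N by standard (fact N)
    interpret PN: poset_algebra N.primes "(\<subseteq>)" "N.rep ` N.L" by (rule N.rep_poset_algebra)
    have h: "is_embedding (N.rep \<circ> (f \<circ> ?g)) (set_str M.primes (\<subseteq>) (M.rep ` M.L))
        (set_str N.primes (\<subseteq>) (N.rep ` N.L))"
      by (intro is_embedding_comp[OF sM is_embedding_comp[OF sM g f] N.rep_embedding])
    note re = realizes_embedding[OF PM.poset_algebra_axioms PN.poset_algebra_axioms h K(1)]
    have fe: "range (f \<circ> e) \<subseteq> N.L" using f e unfolding is_embedding_def by fastforce
    have "sat N (f \<circ> e) \<phi> \<longleftrightarrow> sat (set_str N.primes (\<subseteq>) (N.rep ` N.L)) (N.rep \<circ> (f \<circ> e)) \<phi>"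
      using sat_iso[OF N.struct N.rep_embedding _ fe] by simp
    also have "\<dots> \<longleftrightarrow> sat (set_str N.primes (\<subseteq>) (N.rep ` N.L)) (val (N.rep \<circ> (f \<circ> ?g) \<circ> \<rho>) \<circ> s) \<phi>"
    proof (rule sat_cong)
      fix v assume v: "v \<in> free_vars \<phi>"
      have "e v \<in> M.L" using e by auto
      then have "?g (M.rep (e v)) = e v" by (rule inv_into_f_f[OF M.rep_inj])
      then show "(N.rep \<circ> (f \<circ> e)) v = (val (N.rep \<circ> (f \<circ> ?g) \<circ> \<rho>) \<circ> s) v"
        using re(2)[OF s(1)[of v]] s(2)[OF v] by (simp only: o_apply)
    qed
    finally show ?thesis using re(1) by blast
  qed
  have V: "is_model N1 V3_theory" "is_model N2 V3_theory" using N1 N2 by (auto simp: is_model_def)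
  interpret N1: coheyting N1 by standard (fact V)
  interpret N2: coheyting N2 by standard (fact V)
  from side[OF V(1) f1] obtain \<sigma>1 where 1: "poset_algebra.realizes N1.primes (\<subseteq>) (N1.rep ` N1.L) K \<sigma>1"
    "sat N1 (f1 \<circ> e) \<phi> \<longleftrightarrow> sat (set_str N1.primes (\<subseteq>) (N1.rep ` N1.L)) (val \<sigma>1 \<circ> s) \<phi>" by blast
  from side[OF V(2) f2] obtain \<sigma>2 where 2: "poset_algebra.realizes N2.primes (\<subseteq>) (N2.rep ` N2.L) K \<sigma>2"
    "sat N2 (f2 \<circ> e) \<phi> \<longleftrightarrow> sat (set_str N2.primes (\<subseteq>) (N2.rep ` N2.L)) (val \<sigma>2 \<circ> s) \<phi>" by blast
  have "range s \<subseteq> codes K" using s(1) by auto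
  then show ?thesis
    using pattern_equiv[OF N1.rep_generic[OF N1] N2.rep_generic[OF N2] 1(1) 2(1)] 1(2) 2(2) by simp
qed

section \<open>A model over a given poset\<close>

text \<open>A path \<open>s\<close> is a maximal point \<open>(s, True)\<close>. The letter \<open>None\<close> makes the path leave the
  non-maximal point it was above so far and start a new one; if it does so for the last time just
  before position \<open>N\<close> (or never, and \<open>N = 0\<close>), then the path is above exactly one non-maximal point,
  born at \<open>N\<close>. That point is determined by the letters before \<open>N\<close> and the first components after
  it. It is represented by \<open>(s, False)\<close> for any such path \<open>s\<close>, so that the order \<open>tle\<close> is only a
  preorder.\<close>

type_synonym ('i, 'j) path = "nat \<Rightarrow> (('i \<times> bool) \<times> ('j \<times> bool)) option"

definition born :: "nat \<Rightarrow> ('i, 'j) path \<Rightarrow> bool" where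
  "born N s \<longleftrightarrow> (N = 0 \<or> s (N - 1) = None) \<and> (\<forall>k\<ge>N. s k \<noteq> None)"

definition agree :: "nat \<Rightarrow> ('i, 'j) path \<Rightarrow> ('i, 'j) path \<Rightarrow> bool" where
  "agree N s s' \<longleftrightarrow> (\<forall>k<N. s k = s' k) \<and> (\<forall>k\<ge>N. map_option fst (s k) = map_option fst (s' k))"

definition agree_upto :: "nat \<Rightarrow> nat \<Rightarrow> ('i, 'j) path \<Rightarrow> ('i, 'j) path \<Rightarrow> bool" where
  "agree_upto n N s s' \<longleftrightarrow>
     (\<forall>k<n. (k < N \<longrightarrow> s k = s' k) \<and> (N \<le> k \<longrightarrow> map_option fst (s k) = map_option fst (s' k)))"

fun tle :: "('i, 'j) path \<times> bool \<Rightarrow> ('i, 'j) path \<times> bool \<Rightarrow> bool" where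
  "tle (s, l) (s', l') \<longleftrightarrow> s = s' \<and> l = l' \<or> \<not> l \<and> (\<exists>N. born N s \<and> agree N s s')"

lemma born_unique: "born N s \<Longrightarrow> born N' s \<Longrightarrow> N = N'"
proof -
  have "False" if "born N s" "born N' s" "N < N'" for N N'
  proof -
    have "s (N' - 1) = None" "N' - 1 \<ge> N" using that by (auto simp: born_def)
    then show False using that(1) unfolding born_def by blast
  qed
  then show "born N s \<Longrightarrow> born N' s \<Longrightarrow> N = N'" by (meson linorder_neqE_nat)
qed

lemma agree_refl [simp]: "agree N s s"
  by (simp add: agree_def)

lemma agree_sym: "agree N s s' \<Longrightarrow> agree N s' s"
  by (simp add: agree_def)

lemma agree_trans: "agree N s s' \<Longrightarrow> agree N s' s'' \<Longrightarrow> agree N s s''"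
  by (simp add: agree_def)

lemma born_agree: "born N s \<Longrightarrow> agree N s s' \<Longrightarrow> born N s'"
  unfolding born_def agree_def by (metis diff_less map_option_is_None not_gr_zero zero_less_one)

lemma agree_imp_upto: "agree N s s' \<Longrightarrow> agree_upto n N s s'"
  by (simp add: agree_def agree_upto_def)

lemma agree_upto_sym: "agree_upto n N s s' \<Longrightarrow> agree_upto n N s' s"
  by (simp add: agree_upto_def)

lemma agree_upto_trans: "agree_upto n N s s' \<Longrightarrow> agree_upto n N s' s'' \<Longrightarrow> agree_upto n N s s''"
  by (simp add: agree_upto_def)

lemma agree_upto_mono: "agree_upto n N s s' \<Longrightarrow> m \<le> n \<Longrightarrow> agree_upto m N s s'"
  by (simp add: agree_upto_def)

lemma agree_upto_eq: "agree_upto n N s s' \<Longrightarrow> n \<le> N \<Longrightarrow> k < n \<Longrightarrow> s k = s' k"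
  by (simp add: agree_upto_def)

text \<open>Only the first letter is restricted, by \<open>D\<close>: it is the place where a given
  poset is encoded. All later letters merely supply choices.\<close>

locale tree_model =
  fixes D :: "(('i \<times> bool) \<times> ('j \<times> bool)) set"
begin

definition root :: "('i, 'j) path \<Rightarrow> bool" where
  "root s \<longleftrightarrow> s 0 \<in> Some ` D"

definition TX :: "(('i, 'j) path \<times> bool) set" where
  "TX = {(s, l). root s \<and> (l \<or> (\<exists>N. born N s))}"

definition td :: "(('i, 'j) path \<times> bool) set \<Rightarrow> (('i, 'j) path \<times> bool) set" where
  "td W = {p \<in> TX. \<exists>q\<in>W. tle p q}"

text \<open>Membership in a set of level \<open>n\<close> depends on the first \<open>n\<close> letters only, and a non-maximal
  point born after them is not yet distinguished from the paths above it.\<close>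

definition level :: "nat \<Rightarrow> (('i, 'j) path \<times> bool) set \<Rightarrow> bool" where
  "level n U \<longleftrightarrow>
     (\<forall>s s'. root s \<longrightarrow> root s' \<longrightarrow> (\<forall>k<n. s k = s' k) \<longrightarrow> (s, True) \<in> U \<longrightarrow> (s', True) \<in> U) \<and>
     (\<forall>N s s'. N \<le> n \<longrightarrow> root s \<longrightarrow> root s' \<longrightarrow> born N s \<longrightarrow> born N s' \<longrightarrow> agree_upto n N s s' \<longrightarrow>
        (s, False) \<in> U \<longrightarrow> (s', False) \<in> U) \<and>
     (\<forall>N s. n < N \<longrightarrow> root s \<longrightarrow> born N s \<longrightarrow> ((s, False) \<in> U \<longleftrightarrow> (s, True) \<in> U))"

text \<open>The bound \<open>n\<ge>1\<close> ensures that replacing letters from position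
  \<open>n\<close> on never touches the first letter, hence preserves \<open>root\<close>.\<close>

definition TA :: "(('i, 'j) path \<times> bool) set set" where
  "TA = {U. U \<subseteq> TX \<and> (\<forall>p\<in>TX. \<forall>q\<in>U. tle p q \<longrightarrow> p \<in> U) \<and> (\<exists>n\<ge>1. level n U)}"

lemma levelD:
  assumes "level n U"
  shows "root s \<Longrightarrow> root s' \<Longrightarrow> (\<And>k. k < n \<Longrightarrow> s k = s' k) \<Longrightarrow> (s, True) \<in> U \<longleftrightarrow> (s', True) \<in> U"
    "N \<le> n \<Longrightarrow> root s \<Longrightarrow> root s' \<Longrightarrow> born N s \<Longrightarrow> born N s' \<Longrightarrow> agree_upto n N s s' \<Longrightarrow>
      (s, False) \<in> U \<longleftrightarrow> (s', False) \<in> U"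
    "n < N \<Longrightarrow> root s \<Longrightarrow> born N s \<Longrightarrow> (s, False) \<in> U \<longleftrightarrow> (s, True) \<in> U"
proof -
  show "root s \<Longrightarrow> root s' \<Longrightarrow> (\<And>k. k < n \<Longrightarrow> s k = s' k) \<Longrightarrow> (s, True) \<in> U \<longleftrightarrow> (s', True) \<in> U"
    using assms unfolding level_def by metis
  show "N \<le> n \<Longrightarrow> root s \<Longrightarrow> root s' \<Longrightarrow> born N s \<Longrightarrow> born N s' \<Longrightarrow> agree_upto n N s s' \<Longrightarrow>
      (s, False) \<in> U \<longleftrightarrow> (s', False) \<in> U"
    using assms agree_upto_sym[of n N s s'] unfolding level_def by metis
  show "n < N \<Longrightarrow> root s \<Longrightarrow> born N s \<Longrightarrow> (s, False) \<in> U \<longleftrightarrow> (s, True) \<in> U"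
    using assms unfolding level_def by metis
qed

text \<open>The delicate case is birth at \<open>Suc n\<close>. At level \<open>n\<close> such a
  point is identified with its path, and agreement up to \<open>Suc n\<close> then means equality of
  all these letters.\<close>

lemma level_Suc:
  assumes U: "level n U"
  shows "level (Suc n) U"
  unfolding level_def
proof (intro conjI allI impI)
  fix s s' :: "('i, 'j) path" assume "root s" "root s'" "\<forall>k<Suc n. s k = s' k" "(s, True) \<in> U"
  then show "(s', True) \<in> U" using levelD(1)[OF U, of s s'] by simp
next
  fix N and s s' :: "('i, 'j) path"
  assume *: "N \<le> Suc n" "root s" "root s'" "born N s" "born N s'" "agree_upto (Suc n) N s s'" "(s, False) \<in> U"
  show "(s', False) \<in> U"
  proof (cases "N \<le> n")
    case True
    then show ?thesis using levelD(2)[OF U True *(2-5)] agree_upto_mono[OF *(6), of n] * by simp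
  next
    case False
    then have "n < N" by simp
    then show ?thesis
      using levelD(3)[OF U _ *(2,4)] levelD(3)[OF U _ *(3,5)] levelD(1)[OF U *(2,3)] * agree_upto_eq[OF *(6)]
      by simp
  qed
next
  fix N and s :: "('i, 'j) path" assume "Suc n < N" "root s" "born N s"
  then show "(s, False) \<in> U \<longleftrightarrow> (s, True) \<in> U" using levelD(3)[OF U, of N s] by simp
qed

lemma level_mono: "n \<le> m \<Longrightarrow> level n U \<Longrightarrow> level m U"
  by (induction rule: dec_induct) (auto intro: level_Suc)

lemma level_comb:
  assumes "level n U" "level n V" and W: "\<And>p. p \<in> W \<longleftrightarrow> f (p \<in> U) (p \<in> V)"
  shows "level n W"
  unfolding level_def W
proof (intro conjI allI impI)
  note u = levelD[OF assms(1)] and v = levelD[OF assms(2)]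
  fix s s' :: "('i, 'j) path"
  show "f ((s', True) \<in> U) ((s', True) \<in> V)"
    if "root s" "root s'" "\<forall>k<n. s k = s' k" "f ((s, True) \<in> U) ((s, True) \<in> V)"
    using u(1)[of s s'] v(1)[of s s'] that by simp
  fix N
  show "f ((s', False) \<in> U) ((s', False) \<in> V)"
    if "N \<le> n" "root s" "root s'" "born N s" "born N s'" "agree_upto n N s s'"
      "f ((s, False) \<in> U) ((s, False) \<in> V)"
    using u(2)[OF that(1-6)] v(2)[OF that(1-6)] that(7) by simp
  show "f ((s, False) \<in> U) ((s, False) \<in> V) \<longleftrightarrow> f ((s, True) \<in> U) ((s, True) \<in> V)"
    if "n < N" "root s" "born N s"
    using u(3)[OF that] v(3)[OF that] by simp
qed

lemma level_bool:
  assumes "level n U" "level n V"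
  shows "level n (U \<union> V)" "level n (U \<inter> V)" "level n (U - V)"
  using level_comb[OF assms, of "U \<union> V" "(\<or>)"] level_comb[OF assms, of "U \<inter> V" "(\<and>)"]
    level_comb[OF assms, of "U - V" "\<lambda>x y. x \<and> \<not> y"] by simp_all

lemma tle_refl: "tle p p"
  by (cases p) simp

lemma tle_trans: "tle p q \<Longrightarrow> tle q r \<Longrightarrow> tle p r"
proof (cases p; cases q; cases r)
  fix s l s' l' s'' l''
  assume *: "p = (s, l)" "q = (s', l')" "r = (s'', l'')" "tle p q" "tle q r"
  show "tle p r"
  proof (cases "p = q \<or> q = r")
    case False
    then obtain N N' where N: "\<not> l" "born N s" "agree N s s'" "born N' s'" "agree N' s' s''"
      using * by auto
    then have "N = N'" using born_agree born_unique by metis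
    then have "agree N s s''" using N agree_trans by metis
    then show ?thesis using N * by auto
  qed (use * in auto)
qed

lemma tle_depth: "tle p q \<Longrightarrow> tle q r \<Longrightarrow> tle q p \<or> tle r q"
proof (cases p; cases q; cases r)
  fix s l s' l' s'' l''
  assume *: "p = (s, l)" "q = (s', l')" "r = (s'', l'')" "tle p q" "tle q r"
  show "tle q p \<or> tle r q"
  proof (cases l')
    case True
    then show ?thesis using * by auto
  next
    case False
    then have "tle q p" using * born_agree[of _ s s'] agree_sym[of _ s s'] by auto
    then show ?thesis ..
  qed
qed

lemma td_hi: "W \<subseteq> TX \<Longrightarrow> (s, True) \<in> td W \<longleftrightarrow> (s, True) \<in> W"
  by (auto simp: td_def intro!: bexI[of _ "(s, True)"])

lemma td_lo: "(s, False) \<in> td W \<longleftrightarrow>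
    root s \<and> (\<exists>N s' l. born N s \<and> agree N s s' \<and> (s', l) \<in> W)"
proof
  assume "(s, False) \<in> td W"
  then obtain s' l where q: "(s, False) \<in> TX" "(s', l) \<in> W" "tle (s, False) (s', l)" by (auto simp: td_def)
  then have "\<exists>N. born N s \<and> agree N s s'" by (auto simp: TX_def)
  then show "root s \<and> (\<exists>N s' l. born N s \<and> agree N s s' \<and> (s', l) \<in> W)"
    using q by (auto simp: TX_def)
next
  assume "root s \<and> (\<exists>N s' l. born N s \<and> agree N s s' \<and> (s', l) \<in> W)"
  then obtain N s' l where q: "root s" "born N s" "agree N s s'" "(s', l) \<in> W" by blast
  then have "(s, False) \<in> TX" "tle (s, False) (s', l)" by (auto simp: TX_def)
  then show "(s, False) \<in> td W" using q(4) unfolding td_def by blast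
qed

lemma level_td:
  assumes W: "W \<subseteq> TX" "level n W" and n: "1 \<le> n"
  shows "level n (td W)"
  unfolding level_def td_hi[OF W(1)] td_lo
proof (intro conjI allI impI)
  fix s s' :: "('i, 'j) path" assume "root s" "root s'" "\<forall>k<n. s k = s' k" "(s, True) \<in> W"
  then show "(s', True) \<in> W" using levelD(1)[OF W(2)] by blast
next
  fix N and s s' :: "('i, 'j) path"
  assume *: "N \<le> n" "root s" "root s'" "born N s" "born N s'" "agree_upto n N s s'"
    "root s \<and> (\<exists>N s' l. born N s \<and> agree N s s' \<and> (s', l) \<in> W)"
  then obtain s1 l where s1: "agree N s s1" "(s1, l) \<in> W" using born_unique by blast
  then have r1: "root s1" using W(1) by (auto simp: TX_def)
  show "root s'" by fact
  show "\<exists>N s1 l. born N s' \<and> agree N s' s1 \<and> (s1, l) \<in> W"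
  proof (cases l)
    case False
    have "agree_upto n N s1 s'"
      using agree_upto_trans[OF agree_upto_sym[OF agree_imp_upto[OF s1(1)]] *(6)] .
    then have "(s', False) \<in> W"
      using levelD(2)[OF W(2) *(1) r1 *(3) born_agree[OF *(4) s1(1)] *(5)] s1 False by simp
    then show ?thesis using *(5) agree_refl by blast
  next
    case True
    \<comment> \<open>The path \<open>s1\<close> lies above \<open>s\<close> but perhaps not above
      \<open>s'\<close>. Its splice with \<open>s'\<close> at position \<open>n\<close> does lie
      above \<open>s'\<close>, and it stays in \<open>W\<close>, which sees only the first
      \<open>n\<close> letters of a path.\<close>
    define s2 where "s2 = (\<lambda>k. if k < n then s1 k else s' k)"
    have "root s2" using r1 n by (simp add: root_def s2_def)
    then have "(s2, True) \<in> W"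
      using levelD(1)[OF W(2) r1, of s2] s1 True by (simp add: s2_def)
    moreover have "agree N s' s2"
      using s1(1) *(1,6) by (auto simp: agree_def agree_upto_def s2_def)
    ultimately show ?thesis using *(5) by blast
  qed
next
  fix N and s :: "('i, 'j) path" assume *: "n < N" "root s" "born N s"
  show "(root s \<and> (\<exists>N s' l. born N s \<and> agree N s s' \<and> (s', l) \<in> W)) \<longleftrightarrow> (s, True) \<in> W"
  proof
    assume "root s \<and> (\<exists>N s' l. born N s \<and> agree N s s' \<and> (s', l) \<in> W)"
    then obtain s1 l where s1: "agree N s s1" "(s1, l) \<in> W" using *(3) born_unique by blast
    then have r1: "root s1" using W(1) by (auto simp: TX_def)
    have "(s1, True) \<in> W"
      using levelD(3)[OF W(2) *(1) r1 born_agree[OF *(3) s1(1)]] s1(2) by (cases l) auto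
    then show "(s, True) \<in> W"
      using levelD(1)[OF W(2) *(2) r1] s1(1) *(1) by (auto simp: agree_def)
  qed (use * agree_refl in blast)
qed

lemma TA_common_level:
  assumes "finite F" "F \<subseteq> TA"
  shows "\<exists>n\<ge>1. \<forall>U\<in>F. level n U"
  using assms
proof (induction F)
  case (insert U F)
  then obtain n m where "n \<ge> 1" "\<forall>U\<in>F. level n U" "m \<ge> 1" "level m U" by (auto simp: TA_def)
  then show ?case
    by (intro exI[of _ "max n m"]) (auto intro: level_mono[of n] level_mono[of m])
qed auto

sublocale down_algebra TX tle TA
proof
  show "{} \<in> TA" "TX \<in> TA"
    by (auto simp: TA_def level_def TX_def)
  fix a b assume ab: "a \<in> TA" "b \<in> TA"
  from TA_common_level[of "{a, b}"] ab obtain n where n: "n \<ge> 1" "level n a" "level n b" by auto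
  show "a \<union> b \<in> TA" "a \<inter> b \<in> TA"
    using ab n level_bool[OF n(2,3)] unfolding TA_def by blast+
  have W: "a - b \<subseteq> TX" using ab by (auto simp: TA_def)
  have "level n (td (a - b))" using level_td[OF W level_bool(3)[OF n(2,3)] n(1)] .
  moreover have "p \<in> td (a - b)" if "p \<in> TX" "q \<in> td (a - b)" "tle p q" for p q
    using that tle_trans unfolding td_def by blast
  moreover have "td (a - b) \<subseteq> TX" by (auto simp: td_def)
  ultimately have "td (a - b) \<in> TA" using n(1) unfolding TA_def by blast
  then show "{p \<in> TX. \<exists>q\<in>a - b. tle p q} \<in> TA" by (simp add: td_def)
qed (auto simp: TA_def tle_refl intro: tle_trans dest: tle_depth)

section \<open>D3 and S3 in the path model\<close>

lemma ex_born_cut: "\<exists>N\<le>n. born N (\<lambda>k. if k < n then s k else Some d)"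
proof (induction n)
  case 0
  show ?case by (auto simp: born_def)
next
  case (Suc n)
  show ?case
  proof (cases "s n")
    case None
    then have "born (Suc n) (\<lambda>k. if k < Suc n then s k else Some d)" by (auto simp: born_def)
    then show ?thesis by blast
  next
    case (Some x)
    from Suc obtain N where "N \<le> n" "born N (\<lambda>k. if k < n then s k else Some d)" by blast
    then have "born N (\<lambda>k. if k < Suc n then s k else Some d)"
      using Some by (auto simp: born_def less_Suc_eq simp del: not_None_eq split: if_splits)
    then show ?thesis using \<open>N \<le> n\<close> by (meson le_SucI)
  qed
qed

text \<open>The witness collects the lower points of \<open>a\<close> born by its level
  \<open>n\<close>. The bound gives it a finite level, because points born later would have to be
  accompanied by their paths. Cutting the tail of a path of \<open>a\<close> shows that it is
  non-empty, and regularity puts a path of \<open>a\<close> above each of its points.\<close>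

lemma tree_D3:
  assumes a: "a \<in> TA" "a = td (TX - td (TX - a))" "a \<noteq> {}"
  shows "\<exists>b\<in>TA. b \<noteq> {} \<and> td (a - b) = a \<and> b \<subseteq> a"
proof -
  obtain n where n: "n \<ge> 1" "level n a" using a by (auto simp: TA_def)
  have aX: "a \<subseteq> TX" and ad: "\<And>p q. p \<in> TX \<Longrightarrow> q \<in> a \<Longrightarrow> tle p q \<Longrightarrow> p \<in> a"
    using a(1) by (auto simp: TA_def)
  have above: "\<exists>N s1. born N s \<and> agree N s s1 \<and> (s1, True) \<in> a" if lo: "(s, False) \<in> a" for s
  proof -
    have "(s, False) \<in> td (TX - td (TX - a))" using lo a(2) by simp
    then obtain N s1 l where s1: "born N s" "agree N s s1" "(s1, l) \<in> TX" "(s1, l) \<notin> td (TX - a)"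
      by (subst (asm) td_lo) auto
    have "(s1, True) \<in> TX" using s1(3) by (auto simp: TX_def)
    moreover have "tle (s1, l) (s1, True)" using born_agree[OF s1(1,2)] by auto
    ultimately have "(s1, True) \<in> a" using s1(3,4) unfolding td_def by blast
    then show ?thesis using s1 by blast
  qed
  define b where "b = {(s, l) \<in> a. \<not> l \<and> (\<exists>N\<le>n. born N s)}"
  have "level n b"
    unfolding level_def
  proof (intro conjI allI impI)
    fix N and s s' :: "('i, 'j) path"
    assume *: "N \<le> n" "root s" "root s'" "born N s" "born N s'" "agree_upto n N s s'" "(s, False) \<in> b"
    then show "(s', False) \<in> b" using levelD(2)[OF n(2) *(1-6)] by (auto simp: b_def)
  next
    fix N and s :: "('i, 'j) path" assume *: "n < N" "root s" "born N s"
    have "\<not> (\<exists>N\<le>n. born N s)"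
    proof
      assume "\<exists>N\<le>n. born N s"
      then obtain N' where "N' \<le> n" "born N' s" by blast
      with born_unique[OF *(3)] *(1) show False by fastforce
    qed
    then show "(s, False) \<in> b \<longleftrightarrow> (s, True) \<in> b" by (auto simp: b_def)
  qed (simp add: b_def)
  moreover have "p \<in> b" if p: "p \<in> TX" "q \<in> b" "tle p q" for p q
  proof -
    have "p \<in> a" using ad[OF p(1) _ p(3)] p(2) by (auto simp: b_def)
    moreover have "\<not> snd p \<and> (\<exists>N\<le>n. born N (fst p))"
      using p(2,3) born_agree[of _ "fst p" "fst q"] born_unique[of _ "fst q"]
      by (cases p; cases q) (auto simp: b_def)
    ultimately show ?thesis by (auto simp: b_def)
  qed
  moreover have ba: "b \<subseteq> a" by (auto simp: b_def)
  ultimately have "b \<in> TA" using aX n(1) unfolding TA_def by blast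
  moreover have "b \<noteq> {}"
  proof -
    obtain p where "p \<in> a" using a(3) by blast
    then obtain s where s: "(s, True) \<in> a" using above by (cases p; cases "snd p") fastforce+
    define t where "t = (\<lambda>k. if k < n then s k else Some undefined)"
    obtain N where N: "N \<le> n" "born N t" using ex_born_cut unfolding t_def by blast
    have rs: "root s" "root t" using s aX n(1) by (auto simp: TX_def root_def t_def)
    then have "(t, True) \<in> a" using levelD(1)[OF n(2) rs] s by (simp add: t_def)
    moreover have "(t, False) \<in> TX" using rs N by (auto simp: TX_def)
    moreover have "tle (t, False) (t, True)" using N by auto
    ultimately have "(t, False) \<in> a" using ad by blast
    then show ?thesis using N by (auto simp: b_def)
  qed
  moreover have "td (a - b) = a"
  proof
    show "td (a - b) \<subseteq> a" using ad unfolding td_def by blast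
    show "a \<subseteq> td (a - b)"
    proof
      fix p assume p: "p \<in> a"
      show "p \<in> td (a - b)"
      proof (cases "p \<in> b")
        case False
        then show ?thesis using p aX tle_refl unfolding td_def by blast
      next
        case True
        then obtain s where s: "p = (s, False)" by (auto simp: b_def)
        then obtain N s1 where s1: "born N s" "agree N s s1" "(s1, True) \<in> a" using above p by blast
        then have "tle p (s1, True)" using s by auto
        moreover have "(s1, True) \<notin> b" by (auto simp: b_def)
        ultimately show ?thesis using s1(3) p aX unfolding td_def by blast
      qed
    qed
  qed
  ultimately show ?thesis using ba by blast
qed

text \<open>The condition \<open>I\<close> may read one letter more than \<open>a\<close> does, the
  one at position \<open>n\<close>, so the level rises to \<open>Suc n\<close>. A point born exactly
  at \<open>Suc n\<close> is covered by \<open>late\<close>, which reduces it to the case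
  \<open>hi\<close> of paths.\<close>

lemma restrict_TA:
  assumes a: "a \<in> TA" "level n a" and n: "1 \<le> n"
    and hi: "\<And>s s'. (\<And>k. k < Suc n \<Longrightarrow> s k = s' k) \<Longrightarrow> I s True \<Longrightarrow> I s' True"
    and lo: "\<And>N s s'. N \<le> n \<Longrightarrow> root s \<Longrightarrow> root s' \<Longrightarrow> born N s \<Longrightarrow> born N s' \<Longrightarrow>
      agree_upto (Suc n) N s s' \<Longrightarrow> I s False \<Longrightarrow> I s' False"
    and late: "\<And>N s. n < N \<Longrightarrow> born N s \<Longrightarrow> I s False \<longleftrightarrow> I s True"
    and down: "\<And>N s s'. N \<le> n \<Longrightarrow> root s \<Longrightarrow> root s' \<Longrightarrow> born N s \<Longrightarrow> born N s' \<Longrightarrow>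
      agree N s s' \<Longrightarrow> I s' True \<Longrightarrow> I s False"
  shows "{(s, l) \<in> a. I s l} \<in> TA"
proof -
  let ?V = "{(s, l) \<in> a. I s l}"
  have aX: "a \<subseteq> TX" and ad: "\<And>p q. p \<in> TX \<Longrightarrow> q \<in> a \<Longrightarrow> tle p q \<Longrightarrow> p \<in> a"
    using a(1) by (auto simp: TA_def)
  note la = levelD[OF level_Suc[OF a(2)]]
  have "level (Suc n) ?V"
    unfolding level_def
  proof (intro conjI allI impI)
    fix s s' :: "('i, 'j) path" assume "root s" "root s'" "\<forall>k<Suc n. s k = s' k" "(s, True) \<in> ?V"
    then show "(s', True) \<in> ?V" using la(1)[of s s'] hi[of s s'] by auto
  next
    fix N and s s' :: "('i, 'j) path"
    assume *: "N \<le> Suc n" "root s" "root s'" "born N s" "born N s'" "agree_upto (Suc n) N s s'" "(s, False) \<in> ?V"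
    have "I s' False"
    proof (cases "N \<le> n")
      case True
      then show ?thesis using lo[OF True *(2-6)] *(7) by auto
    next
      case False
      then show ?thesis
        using late[of N s] late[of N s'] hi[of s s'] agree_upto_eq[OF *(6)] * by auto
    qed
    then show "(s', False) \<in> ?V" using la(2)[OF *(1-6)] *(7) by auto
  next
    fix N and s :: "('i, 'j) path" assume "Suc n < N" "root s" "born N s"
    then show "(s, False) \<in> ?V \<longleftrightarrow> (s, True) \<in> ?V" using la(3)[of N s] late[of N s] by auto
  qed
  moreover have "p \<in> ?V" if p: "p \<in> TX" "q \<in> ?V" "tle p q" for p q
  proof -
    have pa: "p \<in> a" using ad[OF p(1) _ p(3)] p(2) by auto
    obtain s l s' l' where pq: "p = (s, l)" "q = (s', l')" by (cases p; cases q)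
    have r: "root s" "root s'" using p aX pq by (auto simp: TX_def)
    have "I s l"
    proof (cases "p = q")
      case False
      then obtain N where N: "\<not> l" "born N s" "agree N s s'" using p(3) pq by auto
      have b': "born N s'" using born_agree[OF N(2,3)] .
      show ?thesis
      proof (cases "N \<le> n")
        case True
        then show ?thesis
          using lo[OF True r(2,1) b' N(2) agree_upto_sym[OF agree_imp_upto[OF N(3)]]]
            down[OF True r N(2) b' N(3)] p(2) pq N(1) by (cases l') auto
      next
        case False
        then have "I s' True" using late[of N s'] b' p(2) pq by (cases l') auto
        moreover have "s' k = s k" if "k < Suc n" for k using N(3) False that by (auto simp: agree_def)
        ultimately show ?thesis using hi[of s' s] late[of N s] False N by auto
      qed
    qed (use p(2) pq in auto)
    then show ?thesis using pa pq by auto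
  qed
  moreover have "?V \<subseteq> TX" using aX by blast
  ultimately show ?thesis unfolding TA_def by (intro CollectI conjI exI[of _ "Suc n"]) auto
qed

lemma tree_S3:
  assumes mem: "a \<in> TA" "b1 \<in> TA" "b2 \<in> TA"
    and ll: "td (a - (b1 \<union> b2)) = a" "b1 \<union> b2 \<subseteq> a" and ne: "a \<noteq> {}"
  shows "\<exists>a1\<in>TA. \<exists>a2\<in>TA. a1 \<noteq> {} \<and> a2 \<noteq> {} \<and> td (a - a2) = a1 \<and> b1 \<subseteq> a1 \<and>
    td (a - a1) = a2 \<and> b2 \<subseteq> a2 \<and> a1 \<inter> a2 = b1 \<inter> b2"
proof -
  from TA_common_level[of "{a, b1, b2}"] mem obtain n where
    n: "1 \<le> n" and la: "level n a" and lb: "level n b1" "level n b2" by auto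
  have aX: "a \<subseteq> TX" and ad: "\<And>p q. p \<in> TX \<Longrightarrow> q \<in> a \<Longrightarrow> tle p q \<Longrightarrow> p \<in> a"
    using mem(1) by (auto simp: TA_def)
  have bd: "p \<in> b1 \<union> b2" if "p \<in> TX" "q \<in> b1 \<union> b2" "tle p q" for p q
    using that mem(2,3) unfolding TA_def by blast
  \<comment> \<open>The closure \<open>td\<close> adds no paths, so removing
    \<open>b1 \<union> b2\<close> from \<open>a\<close> cannot remove any. At level \<open>n\<close>
    points born after \<open>n\<close> behave like paths, which bounds the births inside
    \<open>b1 \<union> b2\<close> by \<open>n\<close>.\<close>
  have b_no_hi: "(s, True) \<notin> b1 \<union> b2" for s
  proof
    assume "(s, True) \<in> b1 \<union> b2"
    then have "(s, True) \<in> td (a - (b1 \<union> b2))" using ll by blast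
    then show False using td_hi[of "a - (b1 \<union> b2)" s] aX \<open>(s, True) \<in> b1 \<union> b2\<close> by auto
  qed
  have b_early: "\<exists>N\<le>n. born N s" if "(s, False) \<in> b1 \<union> b2" for s
  proof -
    have "(s, False) \<in> TX" using that ll(2) aX by blast
    then obtain N where N: "born N s" "root s" by (auto simp: TX_def)
    have "N \<le> n"
    proof (rule ccontr)
      assume "\<not> N \<le> n"
      then have "(s, True) \<in> b1 \<union> b2"
        using levelD(3)[OF lb(1) _ N(2,1)] levelD(3)[OF lb(2) _ N(2,1)] that by auto
      then show False using b_no_hi by blast
    qed
    then show ?thesis using N by blast
  qed
  have b_above: "\<exists>s1. agree N s s1 \<and> (s1, True) \<in> a" if b: "(s, False) \<in> b1 \<union> b2" "born N s" for s N
  proof -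
    have "(s, False) \<in> td (a - (b1 \<union> b2))" using b(1) ll by blast
    then obtain s1 l where s1: "agree N s s1" "(s1, l) \<in> a" "(s1, l) \<notin> b1 \<union> b2"
      unfolding td_lo using born_unique[OF b(2)] by blast
    have "l"
    proof (rule ccontr)
      assume "\<not> l"
      moreover have "tle (s1, False) (s, False)"
        using born_agree[OF b(2) s1(1)] agree_sym[OF s1(1)] by auto
      ultimately have "(s1, l) \<in> b1 \<union> b2"
        using bd[of "(s1, False)" "(s, False)"] b(1) s1(2) aX by auto
      then show False using s1(3) by blast
    qed
    then show ?thesis using s1 by auto
  qed
  text \<open>The letter at position \<open>n\<close> decides to which half a point belongs, depending on whether the
    lower point determined by the first \<open>n\<close> letters lies in \<open>b1\<close> and in \<open>b2\<close>.\<close>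
  define t :: "('i, 'j) path \<Rightarrow> ('i, 'j) path"
    where "t = (\<lambda>s k. if k < n then s k else Some undefined)"
  define \<beta> where "\<beta> = (\<lambda>b s. (t s, False) \<in> b)"
  define early where "early = (\<lambda>s :: ('i, 'j) path. \<exists>N\<le>n. born N s)"
  \<comment> \<open>A lower point born by \<open>n\<close> retains the component read by
    \<open>bi\<close>, in common with all paths above it, and drops the one read by
    \<open>bj\<close>.\<close>
  define bi where "bi = (\<lambda>s :: ('i, 'j) path. snd (fst (the (s n))))"
  define bj where "bj = (\<lambda>s :: ('i, 'j) path. snd (snd (the (s n))))"
  \<comment> \<open>If only one of \<open>b1\<close>, \<open>b2\<close> is prescribed, letters other
    than \<open>None\<close> go to its half and \<open>None\<close> goes to the other half. If
    neither is, \<open>bi\<close> keeps a lower point and the paths above it together. If both are,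
    early lower points go to both halves, while paths and late points are separated by
    \<open>bj\<close>.\<close>
  define I1 where "I1 = (\<lambda>s l. if s n = None then \<not> \<beta> b1 s \<or> \<beta> b2 s
    else if \<beta> b1 s \<and> \<beta> b2 s then \<not> l \<and> early s \<or> bj s
    else if \<beta> b1 s then True else if \<beta> b2 s then False else bi s)"
  define I2 where "I2 = (\<lambda>s l. if s n = None then \<beta> b1 s \<and> \<not> \<beta> b2 s
    else if \<beta> b1 s \<and> \<beta> b2 s then \<not> l \<and> early s \<or> \<not> bj s
    else if \<beta> b1 s then False else if \<beta> b2 s then True else \<not> bi s)"
  have t_cong: "t s = t s'" if "\<And>k. k < n \<Longrightarrow> s k = s' k" for s s'
    using that by (auto simp: t_def)
  have \<beta>_lo: "(s, False) \<in> b \<longleftrightarrow> \<beta> b s" if "N \<le> n" "root s" "born N s" "level n b" for N s b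
  proof -
    have "born N (t s)" using that(1,3) by (auto simp: born_def t_def simp del: not_None_eq)
    moreover have "root (t s)" using that(2) n by (simp add: root_def t_def)
    moreover have "agree_upto n N s (t s)" by (simp add: agree_upto_def t_def)
    ultimately show ?thesis unfolding \<beta>_def using levelD(2)[OF that(4,1,2)] that(3) by blast
  qed
  have \<beta>_cong: "\<beta> b s = \<beta> b s'"
    if "N \<le> n" "root s" "root s'" "born N s" "born N s'" "agree_upto n N s s'" "level n b" for N s s' b
    using levelD(2)[OF that(7,1-6)] \<beta>_lo[OF that(1,2,4,7)] \<beta>_lo[OF that(1,3,5,7)] by simp
  have letter: "s n \<noteq> None" if "N \<le> n" "born N s" for N and s :: "('i, 'j) path"
    using that unfolding born_def by blast
  have bi_cong: "bi s = bi s'" if "N \<le> n" "born N s" "born N s'" "agree_upto (Suc n) N s s'" for N s s'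
  proof -
    have "map_option fst (s n) = map_option fst (s' n)" using that(1,4) by (simp add: agree_upto_def)
    then show ?thesis
      using letter[OF that(1,2)] letter[OF that(1,3)] by (auto simp: bi_def)
  qed
  have not_early: "\<not> early s" if "n < N" "born N s" for N s
    using born_unique[OF that(2)] that(1) unfolding early_def by fastforce
  define a1 where "a1 = {(s, l) \<in> a. I1 s l}"
  define a2 where "a2 = {(s, l) \<in> a. I2 s l}"
  have I_lo: "I1 s' l \<Longrightarrow> I1 s False" "I2 s' l \<Longrightarrow> I2 s False"
    if N: "N \<le> n" "root s" "root s'" "born N s" "born N s'" and ag: "agree_upto (Suc n) N s s'" for N s s' l
  proof -
    have "\<beta> b1 s = \<beta> b1 s'" "\<beta> b2 s = \<beta> b2 s'"
      using \<beta>_cong[OF N agree_upto_mono[OF ag]] lb by auto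
    moreover have "bi s = bi s'" by (rule bi_cong[OF N(1,4,5) ag])
    moreover have "early s" using N unfolding early_def by blast
    ultimately show "I1 s' l \<Longrightarrow> I1 s False" "I2 s' l \<Longrightarrow> I2 s False"
      using letter[OF N(1,4)] letter[OF N(1,5)] unfolding I1_def I2_def by auto
  qed
  have I_hi: "I1 s True \<longleftrightarrow> I1 s' True" "I2 s True \<longleftrightarrow> I2 s' True"
    if "\<And>k. k < Suc n \<Longrightarrow> s k = s' k" for s s'
  proof -
    have "t s = t s'" "s n = s' n" using t_cong[of s s'] that by auto
    then show "I1 s True \<longleftrightarrow> I1 s' True" "I2 s True \<longleftrightarrow> I2 s' True"
      by (simp_all add: I1_def I2_def \<beta>_def bi_def bj_def)
  qed
  have I_late: "I1 s False \<longleftrightarrow> I1 s True" "I2 s False \<longleftrightarrow> I2 s True" if "n < N" "born N s" for N s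
    using not_early[OF that] by (simp_all add: I1_def I2_def)
  have a1: "a1 \<in> TA"
    unfolding a1_def
    by (rule restrict_TA[OF mem(1) la n])
      (use I_hi(1) I_lo(1) I_late(1) agree_upto_sym agree_imp_upto in \<open>metis\<close>)+
  have a2: "a2 \<in> TA"
    unfolding a2_def
    by (rule restrict_TA[OF mem(1) la n])
      (use I_hi(2) I_lo(2) I_late(2) agree_upto_sym agree_imp_upto in \<open>metis\<close>)+
  have I_or: "I1 s l \<or> I2 s l" for s l by (auto simp: I1_def I2_def)
  have I_and: "I1 s l \<and> I2 s l \<longleftrightarrow> \<not> l \<and> early s \<and> \<beta> b1 s \<and> \<beta> b2 s" for s l
    using letter by (auto simp: I1_def I2_def early_def simp del: not_None_eq)
  have inb: "(s, False) \<in> b \<longleftrightarrow> \<beta> b s" if "early s" "(s, False) \<in> a" "level n b" for s b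
    using \<beta>_lo[of _ s b] that aX unfolding early_def TX_def by blast
  have int: "a1 \<inter> a2 = b1 \<inter> b2"
  proof (intro set_eqI)
    fix p show "p \<in> a1 \<inter> a2 \<longleftrightarrow> p \<in> b1 \<inter> b2"
    proof (cases p)
      case (Pair s l)
      have "p \<in> a1 \<inter> a2 \<longleftrightarrow> (s, l) \<in> a \<and> \<not> l \<and> early s \<and> \<beta> b1 s \<and> \<beta> b2 s"
        using I_and[of s l] by (auto simp: a1_def a2_def Pair)
      also have "\<dots> \<longleftrightarrow> p \<in> b1 \<inter> b2"
      proof (cases l)
        case True
        then show ?thesis using b_no_hi[of s] Pair by simp
      next
        case False
        show ?thesis
        proof (cases "early s \<and> (s, False) \<in> a")
          case True
          then show ?thesis using inb[of s b1] inb[of s b2] lb False Pair by simp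
        next
          case not: False
          then have "(s, False) \<notin> b1 \<inter> b2" using b_early[of s] ll(2) unfolding early_def by blast
          then show ?thesis using not False Pair by auto
        qed
      qed
      finally show ?thesis .
    qed
  qed
  have sub: "b1 \<subseteq> a1" "b2 \<subseteq> a2"
  proof -
    have "I1 s l" if "(s, l) \<in> b1" for s l
    proof -
      have l: "\<not> l" "early s" using that b_no_hi[of s] b_early[of s] by (cases l; auto simp: early_def)+
      then have "\<beta> b1 s" using inb[of s b1] that ll(2) lb by auto
      then show ?thesis using l letter by (auto simp: I1_def early_def simp del: not_None_eq)
    qed
    then show "b1 \<subseteq> a1" using ll(2) by (auto simp: a1_def)
    have "I2 s l" if "(s, l) \<in> b2" for s l
    proof -
      have l: "\<not> l" "early s" using that b_no_hi[of s] b_early[of s] by (cases l; auto simp: early_def)+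
      then have "\<beta> b2 s" using inb[of s b2] that ll(2) lb by auto
      then show ?thesis using l letter by (auto simp: I2_def early_def simp del: not_None_eq)
    qed
    then show "b2 \<subseteq> a2" using ll(2) by (auto simp: a2_def)
  qed
  have modify: "(s(n := x), True) \<in> a" if "(s, True) \<in> a" for s x
  proof -
    have "root s" "root (s(n := x))" using that aX n by (auto simp: TX_def root_def)
    then show ?thesis using levelD(1)[OF la, of s "s(n := x)"] that by auto
  qed
  have \<beta>_mod: "\<beta> b (s(n := x)) = \<beta> b s" for b s x
    using t_cong[of "s(n := x)" s] by (simp add: \<beta>_def)
  have both: "\<exists>s1 s2. (s1, True) \<in> a \<and> (s2, True) \<in> a \<and> tle (s, l) (s1, True) \<and> tle (s, l) (s2, True) \<and>
      \<not> I2 s1 True \<and> \<not> I1 s2 True" if p: "(s, l) \<in> b1 \<inter> b2" for s l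
  proof -
    have l: "\<not> l" "early s" using p b_no_hi[of s] b_early[of s] by (cases l; auto simp: early_def)+
    then obtain N where N: "N \<le> n" "born N s" by (auto simp: early_def)
    obtain s1 where s1: "agree N s s1" "(s1, True) \<in> a" using b_above[OF _ N(2)] p l by auto
    have r: "root s" "root s1" using p ll(2) s1(2) aX by (auto simp: TX_def)
    have b1: "born N s1" using born_agree[OF N(2) s1(1)] .
    have "\<beta> b1 s" "\<beta> b2 s" using inb[OF l(2)] p l ll(2) lb by auto
    then have \<beta>: "\<beta> b1 s1" "\<beta> b2 s1"
      using \<beta>_cong[OF N(1) r N(2) b1 agree_imp_upto[OF s1(1)]] lb by auto
    \<comment> \<open>Only the dropped component at position \<open>n\<close> is changed. So the
      path stays above the lower point, and the bit \<open>v\<close> moves it to either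
      half.\<close>
    define u where "u = (\<lambda>v. s1(n := Some (fst (the (s1 n)), (undefined, v))))"
    have "agree N s (u v)" for v
      using s1(1) N(1) letter[OF N(1) b1] unfolding agree_def u_def by auto
    then have "tle (s, l) (u v, True)" for v using N l by auto
    moreover have "(u v, True) \<in> a" for v unfolding u_def by (rule modify[OF s1(2)])
    moreover have "\<not> I2 (u True) True" "\<not> I1 (u False) True"
      using \<beta> by (auto simp: I1_def I2_def u_def \<beta>_mod bj_def)
    ultimately show ?thesis by blast
  qed
  have td1: "td (a - a2) = a1"
  proof
    show "td (a - a2) \<subseteq> a1"
    proof -
      have "a - a2 \<subseteq> a1" using I_or by (auto simp: a1_def a2_def)
      then show ?thesis using a1 unfolding td_def TA_def by blast
    qed
    show "a1 \<subseteq> td (a - a2)"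
    proof
      fix p assume p: "p \<in> a1"
      then have pa: "p \<in> a" "p \<in> TX" using aX by (auto simp: a1_def)
      show "p \<in> td (a - a2)"
      proof (cases "p \<in> a2")
        case False
        then show ?thesis using pa tle_refl unfolding td_def by blast
      next
        case True
        then have "p \<in> b1 \<inter> b2" using p int by blast
        then obtain s1 where "(s1, True) \<in> a" "tle p (s1, True)" "\<not> I2 s1 True"
          using both by (cases p) blast
        then show ?thesis using pa unfolding td_def a2_def by blast
      qed
    qed
  qed
  have td2: "td (a - a1) = a2"
  proof
    show "td (a - a1) \<subseteq> a2"
    proof -
      have "a - a1 \<subseteq> a2" using I_or by (auto simp: a1_def a2_def)
      then show ?thesis using a2 unfolding td_def TA_def by blast
    qed
    show "a2 \<subseteq> td (a - a1)"
    proof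
      fix p assume p: "p \<in> a2"
      then have pa: "p \<in> a" "p \<in> TX" using aX by (auto simp: a2_def)
      show "p \<in> td (a - a1)"
      proof (cases "p \<in> a1")
        case False
        then show ?thesis using pa tle_refl unfolding td_def by blast
      next
        case True
        then have "p \<in> b1 \<inter> b2" using p int by blast
        then obtain s1 where "(s1, True) \<in> a" "tle p (s1, True)" "\<not> I1 s1 True"
          using both by (cases p) blast
        then show ?thesis using pa unfolding td_def a1_def by blast
      qed
    qed
  qed
  have nonempty: "a1 \<noteq> {} \<and> a2 \<noteq> {}"
  proof (cases "\<exists>s. (s, True) \<in> a")
    case True
    then obtain s where s: "(s, True) \<in> a" by blast
    \<comment> \<open>Both bits carry the same value, so one letter serves the case decided by
      \<open>bi\<close> as well as the one decided by \<open>bj\<close>.\<close>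
    define x :: "bool \<Rightarrow> (('i \<times> bool) \<times> ('j \<times> bool)) option"
      where "x = (\<lambda>v. Some ((undefined, v), (undefined, v)))"
    have "\<exists>y. I1 (s(n := y)) True"
      by (rule exI[of _ "if \<not> \<beta> b1 s \<or> \<beta> b2 s then None else x True"])
        (auto simp: I1_def \<beta>_mod x_def)
    moreover have "\<exists>y. I2 (s(n := y)) True"
      by (rule exI[of _ "if \<beta> b1 s \<and> \<not> \<beta> b2 s then None else x False"])
        (auto simp: I2_def \<beta>_mod x_def bi_def bj_def)
    ultimately show ?thesis using modify[OF s] unfolding a1_def a2_def by blast
  next
    case False
    \<comment> \<open>Without paths, \<open>a\<close> consists of lower points born by
      \<open>n\<close>. One outside \<open>b1 \<union> b2\<close> has no prescribed half, so
      changing its remembered bit at position \<open>n\<close> gives points of both halves.\<close>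
    have "a - (b1 \<union> b2) \<noteq> {}" using ll(1) ne by (auto simp: td_def)
    then obtain s l where sl: "(s, l) \<in> a" "(s, l) \<notin> b1 \<union> b2" by auto
    have "\<not> l" using False sl(1) by (cases l) auto
    then have s: "(s, False) \<in> a" "(s, False) \<notin> b1 \<union> b2" using sl by simp_all
    obtain N where N: "born N s" "root s" using s(1) aX by (auto simp: TX_def)
    have "N \<le> n" using levelD(3)[OF la _ N(2,1)] s(1) False by force
    then have \<beta>: "\<not> \<beta> b1 s" "\<not> \<beta> b2 s" using \<beta>_lo[OF _ N(2,1)] s(2) lb by blast+
    define u where "u = (\<lambda>v. s(n := Some ((undefined, v), undefined)))"
    have "(u v, False) \<in> a" for v
    proof -
      have "born N (u v)" using N(1) \<open>N \<le> n\<close> by (auto simp: born_def u_def simp del: not_None_eq)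
      moreover have "root (u v)" using N(2) n by (simp add: root_def u_def)
      moreover have "agree_upto n N s (u v)" by (simp add: agree_upto_def u_def)
      ultimately show ?thesis using levelD(2)[OF la \<open>N \<le> n\<close> N(2) _ N(1)] s(1) by blast
    qed
    moreover have "I1 (u True) False" "I2 (u False) False"
      using \<beta> by (auto simp: I1_def I2_def u_def \<beta>_mod bi_def)
    ultimately show ?thesis unfolding a1_def a2_def by blast
  qed
  show ?thesis using a1 a2 nonempty td1 td2 sub int by blast
qed

lemma tree_model_T3: "is_model (set_str TX tle TA) T3"
proof -
  have d: "diffS (set_str TX tle TA) a b = td (a - b)" for a b by (simp add: td_def)
  show ?thesis
    unfolding is_model_T3_iff
  proof (intro conjI ballI impI)
    show "is_model (set_str TX tle TA) V3_theory" by (rule model_V3)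
  next
    fix a assume "a \<in> carrier (set_str TX tle TA)"
      "a = diffS (set_str TX tle TA) (oneS (set_str TX tle TA))
        (diffS (set_str TX tle TA) (oneS (set_str TX tle TA)) a) \<and> a \<noteq> zeroS (set_str TX tle TA)"
    then have "a \<in> TA" "a = td (TX - td (TX - a))" "a \<noteq> {}"
      unfolding d unfolding set_str_simps by blast+
    from tree_D3[OF this]
    show "\<exists>b\<in>carrier (set_str TX tle TA). b \<noteq> zeroS (set_str TX tle TA) \<and> llS (set_str TX tle TA) b a"
      unfolding llS_def d unfolding set_str_simps leS_set_str .
  next
    fix a b1 b2 assume "a \<in> carrier (set_str TX tle TA)" "b1 \<in> carrier (set_str TX tle TA)"
      "b2 \<in> carrier (set_str TX tle TA)"
      "llS (set_str TX tle TA) (joinS (set_str TX tle TA) b1 b2) a \<and> a \<noteq> zeroS (set_str TX tle TA)"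
    then have "a \<in> TA" "b1 \<in> TA" "b2 \<in> TA" "td (a - (b1 \<union> b2)) = a" "b1 \<union> b2 \<subseteq> a" "a \<noteq> {}"
      unfolding llS_def d unfolding set_str_simps leS_set_str by blast+
    from tree_S3[OF this]
    show "\<exists>a1\<in>carrier (set_str TX tle TA). \<exists>a2\<in>carrier (set_str TX tle TA).
        a1 \<noteq> zeroS (set_str TX tle TA) \<and> a2 \<noteq> zeroS (set_str TX tle TA) \<and>
        diffS (set_str TX tle TA) a a2 = a1 \<and> leS (set_str TX tle TA) b1 a1 \<and>
        diffS (set_str TX tle TA) a a1 = a2 \<and> leS (set_str TX tle TA) b2 a2 \<and>
        meetS (set_str TX tle TA) a1 a2 = meetS (set_str TX tle TA) b1 b2"
      unfolding d unfolding set_str_simps leS_set_str .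
  qed
qed

end

section \<open>The given poset as an image of the path space\<close>

context poset_algebra
begin

definition roots :: "(('a \<times> bool) \<times> ('a \<times> bool)) set" where
  "roots = {(i, j). fst i \<in> X \<and> fst j \<in> mx \<and> le (fst i) (fst j)}"

text \<open>The first letter of a path codes a pair of a point of \<open>X\<close> and a maximal point above it; the
  non-maximal points born at \<open>0\<close> project to the former, all others to the latter.\<close>

fun point :: "('a, 'a) path \<times> bool \<Rightarrow> 'a" where
  "point (s, l) = (if \<not> l \<and> born 0 s then fst (fst (the (s 0))) else fst (snd (the (s 0))))"

interpretation T: tree_model roots .

definition emb :: "'a set \<Rightarrow> (('a, 'a) path \<times> bool) set" where
  "emb U = {p \<in> T.TX. point p \<in> U}"

lemma rootE:
  assumes "T.root s"
  obtains x b c d where "s 0 = Some ((x, b), (c, d))" "x \<in> X" "c \<in> mx" "c \<in> X" "le x c"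
proof -
  from assms obtain i j where "s 0 = Some (i, j)" "(i, j) \<in> roots" unfolding T.root_def by auto
  then show ?thesis
    using that[of "fst i" "snd i" "fst j" "snd j"] mx_sub by (auto simp: roots_def)
qed

lemma point_X: "p \<in> T.TX \<Longrightarrow> point p \<in> X"
  by (cases p) (auto simp: T.TX_def elim!: rootE)

lemma point_mono:
  assumes "p \<in> T.TX" "q \<in> T.TX" "tle p q"
  shows "le (point p) (point q)"
proof (cases "p = q")
  case True
  then show ?thesis using le_refl point_X assms by simp
next
  case False
  obtain s l s' l' where pq: "p = (s, l)" "q = (s', l')" by (cases p; cases q)
  then obtain N where N: "\<not> l" "born N s" "agree N s s'" using assms(3) False by auto
  have r: "T.root s" "T.root s'" using assms pq by (auto simp: T.TX_def)
  show ?thesis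
  proof (cases "N = 0")
    case True
    then have b: "born 0 s" "born 0 s'" using N born_agree by blast+
    have "map_option fst (s 0) = map_option fst (s' 0)" using N(3) True by (simp add: agree_def)
    then show ?thesis
      using r b N(1) le_refl unfolding pq by (elim rootE) auto
  next
    case False
    then have "\<not> born 0 s" "\<not> born 0 s'" using N born_agree born_unique by blast+
    moreover have "s 0 = s' 0" using N(3) False by (simp add: agree_def)
    ultimately show ?thesis
      using le_refl point_X[OF assms(1)] unfolding pq by simp
  qed
qed

text \<open>This is the back condition of a bounded morphism. If \<open>q\<close> is strictly above
  the image, then \<open>p\<close> is a lower point born at \<open>0\<close>. Such a point forgets
  the maximal point named in the first letter, so a path above it may name \<open>q\<close>
  instead.\<close>

lemma point_lift:
  assumes "p \<in> T.TX" "q \<in> X" "le (point p) q"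
  shows "\<exists>r\<in>T.TX. tle p r \<and> point r = q"
proof (cases "point p = q")
  case True
  then show ?thesis using assms(1) T.tle_refl by blast
next
  case False
  obtain s l where p: "p = (s, l)" by (cases p)
  have r: "T.root s" using assms p by (auto simp: T.TX_def)
  then obtain x b c d where s0: "s 0 = Some ((x, b), (c, d))" "x \<in> X" "c \<in> mx" by (rule rootE)
  have q: "q \<in> mx" using above_lo[OF point_X[OF assms(1)] assms(2,3) False] .
  have lo: "\<not> l \<and> born 0 s"
  proof (rule ccontr)
    assume "\<not> (\<not> l \<and> born 0 s)"
    then have "point p = c" using s0 p by auto
    then show False using mxD[OF s0(3) assms(2)] assms(3) False by simp
  qed
  then have x: "point p = x" using s0 p by simp
  define s' where "s' = s(0 := Some ((x, b), (q, d)))"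
  have "agree 0 s s'" using s0 by (auto simp: agree_def s'_def)
  then have "tle p (s', True)" using lo p by auto
  moreover have "((x, b), (q, d)) \<in> roots" using s0 assms(3) q x by (simp add: roots_def)
  then have "(s', True) \<in> T.TX" by (simp add: T.TX_def T.root_def s'_def)
  moreover have "point (s', True) = q" by (simp add: s'_def)
  ultimately show ?thesis by blast
qed

lemma point_surj:
  assumes "x \<in> X"
  shows "\<exists>p\<in>T.TX. point p = x"
proof -
  obtain c where c: "c \<in> mx" "le x c" using ex_mx[OF assms] by blast
  define s :: "('a, 'a) path" where "s = (\<lambda>_. Some ((x, False), (c, False)))"
  have "((x, False), (c, False)) \<in> roots" using assms c by (simp add: roots_def)
  then have "born 0 s" "T.root s" by (simp_all add: born_def s_def T.root_def)
  then have "(s, False) \<in> T.TX" "point (s, False) = x" by (auto simp: T.TX_def s_def)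
  then show ?thesis by blast
qed

lemma emb_TA:
  assumes "U \<in> A"
  shows "emb U \<in> T.TA"
proof -
  have "T.level 1 (emb U)"
    unfolding T.level_def
  proof (intro conjI allI impI)
    fix s s' :: "('a, 'a) path"
    assume "T.root s" "T.root s'" "\<forall>k<1. s k = s' k" "(s, True) \<in> emb U"
    then show "(s', True) \<in> emb U" by (auto simp: emb_def T.TX_def)
  next
    fix N and s s' :: "('a, 'a) path"
    assume *: "N \<le> 1" "T.root s" "T.root s'" "born N s" "born N s'" "agree_upto 1 N s s'" "(s, False) \<in> emb U"
    have "point (s', False) = point (s, False)"
    proof (cases "N = 0")
      case True
      then have "map_option fst (s 0) = map_option fst (s' 0)" using *(6) by (simp add: agree_upto_def)
      then show ?thesis using *(2-5) True by (elim rootE) auto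
    next
      case False
      then have "\<not> born 0 s" "\<not> born 0 s'" using *(4,5) born_unique by blast+
      moreover have "s 0 = s' 0" using *(6) False by (simp add: agree_upto_def)
      ultimately show ?thesis by simp
    qed
    then show "(s', False) \<in> emb U" using * by (auto simp: emb_def T.TX_def)
  next
    fix N and s :: "('a, 'a) path" assume *: "1 < N" "T.root s" "born N s"
    then have "\<not> born 0 s" using born_unique[of N s 0] by auto
    then show "(s, False) \<in> emb U \<longleftrightarrow> (s, True) \<in> emb U" using * by (auto simp: emb_def T.TX_def)
  qed
  moreover have "p \<in> emb U" if "p \<in> T.TX" "q \<in> emb U" "tle p q" for p q
  proof -
    have "q \<in> T.TX" "point q \<in> U" using that(2) by (auto simp: emb_def)
    then show ?thesis
      using A_down[OF assms _ point_X[OF that(1)] point_mono[OF that(1) _ that(3)]] that(1)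
      by (simp add: emb_def)
  qed
  moreover have "emb U \<subseteq> T.TX" by (auto simp: emb_def)
  ultimately show ?thesis unfolding T.TA_def by blast
qed

text \<open>Taking preimages under a surjective bounded morphism is an embedding: surjectivity gives
  injectivity, and the forth and back conditions \<open>point_mono\<close> and
  \<open>point_lift\<close> give the two inclusions for differences.\<close>

lemma emb_embedding: "is_embedding emb (set_str X le A) (set_str T.TX tle T.TA)"
proof -
  have "U = V" if "U \<in> A" "V \<in> A" "emb U = emb V" for U V
  proof -
    have "\<And>p. p \<in> T.TX \<Longrightarrow> point p \<in> U \<longleftrightarrow> point p \<in> V" using that(3) by (auto simp: emb_def)
    then have "\<And>x. x \<in> X \<Longrightarrow> x \<in> U \<longleftrightarrow> x \<in> V" using point_surj by metis
    then show ?thesis using A_sub that(1,2) by blast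
  qed
  then have "inj_on emb A" by (rule inj_onI)
  moreover have "emb {p \<in> X. \<exists>q\<in>U - V. le p q} = {p \<in> T.TX. \<exists>q\<in>emb U - emb V. tle p q}"
    if UV: "U \<in> A" "V \<in> A" for U V
  proof (intro set_eqI iffI)
    fix p assume p: "p \<in> emb {p \<in> X. \<exists>q\<in>U - V. le p q}"
    then obtain q where q: "p \<in> T.TX" "q \<in> U" "q \<notin> V" "le (point p) q" by (auto simp: emb_def)
    then obtain r where "r \<in> T.TX" "tle p r" "point r = q" using point_lift A_sub[OF UV(1)] by blast
    then show "p \<in> {p \<in> T.TX. \<exists>q\<in>emb U - emb V. tle p q}" using q by (auto simp: emb_def)
  next
    fix p assume "p \<in> {p \<in> T.TX. \<exists>q\<in>emb U - emb V. tle p q}"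
    then obtain q where q: "p \<in> T.TX" "q \<in> T.TX" "point q \<in> U" "point q \<notin> V" "tle p q"
      by (auto simp: emb_def)
    then show "p \<in> emb {p \<in> X. \<exists>q\<in>U - V. le p q}"
      using point_mono[OF q(1,2,5)] point_X by (auto simp: emb_def)
  qed
  moreover have "emb X = T.TX" using point_X by (auto simp: emb_def)
  moreover have "emb {} = {}" by (simp add: emb_def)
  moreover have "emb (U \<union> V) = emb U \<union> emb V" "emb (U \<inter> V) = emb U \<inter> emb V" for U V
    by (auto simp: emb_def)
  ultimately show ?thesis
    unfolding is_embedding_def set_str_simps by (auto intro: emb_TA)
qed

end

section \<open>Downward Loewenheim-Skolem\<close>

text \<open>Closing under countably many operations in countably many rounds does not raise the
  cardinality above that of the infinite type \<open>'u\<close>. Arity three suffices for S3;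
  operations of smaller arity ignore arguments.\<close>

lemma ex_small_closure:
  includes cardinal_syntax
  fixes f :: "nat \<Rightarrow> 's \<Rightarrow> 's \<Rightarrow> 's \<Rightarrow> 's" and h0 :: "'s \<Rightarrow> 'u"
  assumes inf: "infinite (UNIV :: 'u set)" and B: "inj_on h0 B" "B \<subseteq> Z"
    and Z: "\<And>n x y z. x \<in> Z \<Longrightarrow> y \<in> Z \<Longrightarrow> z \<in> Z \<Longrightarrow> f n x y z \<in> Z"
  obtains C and h :: "'s \<Rightarrow> 'u" where "B \<subseteq> C" "C \<subseteq> Z" "inj_on h C"
    "\<forall>n. \<forall>x\<in>C. \<forall>y\<in>C. \<forall>z\<in>C. f n x y z \<in> C"
proof -
  define H where "H = (\<lambda>B. B \<union> (\<lambda>(n, x, y, z). f n x y z) ` (UNIV \<times> B \<times> B \<times> B))"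
  define C where "C = (\<Union>n. (H ^^ n) B)"
  have HZ: "H D \<subseteq> Z" if "D \<subseteq> Z" for D
  proof -
    have "f n x y z \<in> Z" if "x \<in> D" "y \<in> D" "z \<in> D" for n x y z
      using Z \<open>D \<subseteq> Z\<close> that by blast
    then show ?thesis using that by (auto simp: H_def)
  qed
  have B_le: "|B| \<le>o |UNIV :: 'u set|"
    using B(1) card_of_ordLeq[of B "UNIV :: 'u set"] by blast
  have nat: "|UNIV :: nat set| \<le>o |UNIV :: 'u set|"
    using inf by (simp add: infinite_iff_card_of_nat)
  have "|H D| \<le>o |UNIV :: 'u set|" if D: "|D| \<le>o |UNIV :: 'u set|" for D
  proof -
    have "|(UNIV :: nat set) \<times> D \<times> D \<times> D| \<le>o |UNIV :: 'u set|"
      using inf by (intro card_of_Times_ordLeq_infinite_Field nat D card_of_Card_order)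
        (simp_all add: Field_card_of)
    then have "|(\<lambda>(n, x, y, z). f n x y z) ` (UNIV \<times> D \<times> D \<times> D)| \<le>o |UNIV :: 'u set|"
      by (rule ordLeq_transitive[OF card_of_image])
    then show ?thesis unfolding H_def using D inf
      by (intro card_of_Un_ordLeq_infinite_Field card_of_Card_order) (simp_all add: Field_card_of)
  qed
  then have "|(H ^^ n) B| \<le>o |UNIV :: 'u set|" for n
    by (induction n) (auto simp: B_le)
  then have "|C| \<le>o |UNIV :: 'u set|"
    unfolding C_def by (intro card_of_UNION_ordLeq_infinite inf nat) auto
  then obtain h :: "'s \<Rightarrow> 'u" where h: "inj_on h C" unfolding card_of_ordLeq[symmetric] by blast
  have "(H ^^ n) B \<subseteq> Z" for n
    by (induction n) (simp_all add: B(2) HZ)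
  then have CZ: "C \<subseteq> Z" by (auto simp: C_def)
  have BC: "B \<subseteq> C" unfolding C_def using funpow_0[of H B] by (metis UN_upper UNIV_I)
  have cl: "f n x y z \<in> C" if "x \<in> C" "y \<in> C" "z \<in> C" for n x y z
  proof -
    have mono: "(H ^^ i) B \<subseteq> (H ^^ k) B" if "i \<le> k" for i k
      using that by (induction rule: dec_induct) (auto simp: H_def)
    from \<open>x \<in> C\<close> \<open>y \<in> C\<close> \<open>z \<in> C\<close> obtain i j k where
      "x \<in> (H ^^ i) B" "y \<in> (H ^^ j) B" "z \<in> (H ^^ k) B" by (auto simp: C_def)
    then have "x \<in> (H ^^ (i + j + k)) B" "y \<in> (H ^^ (i + j + k)) B" "z \<in> (H ^^ (i + j + k)) B"
      using mono[of i "i + j + k"] mono[of j "i + j + k"] mono[of k "i + j + k"] by auto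
    then have "f n x y z \<in> (H ^^ Suc (i + j + k)) B" by (force simp: H_def)
    then show ?thesis unfolding C_def by blast
  qed
  show ?thesis by (rule that[OF BC CZ h]) (use cl in blast)
qed

text \<open>The axioms of the variety are universal and pass to subalgebras. The matrices of D3 and
  S3 are evaluated as in \<open>N\<close>, so it is enough that \<open>C\<close> contains the
  witnesses.\<close>

lemma T3_submodel:
  assumes N: "is_model N T3" and C: "C \<subseteq> carrier N" "zeroS N \<in> C" "oneS N \<in> C"
    and cl: "\<And>x y. x \<in> C \<Longrightarrow> y \<in> C \<Longrightarrow> joinS N x y \<in> C \<and> meetS N x y \<in> C \<and> diffS N x y \<in> C"
    and D3: "\<And>a. a \<in> C \<Longrightarrow> a = diffS N (oneS N) (diffS N (oneS N) a) \<Longrightarrow> a \<noteq> zeroS N \<Longrightarrow>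
      \<exists>b\<in>C. b \<noteq> zeroS N \<and> llS N b a"
    and S3: "\<And>a b1 b2. a \<in> C \<Longrightarrow> b1 \<in> C \<Longrightarrow> b2 \<in> C \<Longrightarrow> llS N (joinS N b1 b2) a \<Longrightarrow> a \<noteq> zeroS N \<Longrightarrow>
      \<exists>a1\<in>C. \<exists>a2\<in>C. a1 \<noteq> zeroS N \<and> a2 \<noteq> zeroS N \<and> diffS N a a2 = a1 \<and> leS N b1 a1 \<and>
        diffS N a a1 = a2 \<and> leS N b2 a2 \<and> meetS N a1 a2 = meetS N b1 b2"
  shows "is_model (N\<lparr>carrier := C\<rparr>) T3"
proof -
  let ?N = "N\<lparr>carrier := C\<rparr>"
  have le: "leS ?N = leS N" and ll: "llS ?N = llS N"
    by (auto simp: leS_def llS_def fun_eq_iff)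
  have V: "is_model N V3_theory" using N unfolding is_model_T3_iff by blast
  have sel: "carrier ?N = C" "zeroS ?N = zeroS N" "oneS ?N = oneS N" "joinS ?N = joinS N"
    "meetS ?N = meetS N" "diffS ?N = diffS N" by simp_all
  have st: "is_structure ?N" using C cl by (simp add: is_structure_def)
  note h = V[unfolded is_model_V3_iff is_model_coHeyting_iff, THEN conjunct1, THEN conjunct2]
  have "is_model ?N coHeyting_theory"
    unfolding is_model_coHeyting_iff le sel
    by (rule conjI[OF st], rule ballI, rule ballI, rule ballI, rule bspec[OF bspec[OF bspec[OF h]]])
      (use C(1) in blast)+
  then have "is_model ?N V3_theory"
    using V C(1) unfolding is_model_V3_iff by (simp add: subset_iff)
  then show ?thesis
    unfolding is_model_T3_iff ll le using D3 S3 by simp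
qed

lemma loewenheim_skolem:
  fixes M :: "'u coh_structure" and N :: "'s coh_structure"
  assumes inf: "infinite (UNIV :: 'u set)" and N: "is_model N T3"
    and M: "is_structure M" and g: "is_embedding g M N"
  shows "\<exists>(N' :: 'u coh_structure) f. is_model N' T3 \<and> is_embedding f M N'"
proof -
  have Ns: "is_structure N" using N by (simp add: is_model_def)
  \<comment> \<open>Skolem functions for D3 and S3. The default \<open>zeroS N\<close> keeps them
    inside the carrier where no witness exists.\<close>
  define d where "d = (\<lambda>a. if \<exists>b\<in>carrier N. b \<noteq> zeroS N \<and> llS N b a
    then SOME b. b \<in> carrier N \<and> b \<noteq> zeroS N \<and> llS N b a else zeroS N)"
  define P where "P = (\<lambda>a b1 b2 (a1, a2). a1 \<in> carrier N \<and> a2 \<in> carrier N \<and> a1 \<noteq> zeroS N \<and> a2 \<noteq> zeroS N \<and>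
    diffS N a a2 = a1 \<and> leS N b1 a1 \<and> diffS N a a1 = a2 \<and> leS N b2 a2 \<and> meetS N a1 a2 = meetS N b1 b2)"
  define s where "s = (\<lambda>a b1 b2. if \<exists>p. P a b1 b2 p then SOME p. P a b1 b2 p else (zeroS N, zeroS N))"
  \<comment> \<open>Three algebra operations, the Skolem function of D3 and the two components of
    that of S3. All indices from \<open>5\<close> on repeat the last one.\<close>
  define f :: "nat \<Rightarrow> 's \<Rightarrow> 's \<Rightarrow> 's \<Rightarrow> 's" where "f = (\<lambda>n x y z.
    if n = 0 then joinS N x y else if n = 1 then meetS N x y else if n = 2 then diffS N x y
    else if n = 3 then d x else if n = 4 then fst (s x y z) else snd (s x y z))"
  have z: "zeroS N \<in> carrier N" "oneS N \<in> carrier N" using Ns by (simp_all add: is_structure_def)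
  have dP: "d a \<in> carrier N \<and> d a \<noteq> zeroS N \<and> llS N (d a) a"
    if "\<exists>b\<in>carrier N. b \<noteq> zeroS N \<and> llS N b a" for a
    using someI_ex[of "\<lambda>b. b \<in> carrier N \<and> b \<noteq> zeroS N \<and> llS N b a"] that unfolding d_def by auto
  have sP: "P a b1 b2 (s a b1 b2)" if "\<exists>p. P a b1 b2 p" for a b1 b2
    using someI_ex[OF that] that unfolding s_def by simp
  have dc: "d a \<in> carrier N" for a using dP[of a] z by (cases "\<exists>b\<in>carrier N. b \<noteq> zeroS N \<and> llS N b a") (auto simp: d_def)
  have sc: "fst (s a b1 b2) \<in> carrier N \<and> snd (s a b1 b2) \<in> carrier N" for a b1 b2
  proof (cases "\<exists>p. P a b1 b2 p")
    case True
    show ?thesis using sP[OF True] by (cases "s a b1 b2") (simp add: P_def)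
  qed (simp add: s_def z)
  have fN: "f n x y w \<in> carrier N" if "x \<in> carrier N" "y \<in> carrier N" "w \<in> carrier N" for n x y w
    using Ns that dc sc by (simp add: f_def is_structure_def)
  have gM: "g ` carrier M \<subseteq> carrier N" using g by (simp add: is_embedding_def)
  have "inj_on (inv_into (carrier M) g) (g ` carrier M)"
    by (rule inj_on_inv_into) simp
  then obtain C and h :: "'s \<Rightarrow> 'u" where
    C: "g ` carrier M \<subseteq> C" "C \<subseteq> carrier N" and h: "inj_on h C"
    and "\<forall>n. \<forall>x\<in>C. \<forall>y\<in>C. \<forall>w\<in>C. f n x y w \<in> C"
    by (rule ex_small_closure[where f = f, OF inf _ gM fN])
  then have Cf: "f n x y w \<in> C" if "x \<in> C" "y \<in> C" "w \<in> C" for n x y w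
    using that by blast
  have zC: "zeroS N \<in> C" "oneS N \<in> C"
    using C(1) g M unfolding is_embedding_def is_structure_def by (metis image_subset_iff)+
  let ?C = "N\<lparr>carrier := C\<rparr>"
  have model: "is_model ?C T3"
  proof (rule T3_submodel[OF N C(2) zC])
    show "joinS N x y \<in> C \<and> meetS N x y \<in> C \<and> diffS N x y \<in> C" if "x \<in> C" "y \<in> C" for x y
      using Cf[of x y x 0] Cf[of x y x 1] Cf[of x y x 2] that by (simp add: f_def)
    show "\<exists>b\<in>C. b \<noteq> zeroS N \<and> llS N b a"
      if "a \<in> C" "a = diffS N (oneS N) (diffS N (oneS N) a)" "a \<noteq> zeroS N" for a
    proof -
      have "a \<in> carrier N" using that(1) C(2) by blast
      then have "\<exists>b\<in>carrier N. b \<noteq> zeroS N \<and> llS N b a"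
        by (rule N[unfolded is_model_T3_iff, THEN conjunct2, THEN conjunct1, rule_format, OF _ conjI[OF that(2,3)]])
      then show ?thesis using dP Cf[of a a a 3] that(1) by (auto simp: f_def)
    qed
    show "\<exists>a1\<in>C. \<exists>a2\<in>C. a1 \<noteq> zeroS N \<and> a2 \<noteq> zeroS N \<and> diffS N a a2 = a1 \<and> leS N b1 a1 \<and>
        diffS N a a1 = a2 \<and> leS N b2 a2 \<and> meetS N a1 a2 = meetS N b1 b2"
      if "a \<in> C" "b1 \<in> C" "b2 \<in> C" "llS N (joinS N b1 b2) a" "a \<noteq> zeroS N" for a b1 b2
    proof -
      have m: "a \<in> carrier N" "b1 \<in> carrier N" "b2 \<in> carrier N" using that(1-3) C(2) by blast+
      have "\<exists>p. P a b1 b2 p"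
        using N[unfolded is_model_T3_iff, THEN conjunct2, THEN conjunct2, rule_format, OF m conjI[OF that(4,5)]]
        unfolding P_def by auto
      then have Ps: "P a b1 b2 (s a b1 b2)" by (rule sP)
      obtain a1 a2 where eq: "s a b1 b2 = (a1, a2)" by (cases "s a b1 b2")
      have "a1 \<in> C" "a2 \<in> C"
        using Cf[OF that(1-3), of 4] Cf[OF that(1-3), of 5] by (simp_all add: f_def eq)
      moreover have "a1 \<noteq> zeroS N \<and> a2 \<noteq> zeroS N \<and> diffS N a a2 = a1 \<and> leS N b1 a1 \<and>
          diffS N a a1 = a2 \<and> leS N b2 a2 \<and> meetS N a1 a2 = meetS N b1 b2"
        using Ps unfolding P_def eq prod.case by (elim conjE, intro conjI)
      ultimately show ?thesis by (intro bexI[of _ a1] bexI[of _ a2])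
    qed
  qed
  have gC: "is_embedding g M ?C"
    using g C(1) by (simp add: is_embedding_def)
  let ?k = "inv_into C h"
  \<comment> \<open>The Skolem hull \<open>C\<close> is copied into \<open>'u\<close> along the
    injection \<open>h\<close>.\<close>
  define N' :: "'u coh_structure" where "N' = \<lparr>carrier = h ` C, zeroS = h (zeroS N), oneS = h (oneS N),
    joinS = \<lambda>x y. h (joinS N (?k x) (?k y)), meetS = \<lambda>x y. h (meetS N (?k x) (?k y)),
    diffS = \<lambda>x y. h (diffS N (?k x) (?k y))\<rparr>"
  have hN': "is_embedding h ?C N'"
    using h by (simp add: is_embedding_def N'_def)
  then have "is_model N' T3" by (rule is_model_iso[OF model]) (simp add: N'_def)
  then show ?thesis using is_embedding_comp[OF M gC hN'] by blast
qed

text \<open>The path model lives over sets of paths labelled by prime ideals, a different type from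
  \<open>'u\<close>. The Skolem hull of the image of \<open>M\<close> brings it back.\<close>

lemma extends_to_T3:
  fixes M :: "'u coh_structure"
  assumes "infinite (UNIV :: 'u set)" and M: "is_model M V3_theory"
  shows "\<exists>(N :: 'u coh_structure) f. is_model N T3 \<and> is_embedding f M N"
proof -
  interpret M: coheyting M by standard (fact M)
  interpret P: poset_algebra M.primes "(\<subseteq>)" "M.rep ` M.L" by (rule M.rep_poset_algebra)
  show ?thesis
    using loewenheim_skolem[OF assms(1) tree_model.tree_model_T3 M.struct
        is_embedding_comp[OF M.struct M.rep_embedding P.emb_embedding]] .
qed

theorem theorem6p3:
  assumes "infinite (UNIV :: 'u set)"
  shows "model_completion TYPE('u) (V3_theory \<union> {axiom_D3, axiom_S3}) V3_theory"
  unfolding model_completion_def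
proof (intro conjI allI impI)
  show "is_model M V3_theory" if "is_model M T3" for M :: "'u coh_structure"
    using that by (auto simp: is_model_def)
  show "\<exists>(N :: 'u coh_structure) f. is_model N T3 \<and> is_embedding f M N"
    if "is_model M V3_theory" for M :: "'u coh_structure"
    by (rule extends_to_T3[OF assms that])
  show "sat N1 (f1 \<circ> e) \<phi> = sat N2 (f2 \<circ> e) \<phi>"
    if "is_model M V3_theory \<and> is_model N1 T3 \<and> is_model N2 T3 \<and>
      is_embedding f1 M N1 \<and> is_embedding f2 M N2 \<and> range e \<subseteq> carrier M"
    for M N1 N2 :: "'u coh_structure" and f1 f2 e \<phi>
    using diagram_complete[of M N1 N2 f1 f2 e \<phi>] that by blast
qed (rule is_theory_axioms)+

end
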